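(* Fix integers $d\ge 1$, $t\ge 2$ and $1\le r\le t-1$. Let $X_t^d,X_{t-r}^d\subset\mathbb{P}^n$ be two arithmetically Cohen-Macaulay codimension $2$ subschemes defined by the maximal minors of a $t\times(t+1)$ (respectively $(t-r)\times(t-r+1)$) matrix $M_t^d$ (respectively $M_{t-r}^d$). Assume that $$M_{t-r}^d=\begin{pmatrix} F_1^1&F_1^2&\cdots&F_1^{t-r+1}\\ F_2^1&F_2^2&\cdots&F_2^{t-r+1}\\ \vdots&\vdots&&\vdots\\ F_{t-r}^1&F_{t-r}^2&\cdots&F_{t-r}^{t-r+1}\end{pmatrix}$$ and $$M_t^d=\begin{pmatrix} G_1^1&G_1^2&\cdots&G_1^{r+1}&F_1^1&\cdots&F_{t-r}^1\\ G_2^1&G_2^2&\cdots&G_2^{r+1}&F_1^2&\cdots&F_{t-r}^2\\ \vdots&\vdots&&\vdots&\vdots&&\vdots\\ G_{t-r+1}^1&G_{t-r+1}^2&\cdots&G_{t-r+1}^{r+1}&F_1^{t-r+1}&\cdots&F_{t-r}^{t-r+1}\\ G_{t-r+2}^1&G_{t-r+2}^2&\cdots&G_{t-r+2}^{r+1}&0&\cdots&0\\ \vdots&\vdots&&\vdots&\vdots&&\vdots\\ G_t^1&G_t^2&\cdots&G_t^{r+1}&0&\cdots&0\end{pmatrix},$$ where the $F_i^j$ and $G_i^j$ are homogeneous polynomials of degree $d$. Then $Y_{t,r}^d=X_t^d\cap X_{t-r}^d\subset\mathbb{P}^n$ is an arithmetically Gorenstein subscheme of codimension $3$, and its homogeneous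 ideal $I(Y_{t,r}^d)$ has a minimal free $R$-resolution of the following type: $$0\to R(-d(2t-r+1))\to R(-d(t+1))^{t-r+1}\oplus R(-d(t-r+1))^{t-r}\to R(-td)^{t-r}\oplus R(-d(t-r))^{t-r+1}\to I(Y_{t,r}^d)\to 0.$$ In particular, $$\deg(Y_{t,r}^d)=\binom{d(2t-r+1)}{3}-(t-r+1)\binom{d(t+1)}{3}+(t-r+1)\binom{d(t-r)}{3}+(t-r)\binom{dt}{3}-(t-r)\binom{d(t-r+1)}{3}.$$
   Context: $\mathbb{P}^n$ is projective space over an algebraically closed field $K$ of characteristic zero and $R=K[X_0,\ldots,X_n]$. A subscheme means an equidimensional closed subscheme, with saturated homogeneous ideal $I(X)$; "defined by the maximal minors" means that $I(X)$ is generated by them. $X$ is arithmetically Cohen-Macaulay if $R/I(X)$ is a Cohen-Macaulay ring. A closed subscheme $X$ of codimension $c$ is arithmetically Gorenstein if $I(X)$ has a minimal free graded $R$-resolution $0\to R(-m)\to F_{c-1}\to\cdots\to F_1\to I(X)\to 0$ for some integer $m$, i.e. $X$ is arithmetically Cohen-Macaulay and the last module in the resolution has rank one.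
   Formalization: Assumes in addition that X_t and X_{t-r} have no common irreducible component and that n ≥ 3; without these the claim fails (X_{t-r} can be a line contained in X_t, and for n = 2 there is no codimension 3 subscheme), and both are forced by Y having codimension 3. *)

theory Defs
  imports
    "HOL-Library.Poly_Mapping"
    "HOL-Library.Cardinality"
    "HOL-Library.Extended_Nat"
    "HOL-Algebra.QuotRing"
    "HOL-Algebra.Ring_Divisibility"
    "HOL-Computational_Algebra.Polynomial"
    "Jordan_Normal_Form.Determinant"
    "Jordan_Normal_Form.DL_Submatrix"
    "Jordan_Normal_Form.VS_Connect"
    "Jordan_Normal_Form.Matrix_Kernel"
begin

section \<open>Commutative algebra\<close>

text \<open>The supremum of the lengths \<open>k\<close> of the strict chains
  \<open>P\<^sub>0 \<subset> P\<^sub>1 \<subset> \<dots> \<subset> P\<^sub>k\<close> in a family of sets.\<close>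

definition chain_length :: "'a set set \<Rightarrow> enat" where
  "chain_length S =
     (SUP Ps \<in> {Ps. Ps \<noteq> [] \<and> set Ps \<subseteq> S \<and> sorted_wrt (\<subset>) Ps}. enat (length Ps - 1))"

definition height :: "('a, 'b) ring_scheme \<Rightarrow> 'a set \<Rightarrow> enat" where
  "height A P = chain_length {Q. primeideal Q A \<and> Q \<subseteq> P}"

definition regular_sequence :: "('a, 'b) ring_scheme \<Rightarrow> 'a list \<Rightarrow> bool" where
  "regular_sequence A xs \<longleftrightarrow>
     set xs \<subseteq> carrier A \<and> Idl\<^bsub>A\<^esub> (set xs) \<noteq> carrier A \<and>
     (\<forall>i < length xs. \<forall>a \<in> carrier A.
        xs ! i \<otimes>\<^bsub>A\<^esub> a \<in> Idl\<^bsub>A\<^esub> (set (take i xs)) \<longrightarrow> a \<in> Idl\<^bsub>A\<^esub> (set (take i xs)))"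

definition depth :: "('a, 'b) ring_scheme \<Rightarrow> 'a set \<Rightarrow> enat" where
  "depth A J = (SUP xs \<in> {xs. regular_sequence A xs \<and> set xs \<subseteq> J}. enat (length xs))"

text \<open>Eisenbud's definition, free of localisations: for a maximal ideal \<open>m\<close> of a Noetherian
  ring \<open>A\<close>, \<open>depth A m\<close> and \<open>height A m\<close> are the depth and the dimension of the local
  ring of \<open>A\<close> at \<open>m\<close>.\<close>

definition cohen_macaulay_ring :: "('a, 'b) ring_scheme \<Rightarrow> bool" where
  "cohen_macaulay_ring A \<longleftrightarrow>
     cring A \<and> noetherian_ring A \<and> (\<forall>m. maximalideal m A \<longrightarrow> depth A m = height A m)"


section \<open>Homogeneous polynomials and ideals\<close>

text \<open>The whole type \<open>('v, 'k) mpoly\<close> is the polynomial ring over \<open>'k\<close> whose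
  variables are indexed by the finite type \<open>'v\<close>; thus \<open>CARD('v) = n + 1\<close> gives
  \<open>K[X\<^sub>0,\<dots>,X\<^sub>n]\<close>. Its ring structure, as an object of HOL-Algebra, is
  \<^term>\<open>class_ring\<close>.\<close>

type_synonym ('v, 'k) mpoly = "('v \<Rightarrow>\<^sub>0 nat) \<Rightarrow>\<^sub>0 'k"

definition Var :: "'v \<Rightarrow> ('v, 'k::comm_ring_1) mpoly" where
  "Var i = Poly_Mapping.single (Poly_Mapping.single i 1) 1"

text \<open>The degree is an integer because resolutions involve arbitrary integer twists; in negative
  degree only \<open>0\<close> is homogeneous, and \<open>0\<close> is homogeneous of every degree.\<close>

definition homogeneous :: "int \<Rightarrow> ('v::finite, 'k::comm_ring_1) mpoly \<Rightarrow> bool" where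
  "homogeneous d p \<longleftrightarrow>
     (\<forall>m \<in> Poly_Mapping.keys p. int (\<Sum>i\<in>UNIV. Poly_Mapping.lookup m i) = d)"

definition irrelevant_ideal :: "('v::finite, 'k::comm_ring_1) mpoly set" where
  "irrelevant_ideal = Idl\<^bsub>class_ring\<^esub> (Set.range Var)"

definition homogeneous_ideal :: "('v::finite, 'k::comm_ring_1) mpoly set \<Rightarrow> bool" where
  "homogeneous_ideal I \<longleftrightarrow>
     ideal I class_ring \<and> I = Idl\<^bsub>class_ring\<^esub> {f \<in> I. \<exists>d. homogeneous d f}"

definition saturation :: "('v::finite, 'k::comm_ring_1) mpoly set \<Rightarrow> ('v, 'k) mpoly set" where
  "saturation I = {f. \<forall>i. \<exists>k. Var i ^ k * f \<in> I}"


section \<open>Closed subschemes of projective space\<close>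

text \<open>A closed subscheme \<open>X\<close> is represented by its saturated homogeneous ideal \<open>I(X)\<close>.
  The points of projective space are the homogeneous primes not containing the irrelevant ideal;
  they correspond to the irreducible closed subsets, with inclusions reversed.\<close>

definition proj_points :: "('v::finite, 'k::comm_ring_1) mpoly set set" where
  "proj_points =
     {P. homogeneous_ideal P \<and> primeideal P class_ring \<and> \<not> irrelevant_ideal \<subseteq> P}"

definition points_of :: "('v::finite, 'k::comm_ring_1) mpoly set \<Rightarrow> ('v, 'k) mpoly set set" where
  "points_of I = {P \<in> proj_points. I \<subseteq> P}"

text \<open>The generic points of the irreducible components.\<close>

definition components :: "('v::finite, 'k::comm_ring_1) mpoly set \<Rightarrow> ('v, 'k) mpoly set set" where
  "components I = {P \<in> points_of I. \<forall>Q \<in> points_of I. Q \<subseteq> P \<longrightarrow> Q = P}"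

text \<open>The topological codimension of \<open>X\<close> in projective space (\<open>\<infinity>\<close> for the empty
  subscheme).\<close>

definition codimension :: "('v::finite, 'k::comm_ring_1) mpoly set \<Rightarrow> enat" where
  "codimension I = (INF P \<in> points_of I. chain_length {Q \<in> proj_points. Q \<subseteq> P})"

definition equidimensional :: "('v::finite, 'k::comm_ring_1) mpoly set \<Rightarrow> bool" where
  "equidimensional I \<longleftrightarrow>
     (\<exists>k. \<forall>P \<in> components I. chain_length {Q \<in> proj_points. P \<subseteq> Q} = k)"

definition is_subscheme :: "('v::finite, 'k::comm_ring_1) mpoly set \<Rightarrow> bool" where
  "is_subscheme I \<longleftrightarrow> homogeneous_ideal I \<and> saturation I = I \<and> equidimensional I"

text \<open>The scheme-theoretic intersection.\<close>

definition scheme_Int ::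
    "('v::finite, 'k::comm_ring_1) mpoly set \<Rightarrow> ('v, 'k) mpoly set \<Rightarrow> ('v, 'k) mpoly set" where
  "scheme_Int I J = saturation (I <+>\<^bsub>class_ring\<^esub> J)"

definition arithmetically_cohen_macaulay :: "('v::finite, 'k::comm_ring_1) mpoly set \<Rightarrow> bool" where
  "arithmetically_cohen_macaulay I \<longleftrightarrow> cohen_macaulay_ring (class_ring Quot I)"

definition maximal_minors :: "'a::comm_ring_1 mat \<Rightarrow> 'a set" where
  "maximal_minors A =
     {det (submatrix A UNIV J) | J. J \<subseteq> {..<dim_col A} \<and> card J = dim_row A}"

definition defined_by_maximal_minors ::
    "('v::finite, 'k::comm_ring_1) mpoly set \<Rightarrow> ('v, 'k) mpoly mat \<Rightarrow> bool" where
  "defined_by_maximal_minors I M \<longleftrightarrow> I = Idl\<^bsub>class_ring\<^esub> (maximal_minors M)"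


section \<open>Graded free resolutions\<close>

text \<open>A list of integers \<open>[a\<^sub>1,\<dots>,a\<^sub>k]\<close> stands for the graded free module
  \<open>R(-a\<^sub>1) \<oplus> \<dots> \<oplus> R(-a\<^sub>k)\<close>. The following are the matrices of the degree-preserving
  homomorphisms from the module given by \<open>b\<close> to the module given by \<open>a\<close>.\<close>

definition graded_hom ::
    "int list \<Rightarrow> int list \<Rightarrow> ('v::finite, 'k::comm_ring_1) mpoly mat \<Rightarrow> bool" where
  "graded_hom b a A \<longleftrightarrow>
     A \<in> carrier_mat (length a) (length b) \<and>
     (\<forall>p < length a. \<forall>q < length b. homogeneous (b ! q - a ! p) (A $$ (p, q)))"

definition mat_image :: "'a::comm_ring_1 mat \<Rightarrow> 'a vec set" where
  "mat_image A = (\<lambda>v. A *\<^sub>v v) ` carrier_vec (dim_col A)"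

text \<open>The complex \<open>0 \<rightarrow> F\<^sub>c \<rightarrow> \<dots> \<rightarrow> F\<^sub>1 \<rightarrow> I \<rightarrow> 0\<close>, where \<open>Fs = [F\<^sub>1,\<dots>,F\<^sub>c]\<close> and
  \<open>\<phi>s\<close> lists the differentials: \<open>\<phi>s ! 0\<close> is the map from \<open>F\<^sub>1\<close> onto \<open>I\<close>, written as a
  one-row matrix with values in \<open>R\<close>, and \<open>\<phi>s ! i\<close> is the map from \<open>F\<^bsub>i+1\<^esub>\<close> to \<open>F\<^sub>i\<close>.
  The last clause is minimality.\<close>

definition minimal_free_resolution ::
    "('v::finite, 'k::comm_ring_1) mpoly set \<Rightarrow> int list list \<Rightarrow> ('v, 'k) mpoly mat list \<Rightarrow> bool"
  where
  "minimal_free_resolution I Fs \<phi>s \<longleftrightarrow>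
     homogeneous_ideal I \<and> Fs \<noteq> [] \<and> length \<phi>s = length Fs \<and>
     (\<forall>i < length Fs. graded_hom (Fs ! i) (([0] # Fs) ! i) (\<phi>s ! i)) \<and>
     (\<lambda>v. v $ 0) ` mat_image (\<phi>s ! 0) = I \<and>
     (\<forall>i. Suc i < length Fs \<longrightarrow> mat_kernel (\<phi>s ! i) = mat_image (\<phi>s ! Suc i)) \<and>
     mat_kernel (last \<phi>s) = {0\<^sub>v (length (last Fs))} \<and>
     (\<forall>i. 0 < i \<and> i < length Fs \<longrightarrow> elements_mat (\<phi>s ! i) \<subseteq> irrelevant_ideal)"

definition has_minimal_free_resolution ::
    "('v::finite, 'k::comm_ring_1) mpoly set \<Rightarrow> int list list \<Rightarrow> bool" where
  "has_minimal_free_resolution I Fs \<longleftrightarrow> (\<exists>\<phi>s. minimal_free_resolution I Fs \<phi>s)"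

text \<open>That the length of the resolution equals the codimension is, by Auslander-Buchsbaum, the
  arithmetically Cohen-Macaulay condition; the last module is \<open>R(-m)\<close>.\<close>

definition arithmetically_gorenstein :: "('v::finite, 'k::comm_ring_1) mpoly set \<Rightarrow> bool" where
  "arithmetically_gorenstein I \<longleftrightarrow>
     (\<exists>Fs m. codimension I = enat (length Fs) \<and> has_minimal_free_resolution I Fs \<and>
             last Fs = [m])"


section \<open>Degree of a subscheme\<close>

definition const_scale :: "'k::comm_ring_1 \<Rightarrow> ('v, 'k) mpoly \<Rightarrow> ('v, 'k) mpoly" where
  "const_scale c p = Poly_Mapping.single 0 c * p"

text \<open>The dimension over the ground field of the degree \<open>m\<close> part of \<open>R/I\<close>.\<close>

definition hilbert_function :: "('v::finite, 'k::field) mpoly set \<Rightarrow> nat \<Rightarrow> nat" where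
  "hilbert_function I m =
     vector_space.dim const_scale {f :: ('v, 'k) mpoly. homogeneous (int m) f} -
     vector_space.dim const_scale {f \<in> I. homogeneous (int m) f}"

definition hilbert_polynomial :: "('v::finite, 'k::field) mpoly set \<Rightarrow> rat poly" where
  "hilbert_polynomial I =
     (THE p. \<forall>\<^sub>F m in sequentially. of_nat (hilbert_function I m) = poly p (of_nat m))"

definition scheme_degree :: "('v::finite, 'k::field) mpoly set \<Rightarrow> rat" where
  "scheme_degree I =
     fact (degree (hilbert_polynomial I)) * lead_coeff (hilbert_polynomial I)"

end

theory Submission
  imports Defs "HOL-Library.Function_Algebras"
begin

text \<open>Put \<open>s = t - r\<close>, let \<open>C\<close> be the cokernel of the \<open>s \<times> (s + 1)\<close> matrix \<open>F\<close>, and let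
  \<open>\<delta>\<^sub>k\<close> be the maximal minor of \<open>M_t\<close> without the column that contains row \<open>k\<close> of \<open>F\<close>; the other
  maximal minors of \<open>M_t\<close> already lie in \<open>I(X\<^bsub>t-r\<^esub>)\<close>. Cramer's rule shows that
  \<open>\<delta>\<^sub>l w = (\<Sum>\<^sub>k \<delta>\<^sub>k w\<^sub>k) e\<^sub>l\<close> in \<open>C\<close>, so that \<open>\<delta>\<close> induces a map \<open>C \<rightarrow> R/I(X\<^bsub>t-r\<^esub>)\<close> whose kernel is
  killed by \<open>J = I(X\<^sub>t) + I(X\<^bsub>t-r\<^esub>)\<close>. The two schemes have no common component, so \<open>J\<close> has codimension
  at least 3, while \<open>C\<close> has depth \<open>n - 1\<close>; hence the map is injective, with cokernel \<open>R/J\<close>, and the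
  mapping cone of the Hilbert-Burch complex of \<open>F\<close> and its dual resolves \<open>R/J\<close>. The resolution gives
  \<open>R/J\<close> depth \<open>n - 2\<close>, measured by Koszul cohomology, so \<open>J\<close> is saturated and all its components
  have codimension 3. The degree is read off the Hilbert polynomial.\<close>

section \<open>Ideals and free modules\<close>

text \<open>Depth and codimension meet in one principle. A nonzero class killed by a graded ideal
  \<open>I\<close> yields an associated prime containing \<open>I\<close>; if Koszul cohomology
  vanishes in degrees up to \<open>q\<close>, that prime starts a chain of \<open>q + 1\<close>
  points. Chains of points have at most \<open>n + 1\<close> members, since algebraically
  independent polynomials can be counted against monomials. Too large a codimension of
  \<open>I\<close> therefore forces the class to be zero. Each map of a resolution costs one degree
  of vanishing, which gives \<open>n\<close> for the cokernel of the transpose of \<open>F\<close>,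
  \<open>n - 1\<close> for \<open>C\<close> and \<open>n - 2\<close> for \<open>R/J\<close>.
  \<open>J\<close> has codimension at least 3 because a point of both schemes is not generic in one
  of them, so that a chain of two steps below a smaller point can be extended. The dual complex has
  the ranks of the Hilbert-Burch complex in reverse order, so the cone has ranks \<open>1\<close>,
  \<open>2 s + 1\<close>, \<open>2 s + 1\<close>, \<open>1\<close>; its last twist is
  \<open>d (t + 1)\<close>, the twist of the source of \<open>F\<close>, plus \<open>s d\<close>,
  the degree of the minors. Characteristic zero enters through the infinity of the field, which
  provides linear forms outside finitely many primes.\<close>

definition ring_ideal :: "'a::comm_ring_1 set \<Rightarrow> bool" where
  "ring_ideal I \<longleftrightarrow> 0 \<in> I \<and> (\<forall>a\<in>I. \<forall>b\<in>I. a + b \<in> I) \<and> (\<forall>a\<in>I. \<forall>r. r * a \<in> I)"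

definition prime_ideal :: "'a::comm_ring_1 set \<Rightarrow> bool" where
  "prime_ideal I \<longleftrightarrow> ring_ideal I \<and> 1 \<notin> I \<and> (\<forall>a b. a * b \<in> I \<longrightarrow> a \<in> I \<or> b \<in> I)"

lemma ring_ideal_0: "ring_ideal I \<Longrightarrow> 0 \<in> I"
  and ring_ideal_add: "ring_ideal I \<Longrightarrow> a \<in> I \<Longrightarrow> b \<in> I \<Longrightarrow> a + b \<in> I"
  and ring_ideal_mult: "ring_ideal I \<Longrightarrow> a \<in> I \<Longrightarrow> r * a \<in> I"
  by (auto simp: ring_ideal_def)

lemma ring_ideal_mult2: "ring_ideal I \<Longrightarrow> a \<in> I \<Longrightarrow> a * r \<in> I"
  using ring_ideal_mult[of I a r] by (simp add: mult.commute)

lemma ring_ideal_minus: "ring_ideal I \<Longrightarrow> a \<in> I \<Longrightarrow> - a \<in> I"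
  using ring_ideal_mult[of I a "-1"] by simp

lemma ring_ideal_diff: "ring_ideal I \<Longrightarrow> a \<in> I \<Longrightarrow> b \<in> I \<Longrightarrow> a - b \<in> I"
  using ring_ideal_add[of I a "-b"] ring_ideal_minus[of I b] by simp

lemma ring_ideal_sum: "ring_ideal I \<Longrightarrow> (\<And>x. x \<in> A \<Longrightarrow> f x \<in> I) \<Longrightarrow> sum f A \<in> I"
  by (induction A rule: infinite_finite_induct) (auto intro: ring_ideal_0 ring_ideal_add)

text \<open>The ring is a whole type, so the carrier conditions of HOL-Algebra are void and plain
  closure conditions describe its ideals. Later arguments use \<open>ring_ideal\<close>; this
  equivalence links them to the given definitions.\<close>

lemma ideal_class_ring: "ideal I (class_ring :: 'a::comm_ring_1 ring) \<longleftrightarrow> ring_ideal I"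
proof
  assume "ideal I (class_ring :: 'a ring)"
  then interpret ideal I "class_ring :: 'a ring" .
  show "ring_ideal I"
    using zero_closed a_closed I_l_closed by (auto simp: ring_ideal_def)
next
  assume I: "ring_ideal I"
  show "ideal I (class_ring :: 'a ring)"
  proof (rule idealI)
    show "ring (class_ring :: 'a ring)" by (rule class_ring.ring_axioms)
    have "group (add_monoid (class_ring :: 'a ring))"
      using abelian_group.a_group[OF class_ring.is_abelian_group] by simp
    then show "subgroup I (add_monoid (class_ring :: 'a ring))"
    proof (rule group.subgroupI)
      fix a assume a: "a \<in> I"
      have "a_inv (class_ring :: 'a ring) a = - a" by (simp add: class_ring_simps)
      then show "inv\<^bsub>add_monoid (class_ring :: 'a ring)\<^esub> a \<in> I"
        using ring_ideal_minus[OF I a] by (simp add: a_inv_def)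
    qed (use I in \<open>auto simp: ring_ideal_def\<close>)
  qed (use I in \<open>auto simp: ring_ideal_def mult.commute\<close>)
qed

lemma primeideal_class_ring: "primeideal I (class_ring :: 'a::comm_ring_1 ring) \<longleftrightarrow> prime_ideal I"
proof
  assume "primeideal I (class_ring :: 'a ring)"
  then interpret primeideal I "class_ring :: 'a ring" .
  have "ring_ideal I" using ideal_axioms by (simp add: ideal_class_ring)
  moreover have "1 \<notin> I" using one_imp_carrier I_notcarr by auto
  ultimately show "prime_ideal I"
    using I_prime by (auto simp: prime_ideal_def)
next
  assume I: "prime_ideal I"
  then have "ideal I (class_ring :: 'a ring)" by (simp add: ideal_class_ring prime_ideal_def)
  then show "primeideal I (class_ring :: 'a ring)"
    by (rule primeidealI) (use I class_cring.cring_axioms in \<open>auto simp: prime_ideal_def\<close>)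
qed

definition gen_ideal :: "'a::comm_ring_1 set \<Rightarrow> 'a set" where
  "gen_ideal S = \<Inter>{I. ring_ideal I \<and> S \<subseteq> I}"

lemma genideal_class_ring: "Idl\<^bsub>class_ring\<^esub> S = gen_ideal S"
  by (simp add: genideal_def ideal_class_ring gen_ideal_def)

lemma ring_ideal_gen: "ring_ideal (gen_ideal (S :: 'a::comm_ring_1 set))"
  unfolding gen_ideal_def by (auto simp: ring_ideal_def)

lemma gen_ideal_superset: "S \<subseteq> gen_ideal (S :: 'a::comm_ring_1 set)"
  unfolding gen_ideal_def by auto

lemma gen_ideal_minimal: "ring_ideal I \<Longrightarrow> S \<subseteq> I \<Longrightarrow> gen_ideal (S :: 'a::comm_ring_1 set) \<subseteq> I"
  unfolding gen_ideal_def by auto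

lemma ring_ideal_image_combination:
  fixes g :: "'i \<Rightarrow> 'a::comm_ring_1"
  shows "ring_ideal {\<Sum>i\<in>A. c i * g i |c. True}"
proof -
  have "\<exists>c. 0 = (\<Sum>i\<in>A. c i * g i)" by (rule exI[of _ "\<lambda>_. 0"]) simp
  moreover have "\<exists>e. (\<Sum>i\<in>A. c i * g i) + (\<Sum>i\<in>A. d i * g i) = (\<Sum>i\<in>A. e i * g i)" for c d
    by (rule exI[of _ "\<lambda>i. c i + d i"]) (simp add: sum.distrib algebra_simps)
  moreover have "\<exists>e. r * (\<Sum>i\<in>A. c i * g i) = (\<Sum>i\<in>A. e i * g i)" for r c
    by (rule exI[of _ "\<lambda>i. r * c i"]) (simp add: sum_distrib_left mult.assoc)
  ultimately show ?thesis
    by (auto simp: ring_ideal_def)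
qed

lemma gen_ideal_image:
  fixes g :: "'i \<Rightarrow> 'a::comm_ring_1"
  assumes A: "finite A"
  shows "gen_ideal (g ` A) = {\<Sum>i\<in>A. c i * g i |c. True}"
proof
  have "g j \<in> {\<Sum>i\<in>A. c i * g i |c. True}" if "j \<in> A" for j
  proof -
    have "(\<Sum>i\<in>A. (if i = j then 1 else 0) * g i) = (\<Sum>i\<in>A. if i = j then g i else 0)"
      by (intro sum.cong) auto
    also have "\<dots> = g j" using A that by simp
    finally have "g j = (\<Sum>i\<in>A. (if i = j then 1 else 0) * g i)" by simp
    then show ?thesis
      by (intro CollectI exI[of _ "\<lambda>i. if i = j then 1 else 0"]) simp
  qed
  then show "gen_ideal (g ` A) \<subseteq> {\<Sum>i\<in>A. c i * g i |c. True}"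
    by (intro gen_ideal_minimal ring_ideal_image_combination) auto
  have "(\<Sum>i\<in>A. c i * g i) \<in> gen_ideal (g ` A)" for c
    by (rule ring_ideal_sum[OF ring_ideal_gen], rule ring_ideal_mult[OF ring_ideal_gen],
        rule subsetD[OF gen_ideal_superset], rule imageI)
  then show "{\<Sum>i\<in>A. c i * g i |c. True} \<subseteq> gen_ideal (g ` A)"
    by auto
qed

text \<open>Functions are an abelian group under pointwise operations, so the generic module locale
  applies to vectors of every rank at once.\<close>

definition smul :: "'a::comm_ring_1 \<Rightarrow> ('i \<Rightarrow> 'a) \<Rightarrow> 'i \<Rightarrow> 'a" where
  "smul a f = (\<lambda>j. a * f j)"

lemma smul_apply: "smul a f j = a * f j"
  by (simp add: smul_def)

interpretation fmod: Modules.module "smul :: 'a::comm_ring_1 \<Rightarrow> ('i \<Rightarrow> 'a) \<Rightarrow> 'i \<Rightarrow> 'a"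
  by standard (auto simp: fun_eq_iff smul_apply algebra_simps)

text \<open>The free module of rank \<open>k\<close>, as a submodule of one fixed type.\<close>

definition Fr :: "nat \<Rightarrow> (nat \<Rightarrow> 'a::comm_ring_1) set" where
  "Fr k = {w. \<forall>j\<ge>k. w j = 0}"

lemma subspace_Fr: "fmod.subspace (Fr k)"
  by (auto simp: fmod.subspace_def Fr_def smul_apply)

text \<open>The annihilator of the class of \<open>w\<close> modulo \<open>N\<close>; prime ideals
  of this form are the associated primes of the quotient by \<open>N\<close>.\<close>

definition colon :: "('i \<Rightarrow> 'a::comm_ring_1) set \<Rightarrow> ('i \<Rightarrow> 'a) \<Rightarrow> 'a set" where
  "colon N w = {a. smul a w \<in> N}"

lemma ring_ideal_colon:
  assumes N: "fmod.subspace N"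
  shows "ring_ideal (colon N w)"
  unfolding ring_ideal_def colon_def
proof (intro conjI ballI allI; unfold mem_Collect_eq)
  show "smul 0 w \<in> N" using fmod.subspace_0[OF N] by simp
next
  fix a b assume "smul a w \<in> N" "smul b w \<in> N"
  then show "smul (a + b) w \<in> N"
    using fmod.subspace_add[OF N] by (simp add: fmod.scale_left_distrib)
next
  fix a r assume "smul a w \<in> N"
  then show "smul (r * a) w \<in> N"
    using fmod.subspace_scale[OF N, of "smul a w" r] by simp
qed

section \<open>Graded polynomials\<close>

definition mdeg :: "('v::finite \<Rightarrow>\<^sub>0 nat) \<Rightarrow> nat" where
  "mdeg m = (\<Sum>i\<in>UNIV. Poly_Mapping.lookup m i)"

lemma mdeg_add [simp]: "mdeg (m + m') = mdeg m + mdeg m'"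
  by (simp add: mdeg_def lookup_add sum.distrib)

lemma mdeg_0 [simp]: "mdeg 0 = 0"
  by (simp add: mdeg_def)

lemma mdeg_single [simp]: "mdeg (Poly_Mapping.single i a) = a"
  by (simp add: mdeg_def lookup_single when_def)

lemma mdeg_eq_0: "mdeg m = 0 \<longleftrightarrow> m = 0"
  by (auto simp: mdeg_def intro!: poly_mapping_eqI)

lemma homogeneous_iff:
  "homogeneous (int e) p \<longleftrightarrow> (\<forall>m. Poly_Mapping.lookup p m \<noteq> 0 \<longrightarrow> mdeg m = e)"
  by (auto simp: homogeneous_def mdeg_def in_keys_iff simp flip: of_nat_sum)

lemma homogeneous_neg: "d < 0 \<Longrightarrow> homogeneous d p \<longleftrightarrow> p = 0"
proof -
  have "int (sum (Poly_Mapping.lookup m) UNIV) \<ge> 0" for m :: "'a::finite \<Rightarrow>\<^sub>0 nat"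
    by (rule of_nat_0_le_iff)
  then show "d < 0 \<Longrightarrow> homogeneous d p \<longleftrightarrow> p = 0"
    unfolding homogeneous_def by (metis all_not_in_conv keys_eq_empty leD keys_zero)
qed

lemma homogeneous_0 [simp]: "homogeneous d 0"
  by (simp add: homogeneous_def)

lemma homogeneous_add: "homogeneous d p \<Longrightarrow> homogeneous d q \<Longrightarrow> homogeneous d (p + q)"
  using keys_add[of p q] unfolding homogeneous_def by blast

lemma homogeneous_uminus: "homogeneous d p \<Longrightarrow> homogeneous d (- p)"
  by (simp add: homogeneous_def in_keys_iff)

lemma homogeneous_diff: "homogeneous d p \<Longrightarrow> homogeneous d q \<Longrightarrow> homogeneous d (p - q)"
  using homogeneous_add[of d p "-q"] homogeneous_uminus[of d q] by simp

lemma homogeneous_sum: "(\<And>x. x \<in> A \<Longrightarrow> homogeneous d (f x)) \<Longrightarrow> homogeneous d (sum f A)"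
  by (induction A rule: infinite_finite_induct) (auto intro: homogeneous_add)

lemma poly_mapping_sum_single:
  fixes p :: "'a \<Rightarrow>\<^sub>0 'b::comm_monoid_add"
  shows "p = (\<Sum>m\<in>Poly_Mapping.keys p. Poly_Mapping.single m (Poly_Mapping.lookup p m))"
  by (rule poly_mapping_eqI) (auto simp: lookup_sum lookup_single when_def in_keys_iff)

lemma lookup_times:
  fixes p q :: "'a::monoid_add \<Rightarrow>\<^sub>0 'b::semiring_0"
  shows "Poly_Mapping.lookup (p * q) k = (\<Sum>a\<in>Poly_Mapping.keys p. \<Sum>b\<in>Poly_Mapping.keys q.
           if a + b = k then Poly_Mapping.lookup p a * Poly_Mapping.lookup q b else 0)"
proof -
  have "p * q = (\<Sum>a\<in>Poly_Mapping.keys p. Poly_Mapping.single a (Poly_Mapping.lookup p a))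
     * (\<Sum>b\<in>Poly_Mapping.keys q. Poly_Mapping.single b (Poly_Mapping.lookup q b))"
    using poly_mapping_sum_single[of p] poly_mapping_sum_single[of q] by simp
  also have "\<dots> = (\<Sum>a\<in>Poly_Mapping.keys p. \<Sum>b\<in>Poly_Mapping.keys q.
      Poly_Mapping.single (a + b) (Poly_Mapping.lookup p a * Poly_Mapping.lookup q b))"
    by (simp add: sum_product mult_single)
  finally show ?thesis
    by (simp add: lookup_sum lookup_single when_def)
qed

lemma lookup_single_times:
  fixes q :: "('v \<Rightarrow>\<^sub>0 nat) \<Rightarrow>\<^sub>0 'b::semiring_0"
  shows "Poly_Mapping.lookup (Poly_Mapping.single a c * q) (a + b) = c * Poly_Mapping.lookup q b"
proof (cases "c = 0")
  case False
  then have "Poly_Mapping.lookup (Poly_Mapping.single a c * q) (a + b)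
      = (\<Sum>b'\<in>Poly_Mapping.keys q. if b' = b then c * Poly_Mapping.lookup q b' else 0)"
    by (simp add: lookup_times)
  also have "\<dots> = c * Poly_Mapping.lookup q b"
    by (auto simp: in_keys_iff)
  finally show ?thesis .
qed simp

lemma homogeneous_mult:
  assumes "homogeneous d p" "homogeneous e q"
  shows "homogeneous (d + e) (p * q)"
  unfolding homogeneous_def
proof
  fix m assume "m \<in> Poly_Mapping.keys (p * q)"
  then have "(\<Sum>a\<in>Poly_Mapping.keys p. \<Sum>b\<in>Poly_Mapping.keys q.
           if a + b = m then Poly_Mapping.lookup p a * Poly_Mapping.lookup q b else 0) \<noteq> 0"
    by (simp add: in_keys_iff lookup_times)
  then obtain a where a: "a \<in> Poly_Mapping.keys p" "(\<Sum>b\<in>Poly_Mapping.keys q.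
           if a + b = m then Poly_Mapping.lookup p a * Poly_Mapping.lookup q b else 0) \<noteq> 0"
    by (rule sum.not_neutral_contains_not_neutral)
  from a(2) obtain b where "b \<in> Poly_Mapping.keys q" "a + b = m"
    by (rule sum.not_neutral_contains_not_neutral) (auto split: if_splits)
  note a(1) this
  with assms show "int (sum (Poly_Mapping.lookup m) UNIV) = d + e"
    by (auto simp: homogeneous_def lookup_add sum.distrib)
qed

lemma homogeneous_single: "homogeneous (int (mdeg m)) (Poly_Mapping.single m c)"
  by (simp add: homogeneous_iff lookup_single when_def)

lemma homogeneous_1 [simp]: "homogeneous 0 1"
  using homogeneous_single[of 0 1] by (simp add: single_one)

lemma homogeneous_Var [simp]: "homogeneous 1 (Var i)"
  using homogeneous_single[of "Poly_Mapping.single i 1"] unfolding Var_def by simp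

lemma homogeneous_prod:
  assumes "\<And>x. x \<in> A \<Longrightarrow> homogeneous (d x) (f x)"
  shows "homogeneous (sum d A) (prod f A)"
  using assms
proof (induction A rule: infinite_finite_induct)
  case (insert x F)
  then show ?case by (simp add: homogeneous_mult)
qed auto

definition hcomp :: "nat \<Rightarrow> ('v::finite, 'k::comm_ring_1) mpoly \<Rightarrow> ('v, 'k) mpoly" where
  "hcomp e = Poly_Mapping.mapp (\<lambda>m c. if mdeg m = e then c else 0)"

lemma lookup_hcomp:
  "Poly_Mapping.lookup (hcomp e p) m = (if mdeg m = e then Poly_Mapping.lookup p m else 0)"
  by (simp add: hcomp_def lookup_mapp when_def in_keys_iff)

lemma homogeneous_hcomp [simp]: "homogeneous (int e) (hcomp e p)"
  by (simp add: homogeneous_iff lookup_hcomp)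

lemma hcomp_homogeneous: "homogeneous (int d) p \<Longrightarrow> hcomp e p = (if e = d then p else 0)"
  by (rule poly_mapping_eqI) (auto simp: homogeneous_iff lookup_hcomp)

lemma hcomp_0 [simp]: "hcomp e 0 = 0"
  by (rule poly_mapping_eqI) (auto simp: lookup_hcomp)

lemma hcomp_add: "hcomp e (p + q) = hcomp e p + hcomp e q"
  by (rule poly_mapping_eqI) (auto simp: lookup_hcomp lookup_add)

lemma hcomp_sum: "hcomp e (sum f A) = (\<Sum>x\<in>A. hcomp e (f x))"
  by (induction A rule: infinite_finite_induct) (auto simp: hcomp_add)

lemma ex_hcomp_sum: "\<exists>b. \<forall>n\<ge>b. p = (\<Sum>e<n. hcomp e p)"
proof (intro exI allI impI)
  fix n assume n: "Suc (Max (insert 0 (mdeg ` Poly_Mapping.keys p))) \<le> n"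
  have "mdeg m < n" if "Poly_Mapping.lookup p m \<noteq> 0" for m
  proof -
    have "mdeg m \<in> insert 0 (mdeg ` Poly_Mapping.keys p)" using that by (simp add: in_keys_iff)
    then have "mdeg m \<le> Max (insert 0 (mdeg ` Poly_Mapping.keys p))" by (intro Max_ge) auto
    with n show ?thesis by simp
  qed
  then show "p = (\<Sum>e<n. hcomp e p)"
    by (intro poly_mapping_eqI) (auto simp: lookup_sum lookup_hcomp)
qed

lemma hcomp_mult:
  assumes p: "homogeneous (int d) p"
  shows "hcomp e (p * q) = (if d \<le> e then p * hcomp (e - d) q else 0)"
proof -
  obtain b where b: "\<forall>n\<ge>b. q = (\<Sum>e<n. hcomp e q)" using ex_hcomp_sum by blast
  define n where "n = max b (Suc e)"
  have q: "q = (\<Sum>e<n. hcomp e q)" using b by (simp add: n_def)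
  have h: "homogeneous (int (d + i)) (p * hcomp i q)" for i
    using homogeneous_mult[OF p homogeneous_hcomp[of i q]] by simp
  have "hcomp e (p * q) = hcomp e (\<Sum>i<n. p * hcomp i q)"
    by (subst q) (simp add: sum_distrib_left)
  also have "\<dots> = (\<Sum>i<n. if e = d + i then p * hcomp i q else 0)"
    by (simp add: hcomp_sum hcomp_homogeneous[OF h])
  also have "\<dots> = (\<Sum>i<n. if d \<le> e \<and> i = e - d then p * hcomp i q else 0)"
    by (intro sum.cong) auto
  also have "\<dots> = (if d \<le> e then p * hcomp (e - d) q else 0)"
  proof (cases "d \<le> e")
    case True
    then have "e - d < n" by (simp add: n_def)
    with True show ?thesis by simp
  qed simp
  finally show ?thesis .
qed

text \<open>Homogeneity as closure under components, the form used in all arguments;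
  \<open>homogeneous_ideal_iff\<close> identifies it with generation by homogeneous
  elements.\<close>

definition graded_ideal :: "('v::finite, 'k::comm_ring_1) mpoly set \<Rightarrow> bool" where
  "graded_ideal I \<longleftrightarrow> ring_ideal I \<and> (\<forall>f\<in>I. \<forall>e. hcomp e f \<in> I)"

lemma graded_idealD: "graded_ideal I \<Longrightarrow> ring_ideal I" "graded_ideal I \<Longrightarrow> f \<in> I \<Longrightarrow> hcomp e f \<in> I"
  by (auto simp: graded_ideal_def)

lemma ring_ideal_if_hcomp:
  assumes "ring_ideal I" "\<And>e. hcomp e f \<in> I"
  shows "f \<in> I"
  using ex_hcomp_sum[of f] ring_ideal_sum[of I _ "\<lambda>e. hcomp e f"] assms by (metis order_refl)

text \<open>Multiplication by a homogeneous polynomial only shifts components, so the elements of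
  the generated ideal whose components all stay in it form an ideal, and this ideal contains
  \<open>S\<close>.\<close>

lemma graded_ideal_gen:
  assumes S: "\<And>f. f \<in> S \<Longrightarrow> \<exists>d. homogeneous d f"
  shows "graded_ideal (gen_ideal (S :: ('v::finite, 'k::comm_ring_1) mpoly set))"
proof -
  let ?I = "gen_ideal S"
  define J where "J = {f \<in> ?I. \<forall>e. hcomp e f \<in> ?I}"
  have *: "hcomp e (r * f) \<in> ?I" if "\<forall>e. hcomp e f \<in> ?I" for r e f
  proof -
    obtain b where r: "r = (\<Sum>i<b. hcomp i r)" using ex_hcomp_sum by blast
    have "hcomp e (r * f) = (\<Sum>i<b. hcomp e (hcomp i r * f))"
      by (subst r) (simp add: sum_distrib_right hcomp_sum)
    also have "\<dots> \<in> ?I"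
      using that by (intro ring_ideal_sum ring_ideal_gen)
        (auto simp: hcomp_mult[OF homogeneous_hcomp] intro!: ring_ideal_mult ring_ideal_gen ring_ideal_0)
    finally show ?thesis .
  qed
  have "ring_ideal J"
    using * unfolding J_def ring_ideal_def
    by (auto simp: hcomp_add intro: ring_ideal_0 ring_ideal_add ring_ideal_mult ring_ideal_gen)
  moreover have "S \<subseteq> J"
  proof
    fix f assume f: "f \<in> S"
    then obtain d where d: "homogeneous d f" using S by blast
    have fI: "f \<in> ?I" using f gen_ideal_superset by blast
    have "hcomp e f \<in> ?I" for e
    proof (cases "d < 0")
      case True
      with d have "f = 0" by (simp add: homogeneous_neg)
      then show ?thesis by (simp add: ring_ideal_0 ring_ideal_gen)
    next
      case False
      then have "d = int (nat d)" by simp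
      then have "homogeneous (int (nat d)) f" using d by simp
      from hcomp_homogeneous[OF this] show ?thesis
        using fI by (simp add: ring_ideal_0 ring_ideal_gen)
    qed
    with fI show "f \<in> J" by (simp add: J_def)
  qed
  ultimately have "?I \<subseteq> J" by (rule gen_ideal_minimal)
  then show ?thesis using ring_ideal_gen[of S] by (auto simp: graded_ideal_def J_def)
qed

lemma gen_ideal_graded:
  assumes I: "graded_ideal I"
  shows "gen_ideal {f \<in> I. \<exists>d. homogeneous d f} = I"
proof
  show "gen_ideal {f \<in> I. \<exists>d. homogeneous d f} \<subseteq> I"
    using I by (intro gen_ideal_minimal) (auto simp: graded_ideal_def)
  show "I \<subseteq> gen_ideal {f \<in> I. \<exists>d. homogeneous d f}"
  proof
    fix f assume f: "f \<in> I"
    have "hcomp e f \<in> {f \<in> I. \<exists>d. homogeneous d f}" for e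
      using graded_idealD(2)[OF I f] homogeneous_hcomp by blast
    then show "f \<in> gen_ideal {f \<in> I. \<exists>d. homogeneous d f}"
      by (rule ring_ideal_if_hcomp[OF ring_ideal_gen subsetD[OF gen_ideal_superset]])
  qed
qed

lemma homogeneous_ideal_iff: "homogeneous_ideal I \<longleftrightarrow> graded_ideal I"
proof
  assume "homogeneous_ideal I"
  then have "I = gen_ideal {f \<in> I. \<exists>d. homogeneous d f}"
    unfolding homogeneous_ideal_def genideal_class_ring by (rule conjunct2)
  moreover have "graded_ideal (gen_ideal {f \<in> I. \<exists>d. homogeneous d f})"
    by (rule graded_ideal_gen) auto
  ultimately show "graded_ideal I" by metis
next
  assume I: "graded_ideal I"
  then show "homogeneous_ideal I"
    unfolding homogeneous_ideal_def genideal_class_ring ideal_class_ring gen_ideal_graded[OF I]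
    by (auto simp: graded_ideal_def)
qed

lemma irrelevant_ideal_eq: "irrelevant_ideal = gen_ideal (Set.range Var)"
  unfolding irrelevant_ideal_def genideal_class_ring ..

text \<open>For a graded ideal primality may be tested on homogeneous elements: of a product compare
  the components of lowest degree outside the ideal.\<close>

lemma prime_idealI_graded:
  fixes I :: "('v::finite, 'k::comm_ring_1) mpoly set"
  assumes I: "graded_ideal I" and one: "1 \<notin> I"
    and prime: "\<And>a b d e. homogeneous (int d) a \<Longrightarrow> homogeneous (int e) b \<Longrightarrow> a * b \<in> I \<Longrightarrow> a \<in> I \<or> b \<in> I"
  shows "prime_ideal I"
proof -
  have R: "ring_ideal I" using I by (rule graded_idealD)
  have "a \<in> I \<or> b \<in> I" if ab: "a * b \<in> I" for a b
  proof (rule ccontr)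
    assume "\<not> (a \<in> I \<or> b \<in> I)"
    then have ex: "\<exists>i. hcomp i a \<notin> I" "\<exists>j. hcomp j b \<notin> I"
      using ring_ideal_if_hcomp[OF R] by blast+
    define i where "i = (LEAST i. hcomp i a \<notin> I)"
    define j where "j = (LEAST j. hcomp j b \<notin> I)"
    have i: "hcomp i a \<notin> I" "\<And>i'. i' < i \<Longrightarrow> hcomp i' a \<in> I"
      using LeastI_ex[OF ex(1)] not_less_Least unfolding i_def by blast+
    have j: "hcomp j b \<notin> I" "\<And>j'. j' < j \<Longrightarrow> hcomp j' b \<in> I"
      using LeastI_ex[OF ex(2)] not_less_Least unfolding j_def by blast+
    obtain n where n: "\<forall>k\<ge>n. a = (\<Sum>e<k. hcomp e a)" using ex_hcomp_sum by blast
    define k where "k = max n (Suc (i + j))"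
    have a: "a = (\<Sum>e<k. hcomp e a)" using n by (simp add: k_def)
    have "hcomp (i + j) (a * b) = (\<Sum>e<k. hcomp (i + j) (hcomp e a * b))"
      by (subst a) (simp add: sum_distrib_right hcomp_sum)
    also have "\<dots> = (\<Sum>e<k. if e \<le> i + j then hcomp e a * hcomp (i + j - e) b else 0)"
      by (simp add: hcomp_mult[OF homogeneous_hcomp])
    also have "\<dots> = hcomp i a * hcomp j b
        + (\<Sum>e\<in>{..<k} - {i}. if e \<le> i + j then hcomp e a * hcomp (i + j - e) b else 0)"
      by (subst sum.remove[of _ i]) (auto simp: k_def)
    finally have eq: "hcomp i a * hcomp j b = hcomp (i + j) (a * b)
        - (\<Sum>e\<in>{..<k} - {i}. if e \<le> i + j then hcomp e a * hcomp (i + j - e) b else 0)"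
      by simp
    have "hcomp e a * hcomp (i + j - e) b \<in> I" if "e \<noteq> i" "e \<le> i + j" for e
    proof (cases "e < i")
      case True
      then show ?thesis using i(2) ring_ideal_mult2[OF R] by blast
    next
      case False
      then have "i + j - e < j" using that by auto
      then show ?thesis using j(2) ring_ideal_mult[OF R] by blast
    qed
    then have "hcomp i a * hcomp j b \<in> I"
      unfolding eq
      by (intro ring_ideal_diff[OF R] ring_ideal_sum[OF R] graded_idealD(2)[OF I ab])
         (auto intro: ring_ideal_0[OF R])
    then show False
      using prime[OF homogeneous_hcomp homogeneous_hcomp, of i a j b] i(1) j(1) by blast
  qed
  then show ?thesis using R one by (auto simp: prime_ideal_def)
qed

lemma proj_points_iff:
  "P \<in> proj_points \<longleftrightarrow> graded_ideal P \<and> prime_ideal P \<and> (\<exists>i. Var i \<notin> P)"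
proof -
  have "irrelevant_ideal \<subseteq> P \<longleftrightarrow> (\<forall>i. Var i \<in> P)" if P: "ring_ideal P"
  proof
    assume "irrelevant_ideal \<subseteq> P"
    then have "Set.range Var \<subseteq> P"
      unfolding irrelevant_ideal_eq using gen_ideal_superset by (rule subset_trans[rotated])
    then show "\<forall>i. Var i \<in> P" by auto
  next
    assume "\<forall>i. Var i \<in> P"
    then show "irrelevant_ideal \<subseteq> P"
      unfolding irrelevant_ideal_eq by (intro gen_ideal_minimal[OF P]) auto
  qed
  then show ?thesis
    by (auto simp: proj_points_def homogeneous_ideal_iff primeideal_class_ring prime_ideal_def)
qed

section \<open>Koszul cohomology\<close>

locale koszul_module = Modules.module scale
  for scale :: "'a::comm_ring_1 \<Rightarrow> 'b::ab_group_add \<Rightarrow> 'b" (infixr \<open>*s\<close> 75)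
begin

text \<open>A Koszul cochain on \<open>x\<^sub>1, \<dots>, x\<^sub>m\<close> assigns a vector to every subset of the
  indices, encoded by its list of membership bits; the differential is the iterated mapping cone
  of the multiplications by the \<open>x\<^sub>i\<close>.\<close>

primrec kd :: "'a list \<Rightarrow> (bool list \<Rightarrow> 'b) \<Rightarrow> bool list \<Rightarrow> 'b" where
  "kd [] c = (\<lambda>b. 0)"
| "kd (x # xs) c = (\<lambda>b. case b of [] \<Rightarrow> 0
     | h # b' \<Rightarrow> if h then x *s c (False # b') - kd xs (\<lambda>b. c (True # b)) b'
                 else kd xs (\<lambda>b. c (False # b)) b')"

abbreviation bdeg :: "bool list \<Rightarrow> nat" where "bdeg b \<equiv> count_list b True"

text \<open>Vanishing of the Koszul cohomology of \<open>L / N\<close> in degrees below \<open>q\<close>.\<close>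

definition kvanish :: "'a list \<Rightarrow> nat \<Rightarrow> 'b set \<Rightarrow> 'b set \<Rightarrow> bool" where
  "kvanish xs q L N \<longleftrightarrow> (\<forall>i<q. \<forall>c. (\<forall>b. c b \<in> L) \<longrightarrow>
     (\<forall>b. length b = length xs \<and> bdeg b = Suc i \<longrightarrow> kd xs c b \<in> N) \<longrightarrow>
     (\<exists>e. (\<forall>b. e b \<in> L) \<and> (\<forall>b. length b = length xs \<and> bdeg b = i \<longrightarrow> c b - kd xs e b \<in> N)))"

lemma kvanishD:
  assumes "kvanish xs q L N" "i < q" "\<And>b. c b \<in> L"
    "\<And>b. length b = length xs \<Longrightarrow> bdeg b = Suc i \<Longrightarrow> kd xs c b \<in> N"
  shows "\<exists>e. (\<forall>b. e b \<in> L) \<and> (\<forall>b. length b = length xs \<and> bdeg b = i \<longrightarrow> c b - kd xs e b \<in> N)"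
  using assms(1)[unfolded kvanish_def, rule_format, OF assms(2), of c] assms(3,4) by blast

lemma kvanishE:
  assumes "kvanish xs q L N" "i < q" "\<And>b. c b \<in> L"
    "\<And>b. length b = length xs \<Longrightarrow> bdeg b = Suc i \<Longrightarrow> kd xs c b \<in> N"
  obtains e where "\<And>b. e b \<in> L"
    "\<And>b. length b = length xs \<Longrightarrow> bdeg b = i \<Longrightarrow> c b - kd xs e b \<in> N"
  using kvanishD[OF assms] that by blast

lemma kvanish_mono: "kvanish xs q L N \<Longrightarrow> q' \<le> q \<Longrightarrow> kvanish xs q' L N"
  unfolding kvanish_def by auto

lemma kd_diff: "kd xs (\<lambda>b. c b - d b) b = kd xs c b - kd xs d b"
  by (induction xs arbitrary: c d b)
     (auto split: list.split simp: scale_right_diff_distrib)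

lemma kd_scale: "kd xs (\<lambda>b. y *s c b) b = y *s kd xs c b"
  by (induction xs arbitrary: c b)
     (auto split: list.split simp: scale_right_diff_distrib scale_left_commute mult.commute)

lemma kd_mem: "subspace L \<Longrightarrow> (\<And>b. c b \<in> L) \<Longrightarrow> kd xs c b \<in> L"
  by (induction xs arbitrary: c b)
     (auto split: list.split intro!: subspace_0 subspace_diff subspace_scale)

lemma kd_bdeg_0: "bdeg b = 0 \<Longrightarrow> kd xs c b = 0"
  by (induction xs arbitrary: c b) (auto split: list.split)

text \<open>A value of the differential involves only values of \<open>c\<close> on subsets with one
  index less. Cochains are functions on all bit lists, and this makes their values in other degrees
  immaterial.\<close>

lemma kd_mem_bdeg:
  assumes "subspace N" "length b = length xs" "bdeg b = Suc i"
    "\<And>b. length b = length xs \<Longrightarrow> bdeg b = i \<Longrightarrow> c b \<in> N"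
  shows "kd xs c b \<in> N"
  using assms
proof (induction xs arbitrary: c b i)
  case (Cons x xs)
  then obtain h b' where b: "b = h # b'" "length b' = length xs" by (cases b) auto
  show ?case
  proof (cases h)
    case True
    have "kd xs (\<lambda>b. c (True # b)) b' \<in> N"
    proof (cases i)
      case 0
      then show ?thesis
        using Cons.prems(1,3) b True by (simp add: kd_bdeg_0 subspace_0)
    next
      case (Suc j)
      then show ?thesis
        using Cons.prems b True by (intro Cons.IH[of _ j]) auto
    qed
    then show ?thesis
      using Cons.prems b True by (auto intro!: subspace_diff subspace_scale)
  next
    case False
    then show ?thesis using Cons.prems b by (auto intro!: Cons.IH[of _ i])
  qed
qed (auto intro: subspace_0)

lemma kd_cong_bdeg:
  assumes "length b = length xs" "bdeg b = Suc i"
    "\<And>b. length b = length xs \<Longrightarrow> bdeg b = i \<Longrightarrow> c b = d b"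
  shows "kd xs c b = kd xs d b"
  using kd_mem_bdeg[of "{0}" b xs i "\<lambda>b. c b - d b"] assms by (simp add: kd_diff)

lemma kd_kd: "kd xs (kd xs c) b = 0"
proof (induction xs arbitrary: c b)
  case (Cons x xs)
  then show ?case by (auto split: list.split simp: kd_diff kd_scale)
qed simp

lemma kd_module_hom:
  assumes "Modules.module_hom scale scale f"
  shows "f (kd xs c b) = kd xs (\<lambda>b. f (c b)) b"
proof -
  interpret f: Modules.module_hom scale scale f by fact
  show ?thesis
    by (induction xs arbitrary: c b) (auto split: list.split simp: f.diff f.scale)
qed

text \<open>Long exact sequence of \<open>N\<close>, \<open>L\<close> and \<open>L / N\<close>: the
  differential of a cocycle modulo \<open>N\<close> is a cocycle with values in \<open>N\<close>,
  hence the differential of some \<open>a\<close> in \<open>N\<close>, and subtracting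
  \<open>a\<close> gives a cocycle of \<open>L\<close>.\<close>

lemma kvanish_quotient:
  assumes sub: "subspace N" "subspace L" and NL: "N \<subseteq> L"
    and N: "kvanish xs (Suc q) N {0}" and L: "kvanish xs q L {0}"
  shows "kvanish xs q L N"
  unfolding kvanish_def
proof (intro allI impI)
  fix i c
  assume i: "i < q" and c: "\<forall>b. c b \<in> L"
    and dc: "\<forall>b. length b = length xs \<and> bdeg b = Suc i \<longrightarrow> kd xs c b \<in> N"
  \<comment> \<open>Outside degree \<open>i + 1\<close> the differential of \<open>c\<close> need
    not lie in \<open>N\<close>, so it is replaced by 0 there.\<close>
  define c' where "c' = (\<lambda>b. if length b = length xs \<and> bdeg b = Suc i then kd xs c b else 0)"
  have "kd xs c' b = 0" if "length b = length xs" "bdeg b = Suc (Suc i)" for b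
    using kd_cong_bdeg[OF that, of c' "kd xs c"] by (simp add: c'_def kd_kd)
  moreover have "c' b \<in> N" for b using dc sub by (auto simp: c'_def subspace_0)
  ultimately obtain a where a: "\<And>b. a b \<in> N"
      "\<And>b. length b = length xs \<Longrightarrow> bdeg b = Suc i \<Longrightarrow> c' b - kd xs a b \<in> {0}"
    using kvanishE[OF N, of "Suc i" c'] i by auto
  have "kd xs (\<lambda>b. c b - a b) b \<in> {0}" if "length b = length xs" "bdeg b = Suc i" for b
    using a(2)[OF that] that by (simp add: kd_diff c'_def)
  moreover have "c b - a b \<in> L" for b
    using c a(1)[of b] NL by (auto intro!: subspace_diff[OF sub(2)])
  ultimately obtain e where e: "\<And>b. e b \<in> L"
      "\<And>b. length b = length xs \<Longrightarrow> bdeg b = i \<Longrightarrow> (c b - a b) - kd xs e b \<in> {0}"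
    using kvanishE[OF L i, of "\<lambda>b. c b - a b"] by blast
  have "c b - kd xs e b \<in> N" if "length b = length xs" "bdeg b = i" for b
  proof -
    have "c b - kd xs e b = a b" using e(2)[OF that] by (simp add: algebra_simps)
    then show ?thesis using a(1) by simp
  qed
  with e(1) show "\<exists>e. (\<forall>b. e b \<in> L) \<and>
      (\<forall>b. length b = length xs \<and> bdeg b = i \<longrightarrow> c b - kd xs e b \<in> N)" by blast
qed

text \<open>Long exact sequence of multiplication by \<open>x\<close> on \<open>L / N\<close>: if
  the differential of \<open>c\<close> is \<open>x e\<close> modulo \<open>N\<close>, cancelling
  \<open>x\<close> shows that \<open>e\<close> is a cocycle, hence the differential of some
  \<open>g\<close>, and \<open>c - x g\<close> is a cocycle modulo \<open>N\<close>.\<close>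

lemma kvanish_mod_nonzerodivisor:
  assumes sub: "subspace N" "subspace L" and NL: "N \<subseteq> L"
    and x: "\<And>w. w \<in> L \<Longrightarrow> x *s w \<in> N \<Longrightarrow> w \<in> N"
    and L: "kvanish xs (Suc q) L N"
  shows "kvanish xs q L {u + x *s w |u w. u \<in> N \<and> w \<in> L}"
  unfolding kvanish_def
proof (intro allI impI)
  fix i c
  assume i: "i < q" and c: "\<forall>b. c b \<in> L"
    and dc: "\<forall>b. length b = length xs \<and> bdeg b = Suc i \<longrightarrow>
      kd xs c b \<in> {u + x *s w |u w. u \<in> N \<and> w \<in> L}"
  have "\<exists>u w. u \<in> N \<and> w \<in> L \<and> (length b = length xs \<and> bdeg b = Suc i \<longrightarrow> kd xs c b = u + x *s w)" for b
  proof (cases "length b = length xs \<and> bdeg b = Suc i")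
    case True
    with dc have "kd xs c b \<in> {u + x *s w |u w. u \<in> N \<and> w \<in> L}" by blast
    then show ?thesis by blast
  next
    case False
    then show ?thesis using sub by (metis subspace_0)
  qed
  then obtain n e where ne: "\<And>b. n b \<in> N" "\<And>b. e b \<in> L"
      "\<And>b. length b = length xs \<Longrightarrow> bdeg b = Suc i \<Longrightarrow> kd xs c b = n b + x *s e b"
    by metis
  have de: "kd xs e b \<in> N" if b: "length b = length xs" "bdeg b = Suc (Suc i)" for b
  proof -
    have "x *s kd xs e b = kd xs (\<lambda>b. kd xs c b - n b) b"
      unfolding kd_scale[symmetric] using ne(3) by (intro kd_cong_bdeg[OF b]) simp
    also have "\<dots> = - kd xs n b" by (simp add: kd_diff kd_kd)
    also have "\<dots> \<in> N" using sub ne(1) by (intro subspace_neg kd_mem)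
    finally show ?thesis by (rule x[OF kd_mem[OF sub(2) ne(2)]])
  qed
  obtain g where g: "\<And>b. g b \<in> L"
      "\<And>b. length b = length xs \<Longrightarrow> bdeg b = Suc i \<Longrightarrow> e b - kd xs g b \<in> N"
    using kvanishD[OF L Suc_mono[OF i] ne(2) de] by blast
  have "kd xs (\<lambda>b. c b - x *s g b) b \<in> N" if b: "length b = length xs" "bdeg b = Suc i" for b
  proof -
    have "kd xs (\<lambda>b. c b - x *s g b) b = n b + x *s (e b - kd xs g b)"
      using ne(3)[OF b] by (simp add: kd_diff kd_scale algebra_simps)
    then show ?thesis using ne(1) g(2)[OF b] sub by (simp add: subspace_add subspace_scale)
  qed
  moreover have "c b - x *s g b \<in> L" for b
    using c g(1) sub by (simp add: subspace_diff subspace_scale)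
  ultimately obtain h where h: "\<And>b. h b \<in> L"
      "\<And>b. length b = length xs \<Longrightarrow> bdeg b = i \<Longrightarrow> (c b - x *s g b) - kd xs h b \<in> N"
    using kvanishE[OF L, of i "\<lambda>b. c b - x *s g b"] i by auto
  have "c b - kd xs h b \<in> {u + x *s w |u w. u \<in> N \<and> w \<in> L}" if b: "length b = length xs" "bdeg b = i" for b
  proof -
    have "c b - kd xs h b = ((c b - x *s g b) - kd xs h b) + x *s g b" by simp
    then show ?thesis using h(2)[OF b] g(1) by blast
  qed
  with h(1) show "\<exists>e. (\<forall>b. e b \<in> L) \<and> (\<forall>b. length b = length xs \<and> bdeg b = i \<longrightarrow>
      c b - kd xs e b \<in> {u + x *s w |u w. u \<in> N \<and> w \<in> L})" by blast
qed

text \<open>The image is isomorphic to \<open>L\<close> modulo the kernel, and \<open>f\<close>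
  commutes with the differential.\<close>

lemma kvanish_image:
  assumes f: "Modules.module_hom scale scale f" and sub: "subspace L"
    and L: "kvanish xs q L {w \<in> L. f w = 0}"
  shows "kvanish xs q (f ` L) {0}"
  unfolding kvanish_def
proof (intro allI impI)
  interpret f: Modules.module_hom scale scale f by fact
  fix i c
  assume i: "i < q" and c: "\<forall>b. c b \<in> f ` L"
    and dc: "\<forall>b. length b = length xs \<and> bdeg b = Suc i \<longrightarrow> kd xs c b \<in> {0}"
  have "\<forall>b. \<exists>u. u \<in> L \<and> c b = f u" using c by auto
  then obtain c' where c': "\<And>b. c' b \<in> L" "\<And>b. c b = f (c' b)" by metis
  then have c_eq: "(\<lambda>b. f (c' b)) = c" by (simp add: fun_eq_iff)
  have "kd xs c' b \<in> {w \<in> L. f w = 0}" if "length b = length xs" "bdeg b = Suc i" for b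
  proof -
    have "f (kd xs c' b) = kd xs c b"
      unfolding kd_module_hom[OF f] c_eq ..
    then show ?thesis using dc that kd_mem[OF sub c'(1)] by auto
  qed
  then obtain e where e: "\<And>b. e b \<in> L"
      "\<And>b. length b = length xs \<Longrightarrow> bdeg b = i \<Longrightarrow> c' b - kd xs e b \<in> {w \<in> L. f w = 0}"
    using kvanishE[OF L i, of c'] c'(1) by blast
  have "c b - kd xs (\<lambda>b. f (e b)) b \<in> {0}" if "length b = length xs" "bdeg b = i" for b
    using e(2)[OF that] c'(2) by (simp add: f.diff kd_module_hom[OF f, symmetric])
  then show "\<exists>e. (\<forall>b. e b \<in> f ` L) \<and>
      (\<forall>b. length b = length xs \<and> bdeg b = i \<longrightarrow> c b - kd xs e b \<in> {0})"
    using e(1) by (intro exI[of _ "\<lambda>b. f (e b)"]) auto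
qed

text \<open>Koszul cohomology in degree 0 is the submodule killed by all of \<open>xs\<close>: such
  a \<open>w\<close> is a cocycle as a constant cochain, and the only coboundary in degree 0 is
  zero.\<close>

lemma kvanish_annihilated:
  assumes sub: "subspace N" and L: "kvanish xs (Suc q) L N" and w: "w \<in> L"
    and ann: "\<And>x. x \<in> set xs \<Longrightarrow> x *s w \<in> N"
  shows "w \<in> N"
proof -
  have dw: "kd xs (\<lambda>b. w) b \<in> N" if "length b = length xs" "bdeg b = Suc 0" for b
    using that ann
  proof (induction xs arbitrary: b)
    case (Cons x xs)
    then obtain h b' where b: "b = h # b'" "length b' = length xs" by (cases b) auto
    then show ?case
      using Cons by (cases h) (auto simp: kd_bdeg_0)
  qed (simp add: subspace_0 sub)
  obtain e where "\<And>b. length b = length xs \<Longrightarrow> bdeg b = 0 \<Longrightarrow> w - kd xs e b \<in> N"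
    using kvanishD[OF L zero_less_Suc w dw] by blast
  from this[of "replicate (length xs) False"] have "w - kd xs e (replicate (length xs) False) \<in> N"
    by (simp add: count_list_0_iff)
  moreover have "kd xs e (replicate (length xs) False) = 0"
    by (rule kd_bdeg_0) (simp add: count_list_0_iff)
  ultimately show ?thesis by simp
qed

section \<open>Regular sequences and vanishing of Koszul cohomology\<close>

primrec mult_sum :: "'a list \<Rightarrow> 'b set \<Rightarrow> 'b set" where
  "mult_sum [] L = {0}"
| "mult_sum (x # xs) L = {x *s u + t |u t. u \<in> L \<and> t \<in> mult_sum xs L}"

text \<open>The head is tested modulo the tail, so the sequence is regular when read from the end.
  This matches the recursion of \<open>kd\<close>, whose outermost cone belongs to the head.\<close>

primrec regular_on :: "'a list \<Rightarrow> 'b set \<Rightarrow> bool" where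
  "regular_on [] L = True"
| "regular_on (x # xs) L \<longleftrightarrow> regular_on xs L \<and> (\<forall>w\<in>L. x *s w \<in> mult_sum xs L \<longrightarrow> w \<in> mult_sum xs L)"

lemma subspace_mult_sum:
  assumes L: "subspace L"
  shows "subspace (mult_sum xs L)"
proof (induction xs)
  case (Cons x xs)
  have "{x *s u + t |u t. u \<in> L \<and> t \<in> mult_sum xs L} =
      {a + b |a b. a \<in> (\<lambda>u. x *s u) ` L \<and> b \<in> mult_sum xs L}" by auto
  moreover have "subspace ((\<lambda>u. x *s u) ` L)"
    unfolding subspace_def
  proof (intro conjI ballI allI)
    show "0 \<in> (\<lambda>u. x *s u) ` L" using L by (intro image_eqI[of _ _ 0]) (auto simp: subspace_0)
  next
    fix a b assume "a \<in> (\<lambda>u. x *s u) ` L" "b \<in> (\<lambda>u. x *s u) ` L"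
    then show "a + b \<in> (\<lambda>u. x *s u) ` L"
      using subspace_add[OF L] by (auto simp: scale_right_distrib[symmetric])
  next
    fix c a assume "a \<in> (\<lambda>u. x *s u) ` L"
    then obtain u where "u \<in> L" "a = x *s u" by auto
    then show "c *s a \<in> (\<lambda>u. x *s u) ` L"
      using subspace_scale[OF L, of u c] by (intro image_eqI[of _ _ "c *s u"]) (auto simp: mult.commute)
  qed
  moreover have "subspace {a + b |a b. a \<in> A \<and> b \<in> B}" if "subspace A" "subspace B" for A B
    unfolding subspace_def
  proof (intro conjI ballI allI)
    show "0 \<in> {a + b |a b. a \<in> A \<and> b \<in> B}" using that by (force intro: subspace_0)
  next
    fix y z assume "y \<in> {a + b |a b. a \<in> A \<and> b \<in> B}" "z \<in> {a + b |a b. a \<in> A \<and> b \<in> B}"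
    then obtain a b a' b' where "y = a + b" "z = a' + b'" "a \<in> A" "a' \<in> A" "b \<in> B" "b' \<in> B" by auto
    then show "y + z \<in> {a + b |a b. a \<in> A \<and> b \<in> B}"
      using subspace_add[OF that(1), of a a'] subspace_add[OF that(2), of b b']
      by (intro CollectI exI[of _ "a + a'"] exI[of _ "b + b'"]) (auto simp: algebra_simps)
  next
    fix c y assume "y \<in> {a + b |a b. a \<in> A \<and> b \<in> B}"
    then obtain a b where "y = a + b" "a \<in> A" "b \<in> B" by auto
    then show "c *s y \<in> {a + b |a b. a \<in> A \<and> b \<in> B}"
      using subspace_scale[OF that(1), of a c] subspace_scale[OF that(2), of b c]
      by (intro CollectI exI[of _ "c *s a"] exI[of _ "c *s b"]) (auto simp: scale_right_distrib)
  qed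
  ultimately show ?case using Cons by simp
qed simp

lemma mult_sum_kd_top:
  assumes L: "subspace L" and "t \<in> mult_sum xs L"
  shows "\<exists>e. (\<forall>b. e b \<in> L) \<and> t = kd xs e (replicate (length xs) True)"
  using assms(2)
proof (induction xs arbitrary: t)
  case (Cons x xs)
  then obtain u s where t: "t = x *s u + s" "u \<in> L" "s \<in> mult_sum xs L" by auto
  \<comment> \<open>The cone subtracts the differential of the tail, hence the sign.\<close>
  with Cons.IH[of "- s"] obtain e where e: "\<forall>b. e b \<in> L" "- s = kd xs e (replicate (length xs) True)"
    using subspace_neg[OF subspace_mult_sum[OF L]] by blast
  have s: "s = - kd xs e (replicate (length xs) True)" using e(2) by (metis minus_minus)
  show ?case
    using e(1) t(1,2) unfolding s
    by (intro exI[of _ "\<lambda>b. if b = [] then u else if hd b then e (tl b) else u"]) auto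
qed (use subspace_0[OF L] in \<open>auto intro!: exI[of _ "\<lambda>_. 0"]\<close>)

lemma kd_top_mult_sum:
  assumes L: "subspace L" and "\<And>b. e b \<in> L"
  shows "kd xs e (replicate (length xs) True) \<in> mult_sum xs L"
  using assms(2)
proof (induction xs arbitrary: e)
  case (Cons x xs)
  have "- kd xs (\<lambda>b. e (True # b)) (replicate (length xs) True) \<in> mult_sum xs L"
    using Cons by (intro subspace_neg subspace_mult_sum[OF L]) auto
  moreover have "kd (x # xs) e (replicate (length (x # xs)) True) =
      x *s e (False # replicate (length xs) True) + - kd xs (\<lambda>b. e (True # b)) (replicate (length xs) True)"
    by simp
  ultimately show ?case using Cons.prems unfolding mult_sum.simps by blast
qed simp

lemma bdeg_le: "bdeg b \<le> length b"
  by (rule count_le_length)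

lemma bdeg_top: "bdeg b = length b \<Longrightarrow> b = replicate (length b) True"
proof (induction b)
  case (Cons h b)
  then show ?case using bdeg_le[of b] by (auto split: if_splits)
qed simp

text \<open>A cocycle of the cone is a pair \<open>(u, v)\<close> in which \<open>u\<close> is a
  cocycle for \<open>xs\<close> and \<open>x u\<close> is the differential of \<open>v\<close>. Once
  \<open>u\<close> is the differential of some \<open>u'\<close>, also \<open>x u' - v\<close> is a
  cocycle one degree lower, the differential of some \<open>v'\<close>, and \<open>(u', v')\<close>
  is a primitive.\<close>

lemma kvanish_regular:
  assumes L: "subspace L" and "regular_on xs L"
  shows "kvanish xs (length xs) L {0}"
  using assms(2)
proof (induction xs)
  case (Cons x xs)
  show ?case
    unfolding kvanish_def
  proof (intro allI impI)
    fix i c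
    assume i: "i < length (x # xs)" and c: "\<forall>b. c b \<in> L"
      and dc: "\<forall>b. length b = length (x # xs) \<and> bdeg b = Suc i \<longrightarrow> kd (x # xs) c b \<in> {0}"
    define u where "u = (\<lambda>b. c (False # b))"
    define v where "v = (\<lambda>b. c (True # b))"
    have u: "u b \<in> L" and v: "v b \<in> L" for b using c by (auto simp: u_def v_def)
    have du: "kd xs u b = 0" if "length b = length xs" "bdeg b = Suc i" for b
      using dc[rule_format, of "False # b"] that by (simp add: u_def)
    have xu: "x *s u b = kd xs v b" if "length b = length xs" "bdeg b = i" for b
      using dc[rule_format, of "True # b"] that by (simp add: u_def v_def)
    have "\<exists>u'. (\<forall>b. u' b \<in> L) \<and> (\<forall>b. length b = length xs \<and> bdeg b = i \<longrightarrow> u b = kd xs u' b)"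
    proof (cases "i < length xs")
      case True
      have "\<exists>e. (\<forall>b. e b \<in> L) \<and> (\<forall>b. length b = length xs \<and> bdeg b = i \<longrightarrow> u b - kd xs e b \<in> {0})"
        using Cons du u True unfolding kvanish_def by auto
      then show ?thesis by auto
    next
      case False
      \<comment> \<open>In the top degree for \<open>xs\<close> the induction hypothesis is silent.
        Instead \<open>x u\<close> lies in the multiples of \<open>xs\<close> by the relation with
        \<open>v\<close>, and regularity of \<open>x\<close> moves \<open>u\<close> there.\<close>
      with i have i': "i = length xs" by simp
      let ?t = "replicate (length xs) True"
      have "bdeg ?t = length xs" by (induction xs) auto
      then have "x *s u ?t \<in> mult_sum xs L"
        using xu[of ?t] kd_top_mult_sum[OF L, of v] v i' by simp
      then have "u ?t \<in> mult_sum xs L" using Cons.prems u by auto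
      then obtain e where "\<forall>b. e b \<in> L" "u ?t = kd xs e ?t" using mult_sum_kd_top[OF L] by blast
      then show ?thesis using bdeg_top i' by metis
    qed
    then obtain u' where u': "\<And>b. u' b \<in> L"
        "\<And>b. length b = length xs \<Longrightarrow> bdeg b = i \<Longrightarrow> u b = kd xs u' b" by blast
    have "\<exists>v'. (\<forall>b. v' b \<in> L) \<and> (\<forall>b. length b = length xs \<and> Suc (bdeg b) = i \<longrightarrow> x *s u' b - v b = kd xs v' b)"
    proof (cases i)
      case 0
      then show ?thesis using subspace_0[OF L] by (intro exI[of _ "\<lambda>_. 0"]) simp
    next
      case (Suc j)
      have "kd xs (\<lambda>b. x *s u' b - v b) b \<in> {0}" if "length b = length xs" "bdeg b = Suc j" for b
        using xu[of b] u'(2)[of b] that Suc by (simp add: kd_diff kd_scale)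
      moreover have "x *s u' b - v b \<in> L" for b
        using u'(1) v L by (intro subspace_diff subspace_scale)
      moreover have "kvanish xs (length xs) L {0}" using Cons by simp
      ultimately obtain e where "\<And>b. e b \<in> L"
          "\<And>b. length b = length xs \<Longrightarrow> bdeg b = j \<Longrightarrow> (x *s u' b - v b) - kd xs e b \<in> {0}"
        using kvanishE[of xs "length xs" L "{0}" j "\<lambda>b. x *s u' b - v b"] i Suc by auto
      then show ?thesis using Suc by (intro exI[of _ e]) auto
    qed
    then obtain v' where v': "\<And>b. v' b \<in> L"
        "\<And>b. length b = length xs \<Longrightarrow> Suc (bdeg b) = i \<Longrightarrow> x *s u' b - v b = kd xs v' b" by blast
    define e where "e = (\<lambda>b. if b = [] then 0 else if hd b then v' (tl b) else u' (tl b))"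
    have eF: "e (False # b) = u' b" and eT: "e (True # b) = v' b" for b by (auto simp: e_def)
    have "c b - kd (x # xs) e b \<in> {0}" if b: "length b = length (x # xs)" "bdeg b = i" for b
    proof -
      from b(1) obtain h b' where h: "b = h # b'" "length b' = length xs" by (cases b) auto
      show ?thesis
      proof (cases h)
        case True
        then have "x *s u' b' - v b' = kd xs v' b'" using v'(2)[of b'] h b by auto
        then have "kd xs v' b' = x *s u' b' - v b'" by simp
        then show ?thesis using h True by (simp add: eF eT v_def)
      next
        case False
        then show ?thesis using u'(2)[of b'] h b by (simp add: eF u_def)
      qed
    qed
    moreover have "e b \<in> L" for b using u'(1) v'(1) L by (auto simp: e_def subspace_0)
    ultimately show "\<exists>e. (\<forall>b. e b \<in> L) \<and>
        (\<forall>b. length b = length (x # xs) \<and> bdeg b = i \<longrightarrow> c b - kd (x # xs) e b \<in> {0})" by blast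
  qed
qed (simp add: kvanish_def)

end

interpretation fmod: koszul_module "smul :: 'a::comm_ring_1 \<Rightarrow> ('i \<Rightarrow> 'a) \<Rightarrow> 'i \<Rightarrow> 'a" ..

section \<open>The variables form a regular sequence\<close>

lemma lookup_single_times_full:
  fixes q :: "('v \<Rightarrow>\<^sub>0 nat) \<Rightarrow>\<^sub>0 'b::semiring_0"
  shows "Poly_Mapping.lookup (Poly_Mapping.single a c * q) m =
    (if \<exists>b. m = a + b then c * Poly_Mapping.lookup q (m - a) else 0)"
proof (cases "\<exists>b. m = a + b")
  case True
  then show ?thesis using lookup_single_times[of a c q] by auto
next
  case False
  then have "Poly_Mapping.lookup (Poly_Mapping.single a c * q) m = 0"
    unfolding lookup_times by (intro sum.neutral ballI) (auto split: if_splits)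
  then show ?thesis using False by simp
qed

lemma add_single_if_lookup:
  fixes m :: "'v \<Rightarrow>\<^sub>0 nat"
  shows "(\<exists>b. m = Poly_Mapping.single v 1 + b) \<longleftrightarrow> Poly_Mapping.lookup m v \<noteq> 0"
proof
  assume "Poly_Mapping.lookup m v \<noteq> 0"
  then have "m = Poly_Mapping.single v 1 + (m - Poly_Mapping.single v 1)"
    by (intro poly_mapping_eqI) (auto simp: lookup_add lookup_minus lookup_single when_def)
  then show "\<exists>b. m = Poly_Mapping.single v 1 + b" by blast
qed (auto simp: lookup_add)

lemma lookup_Var_times:
  "Poly_Mapping.lookup (Var v * q) m =
    (if Poly_Mapping.lookup m v = 0 then 0 else Poly_Mapping.lookup q (m - Poly_Mapping.single v 1))"
  unfolding Var_def lookup_single_times_full add_single_if_lookup by simp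

text \<open>The multiples of the variables in \<open>S\<close> within \<open>Fr k\<close>, described
  by monomials so that membership can be checked coefficient by coefficient.\<close>

definition vars_module :: "nat \<Rightarrow> 'v set \<Rightarrow> (nat \<Rightarrow> ('v, 'k::comm_ring_1) mpoly) set" where
  "vars_module k S = {w \<in> Fr k. \<forall>j m. Poly_Mapping.lookup (w j) m \<noteq> 0 \<longrightarrow>
     (\<exists>i\<in>S. Poly_Mapping.lookup m i \<noteq> 0)}"

lemma mult_sum_Var:
  "fmod.mult_sum (map Var vs) (Fr k) = (vars_module k (set vs) :: (nat \<Rightarrow> ('v, 'k::comm_ring_1) mpoly) set)"
proof (induction vs)
  case Nil
  have "w = 0" if "w \<in> vars_module k {}" for w :: "nat \<Rightarrow> ('v, 'k) mpoly"
    using that by (auto simp: vars_module_def fun_eq_iff intro!: poly_mapping_eqI)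
  moreover have "(0 :: nat \<Rightarrow> ('v, 'k) mpoly) \<in> vars_module k {}" by (simp add: vars_module_def Fr_def)
  ultimately have "vars_module k {} = {0 :: nat \<Rightarrow> ('v, 'k) mpoly}" by auto
  then show ?case by simp
next
  case (Cons v vs)
  have "{smul (Var v) u + t |u t. u \<in> Fr k \<and> t \<in> vars_module k (set vs)} = (vars_module k (insert v (set vs)) :: (nat \<Rightarrow> ('v, 'k) mpoly) set)"
    (is "?L = ?R")
  proof
    show "?L \<subseteq> ?R"
    proof
      fix w :: "nat \<Rightarrow> ('v, 'k) mpoly" assume "w \<in> ?L"
      then obtain u t where w: "w = smul (Var v) u + t" "u \<in> Fr k" "t \<in> vars_module k (set vs)" by auto
      have "\<exists>i\<in>insert v (set vs). Poly_Mapping.lookup m i \<noteq> 0" if "Poly_Mapping.lookup (w j) m \<noteq> 0" for j m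
      proof (cases "Poly_Mapping.lookup m v = 0")
        case True
        then have "Poly_Mapping.lookup (t j) m \<noteq> 0"
          using that by (auto simp: w(1) smul_apply lookup_add lookup_Var_times split: if_splits)
        then show ?thesis using w(3) by (auto simp: vars_module_def)
      qed auto
      moreover have "w \<in> Fr k" using w by (auto simp: Fr_def vars_module_def smul_apply)
      ultimately show "w \<in> ?R" by (auto simp: vars_module_def)
    qed
    show "?R \<subseteq> ?L"
    proof
      fix w :: "nat \<Rightarrow> ('v, 'k) mpoly" assume w: "w \<in> ?R"
      \<comment> \<open>\<open>u\<close> collects the monomials divisible by \<open>Var v\<close>,
        divided by it; the remainder \<open>t\<close> consists of the monomials free of
        \<open>v\<close>.\<close>
      define u where "u = (\<lambda>j. Poly_Mapping.map_key (\<lambda>m. m + Poly_Mapping.single v 1) (w j))"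
      have inj: "inj (\<lambda>m. m + Poly_Mapping.single v (1::nat))" by (simp add: inj_def)
      have lu: "Poly_Mapping.lookup (u j) m = Poly_Mapping.lookup (w j) (m + Poly_Mapping.single v 1)" for j m
        using inj by (simp add: u_def map_key.rep_eq)
      have vu: "Poly_Mapping.lookup (Var v * u j) m =
          (if Poly_Mapping.lookup m v = 0 then 0 else Poly_Mapping.lookup (w j) m)" for j m
      proof (cases "Poly_Mapping.lookup m v = 0")
        case False
        then obtain b where "m = Poly_Mapping.single v 1 + b" using add_single_if_lookup[of m v] by metis
        then have "m - Poly_Mapping.single v 1 + Poly_Mapping.single v 1 = m" by (simp add: add.commute)
        then show ?thesis using False by (simp add: lookup_Var_times lu)
      qed (simp add: lookup_Var_times)
      define t where "t = w - smul (Var v) u"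
      have t: "Poly_Mapping.lookup (t j) m = (if Poly_Mapping.lookup m v = 0 then Poly_Mapping.lookup (w j) m else 0)" for j m
        by (simp add: t_def lookup_minus vu smul_apply)
      have w0: "w j = 0" if "j \<ge> k" for j using w that by (auto simp: vars_module_def Fr_def)
      have "t j = 0" if "j \<ge> k" for j
        by (rule poly_mapping_eqI) (simp add: t w0[OF that])
      moreover have "u j = 0" if "j \<ge> k" for j
        by (rule poly_mapping_eqI) (simp add: lu w0[OF that])
      ultimately have "u \<in> Fr k" "t \<in> Fr k" by (auto simp: Fr_def)
      moreover have "\<exists>i\<in>set vs. Poly_Mapping.lookup m i \<noteq> 0" if "Poly_Mapping.lookup (t j) m \<noteq> 0" for j m
      proof -
        have "Poly_Mapping.lookup m v = 0" "Poly_Mapping.lookup (w j) m \<noteq> 0"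
          using that by (auto simp: t split: if_splits)
        moreover from this(2) have "\<exists>i\<in>insert v (set vs). Poly_Mapping.lookup m i \<noteq> 0"
          using w unfolding vars_module_def by blast
        ultimately show ?thesis by blast
      qed
      ultimately have "u \<in> Fr k" "t \<in> vars_module k (set vs)" by (auto simp: vars_module_def)
      moreover have "w = smul (Var v) u + t" by (simp add: t_def)
      ultimately show "w \<in> ?L" by blast
    qed
  qed
  then show ?case using Cons by simp
qed

text \<open>Multiplication by \<open>Var v\<close> raises only the exponent of \<open>v\<close>, so
  whether a monomial involves a variable of \<open>vs\<close> does not change.\<close>

lemma regular_on_Var:
  "distinct vs \<Longrightarrow> fmod.regular_on (map Var vs) (Fr k :: (nat \<Rightarrow> ('v, 'k::comm_ring_1) mpoly) set)"
proof (induction vs)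
  case (Cons v vs)
  have "w \<in> vars_module k (set vs)" if w: "w \<in> Fr k" "smul (Var v) w \<in> vars_module k (set vs)"
    for w :: "nat \<Rightarrow> ('v, 'k) mpoly"
  proof -
    have "\<exists>i\<in>set vs. Poly_Mapping.lookup m i \<noteq> 0" if m: "Poly_Mapping.lookup (w j) m \<noteq> 0" for j m
    proof -
      have "Poly_Mapping.lookup (smul (Var v) w j) (Poly_Mapping.single v 1 + m) \<noteq> 0"
        using m by (simp add: Var_def lookup_single_times smul_apply)
      then obtain i where i: "i \<in> set vs" "Poly_Mapping.lookup (Poly_Mapping.single v 1 + m) i \<noteq> 0"
        using w(2) unfolding vars_module_def by blast
      have "i \<noteq> v" using i(1) Cons.prems by auto
      then show ?thesis using i by (auto simp: lookup_add lookup_single when_def)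
    qed
    then show ?thesis using w(1) by (auto simp: vars_module_def)
  qed
  then show ?case using Cons by (simp add: mult_sum_Var)
qed simp

definition vars :: "('v::finite, 'k::comm_ring_1) mpoly list" where
  "vars = map Var (SOME vs. distinct vs \<and> set vs = UNIV)"

lemma vars_choice: "distinct (SOME vs. distinct vs \<and> set vs = (UNIV :: 'v::finite set))"
    "set (SOME vs. distinct vs \<and> set vs = (UNIV :: 'v::finite set)) = UNIV"
proof -
  have "\<exists>vs. distinct vs \<and> set vs = (UNIV :: 'v set)"
    using finite_distinct_list[of "UNIV :: 'v set"] by auto
  from someI_ex[OF this] show "distinct (SOME vs. distinct vs \<and> set vs = (UNIV :: 'v set))"
    "set (SOME vs. distinct vs \<and> set vs = (UNIV :: 'v set)) = UNIV" by auto
qed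

lemma set_vars: "set (vars :: ('v::finite, 'k::comm_ring_1) mpoly list) = Set.range Var"
  by (simp add: vars_def vars_choice)

lemma length_vars: "length (vars :: ('v::finite, 'k::comm_ring_1) mpoly list) = CARD('v)"
  by (simp add: vars_def distinct_card[OF vars_choice(1), symmetric] vars_choice(2))

lemma kvanish_Fr:
  "fmod.kvanish vars CARD('v) (Fr k :: (nat \<Rightarrow> ('v::finite, 'k::comm_ring_1) mpoly) set) {0}"
proof -
  have "fmod.regular_on vars (Fr k :: (nat \<Rightarrow> ('v, 'k) mpoly) set)"
    unfolding vars_def by (rule regular_on_Var[OF vars_choice(1)])
  from fmod.kvanish_regular[OF subspace_Fr this] show ?thesis by (simp add: length_vars)
qed

section \<open>The ascending chain condition\<close>

text \<open>A decreasing sequence of naturals is constant from the place where it attains its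
  minimum.\<close>

lemma incseq_subseq_nat:
  fixes g :: "nat \<Rightarrow> nat"
  shows "\<exists>f. strict_mono f \<and> incseq (g \<circ> f)"
proof -
  obtain f :: "nat \<Rightarrow> nat" where f: "strict_mono f" "monoseq (\<lambda>n. g (f n))"
    using seq_monosub[of g] by blast
  from f(2) consider "incseq (\<lambda>n. g (f n))" | "decseq (\<lambda>n. g (f n))"
    by (auto simp: monoseq_iff)
  then show ?thesis
  proof cases
    case 1
    with f(1) show ?thesis by (auto simp: comp_def)
  next
    case 2
    define y where "y = (LEAST y. \<exists>n. y = g (f n))"
    have "\<exists>y n. y = g (f n)" by blast
    from LeastI_ex[OF this] obtain n0 where n0: "y = g (f n0)" unfolding y_def by blast
    have "g (f (n + n0)) = y" for n
    proof (rule antisym)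
      show "g (f (n + n0)) \<le> y" using 2 unfolding n0 by (auto simp: decseq_def)
      show "y \<le> g (f (n + n0))" unfolding y_def by (rule Least_le) blast
    qed
    then have "incseq (g \<circ> (\<lambda>n. f (n + n0)))" by (simp add: incseq_def)
    moreover have "strict_mono (\<lambda>n. f (n + n0))" using f(1) by (auto simp: strict_mono_def)
    ultimately show ?thesis by blast
  qed
qed

lemma Dickson:
  assumes "finite G"
  shows "\<exists>f. strict_mono f \<and> (\<forall>g\<in>G. incseq ((g :: nat \<Rightarrow> nat) \<circ> f))"
  using assms
proof (induction G)
  case empty
  show ?case by (rule exI[of _ id]) (auto simp: strict_mono_def)
next
  case (insert g G)
  then obtain f where f: "strict_mono f" "\<forall>g\<in>G. incseq (g \<circ> f)" by blast
  obtain h where h: "strict_mono h" "incseq ((g \<circ> f) \<circ> h)" using incseq_subseq_nat by blast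
  have "incseq (g' \<circ> (f \<circ> h))" if "g' \<in> G" for g'
    using f(2)[rule_format, OF that] h(1) by (auto simp: incseq_def strict_mono_less_eq)
  moreover have "strict_mono (f \<circ> h)" using f(1) h(1) by (simp add: strict_mono_o)
  moreover have "incseq (g \<circ> (f \<circ> h))" using h(2) by (simp add: o_assoc)
  ultimately show ?case by blast
qed

definition vidx :: "'v::finite \<Rightarrow> nat" where
  "vidx = (SOME f. bij_betw f UNIV {..<CARD('v)})"

lemma bij_vidx: "bij_betw (vidx :: 'v::finite \<Rightarrow> nat) UNIV {..<CARD('v)}"
proof -
  have "\<exists>f. bij_betw f (UNIV :: 'v set) {..<CARD('v)}"
    using ex_bij_betw_finite_nat[of "UNIV :: 'v set"] by (simp add: atLeast0LessThan)
  then show ?thesis unfolding vidx_def by (rule someI_ex)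
qed

text \<open>Monomials, and monomial vectors, are ordered lexicographically by an additive embedding
  into the ordered ring of integer polynomials.\<close>

definition mkey :: "('v::finite \<Rightarrow>\<^sub>0 nat) \<Rightarrow> int poly" where
  "mkey m = (\<Sum>i\<in>UNIV. monom (int (Poly_Mapping.lookup m i)) (vidx i))"

lemma mkey_add: "mkey (m + m') = mkey m + mkey m'"
  by (simp add: mkey_def lookup_add sum.distrib add_monom[symmetric])

lemma coeff_mkey: "coeff (mkey m) (vidx i) = int (Poly_Mapping.lookup m i)"
proof -
  have "vidx x = vidx i \<longleftrightarrow> x = i" for x
    using bij_betw_imp_inj_on[OF bij_vidx] by (auto simp: inj_on_def)
  then have "coeff (mkey m) (vidx i) = (\<Sum>x\<in>UNIV. if x = i then int (Poly_Mapping.lookup m x) else 0)"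
    unfolding mkey_def coeff_sum by (intro sum.cong) auto
  then show ?thesis by simp
qed

lemma coeff_mkey_ge: "j \<ge> CARD('v) \<Longrightarrow> coeff (mkey (m :: 'v::finite \<Rightarrow>\<^sub>0 nat)) j = 0"
proof -
  assume j: "j \<ge> CARD('v)"
  have "vidx x < CARD('v)" for x :: 'v
    using bij_betwE[OF bij_vidx] by auto
  then show ?thesis using j unfolding mkey_def coeff_sum
    by (intro sum.neutral ballI) (metis coeff_monom not_le)
qed

lemma mkey_inj: "mkey m = mkey m' \<Longrightarrow> m = m'"
  by (rule poly_mapping_eqI) (metis coeff_mkey of_nat_eq_iff)

text \<open>The position is stored in degree \<open>CARD('v)\<close>, above the coefficients of all
  variables, so it can be read off and it is compared first.\<close>

definition vkey :: "nat \<times> ('v::finite \<Rightarrow>\<^sub>0 nat) \<Rightarrow> int poly" where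
  "vkey p = monom (int (fst p)) CARD('v) + mkey (snd p)"

lemma vkey_add: "vkey (j, m + m') = vkey (j, m) + mkey m'"
  by (simp add: vkey_def mkey_add)

lemma vkey_inj: "vkey p = vkey p' \<Longrightarrow> p = (p' :: nat \<times> ('v::finite \<Rightarrow>\<^sub>0 nat))"
proof -
  assume eq: "vkey p = vkey p'"
  have "coeff (vkey p) CARD('v) = int (fst p)" for p :: "nat \<times> ('v \<Rightarrow>\<^sub>0 nat)"
    by (simp add: vkey_def coeff_mkey_ge)
  then have f: "fst p = fst p'" using eq by (metis of_nat_eq_iff)
  with eq have "snd p = snd p'" by (intro mkey_inj) (simp add: vkey_def)
  with f show ?thesis by (simp add: prod_eq_iff)
qed

text \<open>Keys are additive, so the product of the leading monomials arises from one pair of terms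
  only and its coefficient cannot cancel.\<close>

lemma mpoly_no_zero_divisors:
  fixes f g :: "('v::finite, 'k::field) mpoly"
  assumes "f \<noteq> 0" "g \<noteq> 0"
  shows "f * g \<noteq> 0"
proof -
  have ex: "\<exists>m. Poly_Mapping.lookup f m \<noteq> 0 \<and> (\<forall>a. Poly_Mapping.lookup f a \<noteq> 0 \<longrightarrow> mkey a \<le> mkey m)"
    if "f \<noteq> 0" for f :: "('v, 'k) mpoly"
  proof -
    have "mkey ` Poly_Mapping.keys f \<noteq> {}" using that by simp
    then have "Max (mkey ` Poly_Mapping.keys f) \<in> mkey ` Poly_Mapping.keys f" by (intro Max_in) auto
    then obtain m where m: "m \<in> Poly_Mapping.keys f" "mkey m = Max (mkey ` Poly_Mapping.keys f)" by auto
    then have "mkey a \<le> mkey m" if "a \<in> Poly_Mapping.keys f" for a using that by simp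
    with m(1) show ?thesis by (auto simp: in_keys_iff)
  qed
  obtain m where m: "Poly_Mapping.lookup f m \<noteq> 0" "\<And>a. Poly_Mapping.lookup f a \<noteq> 0 \<Longrightarrow> mkey a \<le> mkey m"
    using ex[OF assms(1)] by blast
  obtain n where n: "Poly_Mapping.lookup g n \<noteq> 0" "\<And>a. Poly_Mapping.lookup g a \<noteq> 0 \<Longrightarrow> mkey a \<le> mkey n"
    using ex[OF assms(2)] by blast
  have eq: "a + b = m + n \<longleftrightarrow> a = m \<and> b = n" if "a \<in> Poly_Mapping.keys f" "b \<in> Poly_Mapping.keys g" for a b
  proof
    assume "a + b = m + n"
    then have "mkey a + mkey b = mkey m + mkey n" by (metis mkey_add)
    moreover have "mkey a \<le> mkey m" "mkey b \<le> mkey n" using m n that by (auto simp: in_keys_iff)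
    ultimately have "mkey a = mkey m" "mkey b = mkey n" by linarith+
    then show "a = m \<and> b = n" by (auto dest: mkey_inj)
  qed auto
  have "Poly_Mapping.lookup (f * g) (m + n) = (\<Sum>a\<in>Poly_Mapping.keys f. \<Sum>b\<in>Poly_Mapping.keys g.
      if a = m then if b = n then Poly_Mapping.lookup f a * Poly_Mapping.lookup g b else 0 else 0)"
    unfolding lookup_times by (intro sum.cong) (auto simp: eq)
  also have "\<dots> = (\<Sum>a\<in>Poly_Mapping.keys f. if a = m then
      \<Sum>b\<in>Poly_Mapping.keys g. if b = n then Poly_Mapping.lookup f a * Poly_Mapping.lookup g b else 0 else 0)"
    by (intro sum.cong) auto
  also have "\<dots> = Poly_Mapping.lookup f m * Poly_Mapping.lookup g n"
    using m(1) n(1) by (simp add: in_keys_iff)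
  finally show ?thesis using m(1) n(1) by auto
qed

definition graded_sub :: "nat \<Rightarrow> (nat \<Rightarrow> ('v::finite, 'k::comm_ring_1) mpoly) set \<Rightarrow> bool" where
  "graded_sub k N \<longleftrightarrow> fmod.subspace N \<and> N \<subseteq> Fr k \<and> (\<forall>w\<in>N. \<forall>e. (\<lambda>j. hcomp e (w j)) \<in> N)"

lemma graded_subD:
  assumes "graded_sub k N"
  shows "fmod.subspace N" "N \<subseteq> Fr k" "w \<in> N \<Longrightarrow> (\<lambda>j. hcomp e (w j)) \<in> N"
  using assms by (auto simp: graded_sub_def)

lemma finite_mdeg: "finite {m :: 'v::finite \<Rightarrow>\<^sub>0 nat. mdeg m = e}"
proof (rule finite_imageD)
  have "Poly_Mapping.lookup m i \<le> mdeg m" for m :: "'v \<Rightarrow>\<^sub>0 nat" and i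
    unfolding mdeg_def by (rule member_le_sum) auto
  then have "Poly_Mapping.lookup ` {m :: 'v \<Rightarrow>\<^sub>0 nat. mdeg m = e} \<subseteq> (UNIV :: 'v set) \<rightarrow>\<^sub>E {..e}" by auto
  then show "finite (Poly_Mapping.lookup ` {m :: 'v \<Rightarrow>\<^sub>0 nat. mdeg m = e})"
    by (rule finite_subset) (auto intro: finite_PiE)
  show "inj_on Poly_Mapping.lookup {m :: 'v \<Rightarrow>\<^sub>0 nat. mdeg m = e}"
    by (auto simp: inj_on_def lookup_inject)
qed

lemma sum_fun_apply: "sum f A x = (\<Sum>a\<in>A. f a x)"
  by (induction A rule: infinite_finite_induct) auto

lemma mem_if_hcomp:
  assumes N: "fmod.subspace N" and w: "w \<in> Fr k" and h: "\<And>e. (\<lambda>j. hcomp e (w j)) \<in> N"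
  shows "w \<in> N"
proof -
  have "\<forall>j. \<exists>b. \<forall>n\<ge>b. w j = (\<Sum>e<n. hcomp e (w j))" using ex_hcomp_sum by blast
  then obtain b where b: "\<And>j n. n \<ge> b j \<Longrightarrow> w j = (\<Sum>e<n. hcomp e (w j))" by metis
  define n where "n = Max (insert 0 (b ` {..<k}))"
  have "w j = (\<Sum>e<n. hcomp e (w j))" for j
  proof (cases "j < k")
    case True
    then have "b j \<le> n" unfolding n_def by (intro Max_ge) auto
    then show ?thesis by (rule b)
  next
    case False
    then have "w j = 0" using w by (auto simp: Fr_def)
    then show ?thesis by simp
  qed
  then have "w = (\<Sum>e<n. (\<lambda>j. hcomp e (w j)))"
    by (auto simp: fun_eq_iff sum_fun_apply)
  also have "\<dots> \<in> N" by (intro fmod.subspace_sum N h)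
  finally show ?thesis .
qed

text \<open>From each step of a strictly ascending chain take a new homogeneous element with
  smallest leading term. By \<open>Dickson\<close> one of these leading terms divides a later one;
  cancelling it with a multiple of the earlier element leaves a new element of the same degree with
  smaller leading term, a contradiction.\<close>

lemma wf_graded_sub:
  "wf {(N', N :: (nat \<Rightarrow> ('v::finite, 'k::field) mpoly) set). graded_sub k N \<and> graded_sub k N' \<and> N \<subset> N'}"
proof (rule ccontr)
  let ?lk = Poly_Mapping.lookup
  assume "\<not> ?thesis"
  then obtain N :: "nat \<Rightarrow> (nat \<Rightarrow> ('v, 'k) mpoly) set"
    where "\<forall>i. (N (Suc i), N i) \<in> {(N', N). graded_sub k N \<and> graded_sub k N' \<and> N \<subset> N'}"
    unfolding wf_iff_no_infinite_down_chain by blast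
  then have N: "\<And>i. graded_sub k (N i)" "\<And>i. N i \<subset> N (Suc i)" by auto
  have mono: "N a \<subseteq> N b" if "a \<le> b" for a b
    by (rule lift_Suc_mono_le[OF _ that]) (use N(2) in blast)
  define hom where "hom = (\<lambda>e (w :: nat \<Rightarrow> ('v, 'k) mpoly). \<forall>j. homogeneous (int e) (w j))"
  have "\<exists>e w p m. w \<in> N (Suc i) \<and> w \<notin> N i \<and> hom e w \<and> ?lk (w p) m \<noteq> 0 \<and>
      (\<forall>j a. ?lk (w j) a \<noteq> 0 \<longrightarrow> vkey (j, a) \<le> vkey (p, m)) \<and>
      (\<forall>w'. w' \<in> N (Suc i) \<and> w' \<notin> N i \<and> hom e w' \<longrightarrow>
         (\<exists>j a. ?lk (w' j) a \<noteq> 0 \<and> vkey (p, m) \<le> vkey (j, a)))" for i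
  proof -
    from N(2) obtain w0 where w0: "w0 \<in> N (Suc i)" "w0 \<notin> N i" by blast
    then obtain e where e: "(\<lambda>j. hcomp e (w0 j)) \<notin> N i"
      using mem_if_hcomp[of "N i" w0 k] graded_subD[OF N(1)] by blast
    define D where "D = {w. w \<in> N (Suc i) \<and> w \<notin> N i \<and> hom e w}"
    define sup where "sup = (\<lambda>w :: nat \<Rightarrow> ('v, 'k) mpoly. {(j, m). ?lk (w j) m \<noteq> 0})"
    \<comment> \<open>In the fixed degree \<open>e\<close> only finitely many terms can occur, so a
      smallest leading term exists by finiteness alone.\<close>
    define B where "B = {..<k} \<times> {m :: 'v \<Rightarrow>\<^sub>0 nat. mdeg m = e}"
    have finB: "finite B" by (simp add: B_def finite_mdeg)
    have supB: "sup w \<subseteq> B" if "w \<in> D" for w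
    proof -
      have "w \<in> Fr k" "hom e w" using that graded_subD(2)[OF N(1)] by (auto simp: D_def)
      then show ?thesis
        unfolding sup_def B_def hom_def Fr_def homogeneous_iff by (force simp: not_less[symmetric])
    qed
    have sup_ne: "sup w \<noteq> {}" if "w \<in> D" for w
    proof
      assume "sup w = {}"
      then have "w = 0" by (auto simp: sup_def fun_eq_iff intro!: poly_mapping_eqI)
      then show False using that fmod.subspace_0[OF graded_subD(1)[OF N(1)]] by (auto simp: D_def)
    qed
    define lead where "lead = (\<lambda>w. Max (vkey ` sup w))"
    have lead: "lead w \<in> vkey ` sup w" "\<And>x. x \<in> sup w \<Longrightarrow> vkey x \<le> lead w" if "w \<in> D" for w
      using sup_ne[OF that] finite_subset[OF supB[OF that] finB] unfolding lead_def by auto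
    have "(\<lambda>j. hcomp e (w0 j)) \<in> D"
      using w0 e graded_subD(3)[OF N(1)] by (simp add: D_def hom_def)
    moreover have fin: "finite (lead ` D)"
      using lead(1) supB by (intro finite_subset[OF _ finite_imageI[OF finB, of vkey]]) blast
    ultimately have "Min (lead ` D) \<in> lead ` D" by (intro Min_in) auto
    then obtain w where w: "w \<in> D" "lead w = Min (lead ` D)" by auto
    then have wmin: "lead w \<le> lead w'" if "w' \<in> D" for w' using that fin by simp
    obtain p m where pm: "(p, m) \<in> sup w" "lead w = vkey (p, m)" using lead(1)[OF w(1)] by auto
    have "\<exists>j a. ?lk (w' j) a \<noteq> 0 \<and> vkey (p, m) \<le> vkey (j, a)" if w': "w' \<in> D" for w'
    proof -
      obtain j a where "(j, a) \<in> sup w'" "lead w' = vkey (j, a)" using lead(1)[OF w'] by auto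
      then show ?thesis using wmin[OF w'] pm(2) by (auto simp: sup_def)
    qed
    moreover have "\<forall>j a. ?lk (w j) a \<noteq> 0 \<longrightarrow> vkey (j, a) \<le> vkey (p, m)"
      using lead(2)[OF w(1)] pm(2) by (auto simp: sup_def)
    moreover have "w \<in> N (Suc i) \<and> w \<notin> N i \<and> hom e w \<and> ?lk (w p) m \<noteq> 0"
      using w(1) pm(1) by (auto simp: D_def sup_def)
    ultimately show ?thesis unfolding D_def by blast
  qed
  then obtain e w p m where
    wN: "\<And>i. w i \<in> N (Suc i)" "\<And>i. w i \<notin> N i" and hom: "\<And>i. hom (e i) (w i)" and
    lk: "\<And>i. ?lk (w i (p i)) (m i) \<noteq> 0" and
    lead: "\<And>i j a. ?lk (w i j) a \<noteq> 0 \<Longrightarrow> vkey (j, a) \<le> vkey (p i, m i)" and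
    min: "\<And>i w'. w' \<in> N (Suc i) \<Longrightarrow> w' \<notin> N i \<Longrightarrow> hom (e i) w' \<Longrightarrow>
       \<exists>j a. ?lk (w' j) a \<noteq> 0 \<and> vkey (p i, m i) \<le> vkey (j, a)"
    by metis
  have pk: "p i < k" for i
  proof (rule ccontr)
    assume "\<not> p i < k"
    moreover have "w i \<in> Fr k" using wN(1)[of i] graded_subD(2)[OF N(1)] by blast
    ultimately have "w i (p i) = 0" by (simp add: Fr_def)
    then show False using lk[of i] by simp
  qed
  \<comment> \<open>Monotonicity of both \<open>p\<close> and \<open>k - p\<close> forces equal
    positions; the remaining functions are the exponents of the leading monomials.\<close>
  define G where "G = {p, \<lambda>i. k - p i} \<union> Set.range (\<lambda>x i. ?lk (m i) x)"
  have "finite G" by (simp add: G_def)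
  from Dickson[OF this] obtain f where f: "strict_mono f" "\<forall>g\<in>G. incseq (g \<circ> f)" by blast
  define a where "a = f 0"
  define b where "b = f 1"
  have ab: "a < b" using f(1) by (simp add: a_def b_def strict_mono_def)
  have le: "g a \<le> g b" if "g \<in> G" for g
    using f(2)[rule_format, OF that] by (simp add: a_def b_def incseq_def)
  have p: "p a = p b"
    using le[of p] le[of "\<lambda>i. k - p i"] pk[of a] pk[of b] by (simp add: G_def)
  define d where "d = m b - m a"
  have md: "m b = m a + d"
  proof (rule poly_mapping_eqI)
    fix x
    have "?lk (m a) x \<le> ?lk (m b) x" using le[of "\<lambda>i. ?lk (m i) x"] by (auto simp: G_def)
    then show "?lk (m b) x = ?lk (m a + d) x" by (simp add: d_def lookup_add lookup_minus)
  qed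
  \<comment> \<open>The quotient of the leading coefficients, so that \<open>g\<close> and
    \<open>w b\<close> have the same leading term.\<close>
  define c where "c = ?lk (w b (p b)) (m b) / ?lk (w a (p a)) (m a)"
  define g where "g = smul (Poly_Mapping.single d c) (w a)"
  have gN: "g \<in> N b"
    using fmod.subspace_scale[OF graded_subD(1)[OF N(1)] wN(1)] mono[of "Suc a" b] ab
    unfolding g_def by auto
  have ea: "mdeg (m i) = e i" for i using hom[of i] lk[of i] by (auto simp: hom_def homogeneous_iff)
  have eb: "e b = mdeg d + e a" unfolding ea[symmetric] md by simp
  have homg: "hom (e b) g"
    unfolding hom_def g_def smul_apply eb of_nat_add
    using hom[of a] by (intro allI homogeneous_mult homogeneous_single) (simp add: hom_def)
  have "w b - g \<in> N (Suc b)"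
    using gN wN(1)[of b] N(2)[of b] by (intro fmod.subspace_diff[OF graded_subD(1)[OF N(1)]]) auto
  moreover have "w b - g \<notin> N b"
  proof
    assume "w b - g \<in> N b"
    then have "(w b - g) + g \<in> N b" using gN by (intro fmod.subspace_add[OF graded_subD(1)[OF N(1)]])
    then show False using wN(2)[of b] by simp
  qed
  moreover have "hom (e b) (w b - g)"
    using hom[of b] homg by (auto simp: hom_def intro: homogeneous_diff)
  ultimately obtain j x where jx: "?lk ((w b - g) j) x \<noteq> 0" "vkey (p b, m b) \<le> vkey (j, x)"
    using min by blast
  have "vkey (j, x) \<le> vkey (p b, m b)"
  proof (cases "?lk (w b j) x = 0")
    case True
    then have "?lk (Poly_Mapping.single d c * w a j) x \<noteq> 0" using jx(1) by (simp add: g_def smul_apply lookup_minus)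
    then obtain y where y: "x = d + y" "?lk (w a j) y \<noteq> 0"
      by (auto simp: lookup_single_times_full split: if_splits)
    have "vkey (j, x) = vkey (j, y) + mkey d" unfolding y(1) add.commute[of d] by (rule vkey_add)
    also have "\<dots> \<le> vkey (p a, m a) + mkey d" using lead[OF y(2)] by simp
    also have "\<dots> = vkey (p b, m b)" unfolding md p by (simp add: vkey_add)
    finally show ?thesis .
  qed (rule lead)
  with jx(2) have "(j, x) = (p b, m b)" by (intro vkey_inj antisym)
  moreover have "?lk (g (p b)) (m b) = ?lk (w b (p b)) (m b)"
    using lk[of a] unfolding g_def smul_apply md
    by (simp add: lookup_single_times add.commute[of "m a"] c_def p md)
  ultimately show False using jx(1) by (simp add: lookup_minus)
qed

section \<open>Associated primes of graded modules\<close>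

definition hvec :: "nat \<Rightarrow> (nat \<Rightarrow> ('v::finite, 'k::comm_ring_1) mpoly) \<Rightarrow> bool" where
  "hvec e w \<longleftrightarrow> (\<forall>j. homogeneous (int e) (w j))"

lemma hvec_smul: "homogeneous (int d) f \<Longrightarrow> hvec e w \<Longrightarrow> hvec (d + e) (smul f w)"
  by (simp add: hvec_def smul_apply homogeneous_mult)

lemma smul_Fr: "w \<in> Fr k \<Longrightarrow> smul f w \<in> Fr k"
  by (rule fmod.subspace_scale[OF subspace_Fr])

lemma hcomp_smul:
  assumes "homogeneous (int d) f"
  shows "(\<lambda>j. hcomp (d + e) (smul f w j)) = smul f (\<lambda>j. hcomp e (w j))"
  by (simp add: fun_eq_iff smul_apply hcomp_mult[OF assms])

lemma graded_ideal_colon: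
  assumes N: "graded_sub k N" and w: "hvec e w"
  shows "graded_ideal (colon N w)"
  unfolding graded_ideal_def
proof (intro conjI ballI allI)
  show "ring_ideal (colon N w)" by (rule ring_ideal_colon[OF graded_subD(1)[OF N]])
next
  fix f i assume "f \<in> colon N w"
  then have "(\<lambda>j. hcomp (e + i) (smul f w j)) \<in> N"
    using graded_subD(3)[OF N] by (simp add: colon_def)
  moreover have "(\<lambda>j. hcomp (e + i) (smul f w j)) = smul (hcomp i f) w"
    using w hcomp_mult[of e "w _" "e + i" f] by (simp add: fun_eq_iff smul_apply hvec_def mult.commute)
  ultimately show "hcomp i f \<in> colon N w" by (simp add: colon_def)
qed

lemma graded_sub_ideal:
  assumes I: "graded_ideal I"
  shows "graded_sub 1 {w \<in> Fr 1. w 0 \<in> I}"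
  using graded_idealD[OF I] fmod.subspace_0[OF subspace_Fr] fmod.subspace_add[OF subspace_Fr] smul_Fr
  unfolding graded_sub_def fmod.subspace_def
  by (auto simp: smul_apply Fr_def intro: ring_ideal_0 ring_ideal_add ring_ideal_mult)

lemma wf_graded_ideal:
  "wf {(I', I :: ('v::finite, 'k::field) mpoly set). graded_ideal I \<and> graded_ideal I' \<and> I \<subset> I'}"
proof -
  define V where "V = (\<lambda>I :: ('v, 'k) mpoly set. {w \<in> Fr 1. w 0 \<in> I})"
  have V: "graded_sub 1 (V I)" if "graded_ideal I" for I
    unfolding V_def using that by (rule graded_sub_ideal)
  have inj: "I = I'" if "V I = V I'" for I I'
  proof -
    have "f \<in> I \<longleftrightarrow> (\<lambda>j. if j = 0 then f else 0) \<in> V I" for f I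
      by (simp add: V_def Fr_def)
    then show ?thesis using that by blast
  qed
  have mono: "V I \<subseteq> V I'" if "I \<subseteq> I'" for I I' using that by (auto simp: V_def)
  have "{(I', I). graded_ideal I \<and> graded_ideal I' \<and> I \<subset> I'} \<subseteq>
      inv_image {(N', N). graded_sub 1 N \<and> graded_sub 1 N' \<and> N \<subset> N'} V"
    using V inj by (auto simp: inv_image_def psubset_eq dest: mono[THEN subsetD])
  then show ?thesis by (rule wf_subset[OF wf_inv_image[OF wf_graded_sub]])
qed

text \<open>Take an annihilator \<open>I\<close> of a homogeneous \<open>u\<close> that is maximal
  among those inside \<open>P\<close>, and let \<open>a b\<close> lie in \<open>I\<close>. If the
  annihilator of \<open>b u\<close> stays inside \<open>P\<close>, it equals \<open>I\<close> and
  contains \<open>a\<close>. Otherwise a homogeneous \<open>s\<close> outside \<open>P\<close> kills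
  \<open>b u\<close>; the annihilator of \<open>s u\<close> is inside \<open>P\<close> by primality,
  so it equals \<open>I\<close>, and it contains \<open>b\<close>. Bounding by \<open>P\<close>
  takes the place of localising at \<open>P\<close>.\<close>

lemma associated_prime_between:
  fixes N :: "(nat \<Rightarrow> ('v::finite, 'k::field) mpoly) set"
  assumes N: "graded_sub k N" and P: "graded_ideal P" "prime_ideal P"
    and w: "w \<in> Fr k" "hvec e w" "colon N w \<subseteq> P"
  obtains e' w' where "w' \<in> Fr k" "hvec e' w'" "prime_ideal (colon N w')"
    "colon N w \<subseteq> colon N w'" "colon N w' \<subseteq> P"
proof -
  define Q where "Q = {I. \<exists>e' w'. I = colon N w' \<and> w' \<in> Fr k \<and> hvec e' w' \<and> colon N w \<subseteq> I \<and> I \<subseteq> P}"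
  have "colon N w \<in> Q" using w by (auto simp: Q_def)
  then have "\<exists>I\<in>Q. \<forall>I'. (I', I) \<in> {(I', I). graded_ideal I \<and> graded_ideal I' \<and> I \<subset> I'} \<longrightarrow> I' \<notin> Q"
    using wf_graded_ideal unfolding wf_eq_minimal by blast
  then obtain I where I: "I \<in> Q" "\<And>I'. (I', I) \<in> {(I', I). graded_ideal I \<and> graded_ideal I' \<and> I \<subset> I'} \<Longrightarrow> I' \<notin> Q"
    by blast
  then obtain e' u where u: "I = colon N u" "u \<in> Fr k" "hvec e' u" "colon N w \<subseteq> I" "I \<subseteq> P"
    unfolding Q_def by blast
  have gI: "graded_ideal I" unfolding u(1) by (rule graded_ideal_colon[OF N u(3)])
  have max: "\<not> I \<subset> I'" if "I' \<in> Q" for I'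
  proof -
    have "graded_ideal I'" using that graded_ideal_colon[OF N] unfolding Q_def by blast
    then show ?thesis using I(2)[of I'] gI that by blast
  qed
  have enlarge: "I \<subseteq> colon N (smul b u)" for b
  proof
    fix c assume "c \<in> I"
    then have "smul c u \<in> N" by (simp add: u(1) colon_def)
    then have "smul b (smul c u) \<in> N" by (rule fmod.subspace_scale[OF graded_subD(1)[OF N]])
    then show "c \<in> colon N (smul b u)" by (simp add: colon_def mult.commute)
  qed
  have mult: "a \<in> colon N (smul b u) \<longleftrightarrow> a * b \<in> I" for a b
    by (simp add: u(1) colon_def)
  have no_larger: "colon N (smul b u) \<subseteq> I" if b: "homogeneous (int d) b" "colon N (smul b u) \<subseteq> P" for b d
  proof -
    have "colon N (smul b u) \<in> Q"
      using b u enlarge[of b] hvec_smul[OF b(1) u(3)] smul_Fr[OF u(2)] unfolding Q_def by blast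
    from max[OF this] enlarge[of b] show ?thesis by blast
  qed
  have "prime_ideal I"
  proof (rule prime_idealI_graded[OF gI])
    show "1 \<notin> I" using u(5) P(2) by (auto simp: prime_ideal_def)
  next
    fix a b d d' assume ab: "homogeneous (int d) a" "homogeneous (int d') b" "a * b \<in> I"
    show "a \<in> I \<or> b \<in> I"
    proof (cases "colon N (smul b u) \<subseteq> P")
      case True
      then have "a \<in> I" using no_larger[OF ab(2)] mult ab(3) by blast
      then show ?thesis ..
    next
      case False
      then obtain s where s: "s \<in> colon N (smul b u)" "s \<notin> P" by blast
      then obtain i where i: "hcomp i s \<notin> P"
        using ring_ideal_if_hcomp[of P s] graded_idealD(1)[OF P(1)] by blast
      have "hcomp i s \<in> colon N (smul b u)"
        by (rule graded_idealD(2)[OF graded_ideal_colon[OF N hvec_smul[OF ab(2) u(3)]] s(1)])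
      then have "b \<in> colon N (smul (hcomp i s) u)" by (simp add: mult mult.commute)
      moreover have "colon N (smul (hcomp i s) u) \<subseteq> P"
        using i P(2) u(5) mult unfolding prime_ideal_def by blast
      ultimately have "b \<in> I" using no_larger[OF homogeneous_hcomp] by blast
      then show ?thesis ..
    qed
  qed
  with u that show thesis by blast
qed

text \<open>The irrelevant maximal ideal in coefficient form. As a prime above every proper graded
  ideal it serves as the upper bound \<open>P\<close> when any associated prime will do.\<close>

definition Irr :: "('v, 'k::comm_ring_1) mpoly set" where
  "Irr = {f. Poly_Mapping.lookup f 0 = 0}"

lemma lookup_mult_0:
  "Poly_Mapping.lookup (f * g :: ('v::finite, 'k::comm_ring_1) mpoly) 0 = Poly_Mapping.lookup f 0 * Poly_Mapping.lookup g 0"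
proof -
  have "a + b = 0 \<longleftrightarrow> a = 0 \<and> b = 0" for a b :: "'v \<Rightarrow>\<^sub>0 nat"
    by (metis add.right_neutral add_is_0 mdeg_add mdeg_eq_0)
  then have "Poly_Mapping.lookup (f * g) 0 = (\<Sum>a\<in>Poly_Mapping.keys f. if a = 0 then
      \<Sum>b\<in>Poly_Mapping.keys g. if b = 0 then Poly_Mapping.lookup f a * Poly_Mapping.lookup g b else 0 else 0)"
    unfolding lookup_times by (intro sum.cong) auto
  also have "\<dots> = Poly_Mapping.lookup f 0 * Poly_Mapping.lookup g 0"
    by (auto simp: in_keys_iff)
  finally show ?thesis .
qed

lemma graded_ideal_Irr: "graded_ideal (Irr :: ('v::finite, 'k::comm_ring_1) mpoly set)"
  by (auto simp: graded_ideal_def ring_ideal_def Irr_def lookup_add lookup_mult_0 lookup_hcomp)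

lemma prime_ideal_Irr: "prime_ideal (Irr :: ('v::finite, 'k::field) mpoly set)"
  using graded_ideal_Irr
  by (auto simp: prime_ideal_def graded_ideal_def Irr_def lookup_mult_0 lookup_one)

text \<open>A nonzero constant term would be a component of degree 0 in \<open>I\<close>, hence a
  unit.\<close>

lemma graded_ideal_le_Irr:
  fixes I :: "('v::finite, 'k::field) mpoly set"
  assumes I: "graded_ideal I" "1 \<notin> I"
  shows "I \<subseteq> Irr"
proof
  fix f assume f: "f \<in> I"
  show "f \<in> Irr"
  proof (rule ccontr)
    assume "f \<notin> Irr"
    then have c: "Poly_Mapping.lookup f 0 \<noteq> 0" by (simp add: Irr_def)
    have "hcomp 0 f = Poly_Mapping.single 0 (Poly_Mapping.lookup f 0)"
      by (rule poly_mapping_eqI) (auto simp: lookup_hcomp mdeg_eq_0 lookup_single when_def)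
    then have "Poly_Mapping.single 0 (inverse (Poly_Mapping.lookup f 0)) * hcomp 0 f = 1"
      using c by (simp add: mult_single)
    moreover have "hcomp 0 f \<in> I" by (rule graded_idealD(2)[OF I(1) f])
    ultimately show False using ring_ideal_mult[OF graded_idealD(1)[OF I(1)]] I(2) by metis
  qed
qed

lemma colon_le_Irr:
  fixes N :: "(nat \<Rightarrow> ('v::finite, 'k::field) mpoly) set"
  assumes "graded_sub k N" "hvec e w" "w \<notin> N"
  shows "colon N w \<subseteq> Irr"
  using assms by (intro graded_ideal_le_Irr graded_ideal_colon) (auto simp: colon_def)

definition assoc_primes :: "nat \<Rightarrow> (nat \<Rightarrow> ('v::finite, 'k::comm_ring_1) mpoly) set \<Rightarrow> ('v, 'k) mpoly set set" where
  "assoc_primes k N = {colon N w |w e. w \<in> Fr k \<and> hvec e w \<and> prime_ideal (colon N w)}"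

lemma graded_sub_add_multiples:
  fixes N :: "(nat \<Rightarrow> ('v::finite, 'k::comm_ring_1) mpoly) set"
  assumes N: "graded_sub k N" and w: "w \<in> Fr k" "hvec e w"
  shows "graded_sub k {u + smul f w |u f. u \<in> N}"
  unfolding graded_sub_def fmod.subspace_def
proof (intro conjI ballI allI subsetI)
  let ?M = "{u + smul f w |u f. u \<in> N}"
  note S = graded_subD(1)[OF N]
  have "0 = 0 + smul 0 w" by simp
  then show "0 \<in> ?M" using fmod.subspace_0[OF S] by blast
  fix x assume "x \<in> ?M"
  then obtain u f where x: "x = u + smul f w" "u \<in> N" by blast
  have "u \<in> Fr k" using x(2) graded_subD(2)[OF N] by blast
  then show "x \<in> Fr k" unfolding x(1) by (intro fmod.subspace_add[OF subspace_Fr] smul_Fr w)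
  show "smul c x \<in> ?M" for c
  proof -
    have "smul c x = smul c u + smul (c * f) w" by (simp add: x(1) fmod.scale_right_distrib)
    then show ?thesis using fmod.subspace_scale[OF S x(2)] by blast
  qed
  show "x + y \<in> ?M" if yM: "y \<in> ?M" for y
  proof -
    obtain u' f' where y: "y = u' + smul f' w" "u' \<in> N" using yM by blast
    have "x + y = (u + u') + smul (f + f') w" by (simp add: x(1) y(1) fmod.scale_left_distrib)
    then show ?thesis using fmod.subspace_add[OF S x(2) y(2)] by blast
  qed
  show "(\<lambda>j. hcomp i (x j)) \<in> ?M" for i
  proof -
    have "(\<lambda>j. hcomp i (x j)) = (\<lambda>j. hcomp i (u j)) + smul (if e \<le> i then hcomp (i - e) f else 0) w"
      using w(2) hcomp_mult[of e "w _" i f]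
      by (simp add: x(1) fun_eq_iff hcomp_add smul_apply hvec_def mult.commute)
    then show ?thesis using graded_subD(3)[OF N x(2)] by blast
  qed
qed

text \<open>Noetherian induction: adjoin a \<open>w\<close> with prime annihilator to
  \<open>N\<close>. The submodule generated by \<open>w\<close> is \<open>R\<close> modulo that
  prime and has no other associated prime, while every other associated prime survives in the larger
  quotient.\<close>

lemma finite_assoc_primes:
  fixes N :: "(nat \<Rightarrow> ('v::finite, 'k::field) mpoly) set"
  assumes "graded_sub k N"
  shows "finite (assoc_primes k N)"
  using assms
proof (induction N rule: wf_induct_rule[OF wf_graded_sub[of k]])
  case (1 N)
  note N = 1(2)
  show ?case
  proof (cases "assoc_primes k N = {}")
    case False
    then obtain w e where w: "w \<in> Fr k" "hvec e w" "prime_ideal (colon N w)"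
      unfolding assoc_primes_def by blast
    define N' where "N' = {u + smul f w |u f. u \<in> N}"
    have N': "graded_sub k N'" unfolding N'_def by (rule graded_sub_add_multiples[OF N w(1,2)])
    have sub: "N \<subseteq> N'"
    proof
      fix u assume "u \<in> N"
      moreover have "u = u + smul 0 w" by simp
      ultimately show "u \<in> N'" unfolding N'_def by blast
    qed
    have "w = 0 + smul 1 w" by simp
    then have "w \<in> N'" using fmod.subspace_0[OF graded_subD(1)[OF N]] unfolding N'_def by blast
    moreover have "w \<notin> N" using w(3) by (auto simp: prime_ideal_def colon_def)
    ultimately have "N \<subset> N'" using sub by blast
    then have fin: "finite (assoc_primes k N')" using 1(1) N N' by simp
    have "assoc_primes k N \<subseteq> insert (colon N w) (assoc_primes k N')"
    proof
      fix Q assume "Q \<in> assoc_primes k N"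
      then obtain u d where u: "Q = colon N u" "u \<in> Fr k" "hvec d u" "prime_ideal Q"
        unfolding assoc_primes_def by blast
      show "Q \<in> insert (colon N w) (assoc_primes k N')"
      proof (cases "colon N' u \<subseteq> colon N u")
        case True
        then have "colon N' u = Q" using sub by (auto simp: u(1) colon_def)
        then have "Q \<in> assoc_primes k N'" using u unfolding assoc_primes_def by blast
        then show ?thesis by blast
      next
        case False
        then obtain a where a: "smul a u \<in> N'" "smul a u \<notin> N" by (auto simp: colon_def)
        then obtain n b where nb: "smul a u = n + smul b w" "n \<in> N" unfolding N'_def by blast
        have bw: "smul b w \<notin> N"
          using a(2) nb fmod.subspace_add[OF graded_subD(1)[OF N]] by metis
        \<comment> \<open>Nonzero multiples of an element with prime annihilator have the same
          annihilator; \<open>a u\<close> and \<open>b w\<close> are such multiples and agree modulo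
          \<open>N\<close>.\<close>
        have 1: "c \<in> colon N (smul a u) \<longleftrightarrow> c \<in> Q" for c
          using u(4) a(2) by (auto simp: prime_ideal_def u(1) colon_def ring_ideal_def mult.commute)
        have 2: "c \<in> colon N (smul b w) \<longleftrightarrow> c \<in> colon N w" for c
          using w(3) bw by (auto simp: prime_ideal_def colon_def ring_ideal_def mult.commute)
        have 3: "c \<in> colon N (smul a u) \<longleftrightarrow> c \<in> colon N (smul b w)" for c
        proof -
          have eq: "smul c (smul a u) = smul c n + smul c (smul b w)"
            unfolding nb(1) by (rule fmod.scale_right_distrib)
          have cn: "smul c n \<in> N" by (rule fmod.subspace_scale[OF graded_subD(1)[OF N] nb(2)])
          have "smul c (smul b w) = smul c (smul a u) - smul c n" unfolding eq by simp
          with eq cn show ?thesis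
            using fmod.subspace_add[OF graded_subD(1)[OF N]] fmod.subspace_diff[OF graded_subD(1)[OF N]]
            unfolding colon_def mem_Collect_eq by metis
        qed
        have "Q = colon N w" using 1 2 3 by blast
        then show ?thesis by blast
      qed
    qed
    then show ?thesis using fin finite_subset by blast
  qed simp
qed

text \<open>On the line \<open>x + c Var i\<close> each ideal is met for at most one
  \<open>c\<close>: two values would put \<open>Var i\<close>, and then \<open>x\<close>, into it.
  An infinite field leaves a value of \<open>c\<close> outside these finitely many.\<close>

lemma linear_form_avoiding:
  fixes PS :: "('v::finite, 'k::field_char_0) mpoly set set"
  assumes "finite PS" "\<And>P. P \<in> PS \<Longrightarrow> ring_ideal P \<and> (\<exists>i. Var i \<notin> P)"
  shows "\<exists>x. homogeneous 1 x \<and> (\<forall>P\<in>PS. x \<notin> P)"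
  using assms
proof (induction PS)
  case empty
  show ?case by (rule exI[of _ 0]) simp
next
  case (insert P PS)
  then obtain x where x: "homogeneous 1 x" "\<And>P. P \<in> PS \<Longrightarrow> x \<notin> P" by blast
  obtain i where i: "Var i \<notin> P" using insert.prems by blast
  define y where "y = (\<lambda>c. x + Poly_Mapping.single 0 c * Var i)"
  have one: "c = c'" if Q: "Q \<in> insert P PS" and cc: "y c \<in> Q" "y c' \<in> Q" for c c' Q
  proof (rule ccontr)
    assume ne: "c \<noteq> c'"
    have R: "ring_ideal Q" using insert.prems Q by blast
    have "y c - y c' = Poly_Mapping.single 0 (c - c') * Var i"
      by (simp add: y_def single_diff left_diff_distrib)
    then have "Poly_Mapping.single 0 (c - c') * Var i \<in> Q" using ring_ideal_diff[OF R cc] by simp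
    from ring_ideal_mult[OF R this, of "Poly_Mapping.single 0 (inverse (c - c'))"]
    have "Poly_Mapping.single 0 (inverse (c - c')) * Poly_Mapping.single 0 (c - c') * Var i \<in> Q"
      by (simp only: mult.assoc)
    then have v: "Var i \<in> Q" using ne by (simp add: mult_single)
    then have "x \<in> Q"
      using ring_ideal_diff[OF R cc(1) ring_ideal_mult[OF R v, of "Poly_Mapping.single 0 c"]] by (simp add: y_def)
    then show False using Q x(2) v i by blast
  qed
  have "finite {c. y c \<in> Q}" if "Q \<in> insert P PS" for Q
  proof (cases "\<exists>c. y c \<in> Q")
    case True
    then obtain c where "y c \<in> Q" by blast
    then have "{c. y c \<in> Q} \<subseteq> {c}" using one[OF that] by blast
    then show ?thesis using finite_subset by blast
  qed auto
  then have "finite (\<Union>Q\<in>insert P PS. {c. y c \<in> Q})" using insert.hyps by blast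
  then obtain c where c: "c \<notin> (\<Union>Q\<in>insert P PS. {c. y c \<in> Q})"
    using infinite_UNIV_char_0[where ?'a = 'k] by (metis ex_new_if_finite)
  have "homogeneous (0 + 1) (Poly_Mapping.single 0 c * Var i)"
    by (rule homogeneous_mult[OF _ homogeneous_Var]) (use homogeneous_single[of 0 c] in simp)
  then have "homogeneous 1 (y c)" unfolding y_def by (intro homogeneous_add x(1)) simp
  then show ?case using c by blast
qed

text \<open>A homogeneous zero divisor modulo \<open>N\<close> lies in some associated prime, and
  \<open>depth\<close> says that none of these contains all variables.\<close>

lemma ex_linear_nonzerodivisor:
  fixes N :: "(nat \<Rightarrow> ('v::finite, 'k::field_char_0) mpoly) set"
  assumes N: "graded_sub k N"
    and depth: "\<And>w. w \<in> Fr k \<Longrightarrow> (\<And>i. smul (Var i) w \<in> N) \<Longrightarrow> w \<in> N"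
  obtains x where "homogeneous 1 x" "\<And>w. w \<in> Fr k \<Longrightarrow> smul x w \<in> N \<Longrightarrow> w \<in> N"
proof -
  have "ring_ideal P \<and> (\<exists>i. Var i \<notin> P)" if P: "P \<in> assoc_primes k N" for P
  proof -
    obtain w where w: "P = colon N w" "w \<in> Fr k" "prime_ideal P"
      using P unfolding assoc_primes_def by blast
    have "w \<notin> N" using w(3) by (auto simp: w(1) prime_ideal_def colon_def)
    then have "\<exists>i. Var i \<notin> P" using depth[OF w(2)] by (auto simp: w(1) colon_def)
    then show ?thesis using w(3) by (auto simp: prime_ideal_def)
  qed
  from linear_form_avoiding[OF finite_assoc_primes[OF N] this]
  obtain x where x: "homogeneous 1 x" "\<And>P. P \<in> assoc_primes k N \<Longrightarrow> x \<notin> P" by blast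
  have "w \<in> N" if w: "w \<in> Fr k" "smul x w \<in> N" for w
  proof (rule mem_if_hcomp[OF graded_subD(1)[OF N] w(1)], rule ccontr)
    fix e
    let ?w = "\<lambda>j. hcomp e (w j)"
    assume ne: "?w \<notin> N"
    have hw: "hvec e ?w" by (simp add: hvec_def)
    have wF: "?w \<in> Fr k" using w(1) by (simp add: Fr_def)
    have "(\<lambda>j. hcomp (1 + e) (smul x w j)) = smul x ?w" by (rule hcomp_smul) (simp add: x(1))
    then have "smul x ?w \<in> N" using graded_subD(3)[OF N w(2)] by metis
    then have xc: "x \<in> colon N ?w" by (simp add: colon_def)
    obtain e' w' where "w' \<in> Fr k" "hvec e' w'" "prime_ideal (colon N w')" "colon N ?w \<subseteq> colon N w'"
      by (rule associated_prime_between[OF N graded_ideal_Irr prime_ideal_Irr wF hw colon_le_Irr[OF N hw ne]])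
    then have "colon N w' \<in> assoc_primes k N" "x \<in> colon N w'" using xc unfolding assoc_primes_def by blast+
    then show False using x(2) by blast
  qed
  with x(1) that show thesis by blast
qed

lemma graded_sub_mod_linear:
  fixes N :: "(nat \<Rightarrow> ('v::finite, 'k::comm_ring_1) mpoly) set"
  assumes N: "graded_sub k N" and x: "homogeneous 1 x"
  shows "graded_sub k {u + smul x v |u v. u \<in> N \<and> v \<in> Fr k}"
  unfolding graded_sub_def fmod.subspace_def
proof (intro conjI ballI allI subsetI)
  let ?M = "{u + smul x v |u v. u \<in> N \<and> v \<in> Fr k}"
  note S = graded_subD(1)[OF N]
  have "0 = 0 + smul x 0" by simp
  then show "0 \<in> ?M" using fmod.subspace_0[OF S] fmod.subspace_0[OF subspace_Fr] by blast
  fix y assume "y \<in> ?M"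
  then obtain u v where y: "y = u + smul x v" "u \<in> N" "v \<in> Fr k" by blast
  have "u \<in> Fr k" using y(2) graded_subD(2)[OF N] by blast
  then show "y \<in> Fr k" unfolding y(1) by (intro fmod.subspace_add[OF subspace_Fr] smul_Fr y)
  show "smul c y \<in> ?M" for c
  proof -
    have "smul c y = smul c u + smul x (smul c v)" by (simp add: y(1) fmod.scale_right_distrib mult.commute)
    then show ?thesis using fmod.subspace_scale[OF S y(2)] smul_Fr[OF y(3)] by blast
  qed
  show "y + z \<in> ?M" if zM: "z \<in> ?M" for z
  proof -
    obtain u' v' where z: "z = u' + smul x v'" "u' \<in> N" "v' \<in> Fr k" using zM by blast
    have "y + z = (u + u') + smul x (v + v')" by (simp add: y(1) z(1) fmod.scale_right_distrib)
    then show ?thesis using fmod.subspace_add[OF S y(2) z(2)] fmod.subspace_add[OF subspace_Fr y(3) z(3)] by blast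
  qed
  show "(\<lambda>j. hcomp i (y j)) \<in> ?M" for i
  proof -
    define v' where "v' = (\<lambda>j. if 1 \<le> i then hcomp (i - 1) (v j) else 0)"
    have "homogeneous (int 1) x" using x by simp
    from hcomp_mult[OF this] have "(\<lambda>j. hcomp i (y j)) = (\<lambda>j. hcomp i (u j)) + smul x v'"
      by (simp add: y(1) fun_eq_iff hcomp_add smul_apply v'_def)
    moreover have "v' \<in> Fr k" using y(3) by (simp add: Fr_def v'_def)
    ultimately show ?thesis using graded_subD(3)[OF N y(2)] by blast
  qed
qed

text \<open>If the submodule of \<open>R\<^sup>k / N\<close> killed by \<open>P\<close> were contained in \<open>x (R\<^sup>k / N)\<close>, it would be
  divisible by \<open>x\<close>, and dividing a homogeneous element repeatedly by \<open>x\<close> would lower its degree forever.\<close>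

lemma annihilated_mod_linear:
  fixes N :: "(nat \<Rightarrow> ('v::finite, 'k::comm_ring_1) mpoly) set"
  assumes N: "graded_sub k N" and x: "homogeneous 1 x"
    and nzd: "\<And>w. w \<in> Fr k \<Longrightarrow> smul x w \<in> N \<Longrightarrow> w \<in> N"
    and "w \<in> Fr k" "hvec e w" "w \<notin> N" "P \<subseteq> colon N w"
  shows "\<exists>e' w'. w' \<in> Fr k \<and> hvec e' w' \<and> w' \<notin> {u + smul x v |u v. u \<in> N \<and> v \<in> Fr k} \<and> P \<subseteq> colon N w'"
  using assms(4-)
proof (induction e arbitrary: w)
  let ?M = "{u + smul x v |u v. u \<in> N \<and> v \<in> Fr k}"
  case 0
  have "w \<notin> ?M"
  proof
    assume "w \<in> ?M"
    then obtain u v where w: "w = u + smul x v" "u \<in> N" "v \<in> Fr k" by blast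
    have "w = (\<lambda>j. hcomp 0 (w j))"
      using \<open>hvec 0 w\<close> hcomp_homogeneous[of 0 "w _" 0] by (simp add: hvec_def fun_eq_iff)
    also have "\<dots> = (\<lambda>j. hcomp 0 (u j))"
      using hcomp_mult[of 1 x 0] x by (simp add: w(1) hcomp_add smul_apply)
    also have "\<dots> \<in> N" by (rule graded_subD(3)[OF N w(2)])
    finally show False using \<open>w \<notin> N\<close> by simp
  qed
  then show ?case using 0 by blast
next
  let ?M = "{u + smul x v |u v. u \<in> N \<and> v \<in> Fr k}"
  case (Suc e)
  show ?case
  proof (cases "w \<in> ?M")
    case True
    then obtain u v where w: "w = u + smul x v" "u \<in> N" "v \<in> Fr k" by blast
    define u' where "u' = (\<lambda>j. hcomp (Suc e) (u j))"
    define v' where "v' = (\<lambda>j. hcomp e (v j))"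
    have u': "u' \<in> N" unfolding u'_def by (rule graded_subD(3)[OF N w(2)])
    have v': "v' \<in> Fr k" "hvec e v'" using w(3) by (auto simp: v'_def Fr_def hvec_def)
    have "w = (\<lambda>j. hcomp (Suc e) (w j))"
      using \<open>hvec (Suc e) w\<close> hcomp_homogeneous[of "Suc e" "w _" "Suc e"] by (simp add: hvec_def fun_eq_iff)
    also have "\<dots> = u' + smul x v'"
      using hcomp_mult[of 1 x "Suc e"] x by (simp add: w(1) hcomp_add smul_apply u'_def v'_def fun_eq_iff)
    finally have eq: "w = u' + smul x v'" .
    have "v' \<notin> N"
    proof
      assume "v' \<in> N"
      then have "w \<in> N" unfolding eq
        by (intro fmod.subspace_add[OF graded_subD(1)[OF N] u'] fmod.subspace_scale[OF graded_subD(1)[OF N]])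
      then show False using Suc.prems by blast
    qed
    moreover have "P \<subseteq> colon N v'"
    proof
      fix p assume "p \<in> P"
      then have pw: "smul p w \<in> N" using Suc.prems by (auto simp: colon_def)
      have "smul x (smul p v') = smul p w - smul p u'"
        by (simp add: eq fmod.scale_right_distrib mult.commute)
      also have "\<dots> \<in> N"
        by (intro fmod.subspace_diff[OF graded_subD(1)[OF N] pw] fmod.subspace_scale[OF graded_subD(1)[OF N] u'])
      finally have "smul p v' \<in> N" by (rule nzd[OF smul_Fr[OF v'(1)]])
      then show "p \<in> colon N v'" by (simp add: colon_def)
    qed
    ultimately show ?thesis using Suc.IH[OF v'] by blast
  qed (use Suc in blast)
qed

text \<open>Depth is bounded by the dimension of each associated prime. Modulo a linear
  nonzerodivisor \<open>x\<close> the vanishing range drops by one, a nonzero class is still killed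
  by \<open>colon N w\<close>, and an associated prime above its annihilator also contains
  \<open>x\<close>, hence is strictly larger.\<close>

lemma chain_above_associated_prime:
  fixes N :: "(nat \<Rightarrow> ('v::finite, 'k::field_char_0) mpoly) set"
  assumes "graded_sub k N" "fmod.kvanish vars (Suc q) (Fr k) N"
    and "w \<in> Fr k" "hvec e w" "prime_ideal (colon N w)"
  shows "\<exists>Ps. length Ps = Suc q \<and> hd Ps = colon N w \<and> set Ps \<subseteq> proj_points \<and> sorted_wrt (\<subset>) Ps"
  using assms
proof (induction q arbitrary: N w e)
  case (0 N w e)
  note N = 0(1) and w = 0(3-5)
  have "w \<notin> N" using w(3) by (auto simp: prime_ideal_def colon_def)
  then have "\<exists>i. Var i \<notin> colon N w"
    using fmod.kvanish_annihilated[OF graded_subD(1)[OF N] 0(2) w(1)] by (auto simp: set_vars colon_def)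
  then have "colon N w \<in> proj_points"
    using w(3) graded_ideal_colon[OF N w(2)] by (simp add: proj_points_iff)
  then show ?case by (intro exI[of _ "[colon N w]"]) simp
next
  case (Suc q N w e)
  note N = Suc.prems(1) and w = Suc.prems(3-5)
  note ann = fmod.kvanish_annihilated[OF graded_subD(1)[OF N] Suc.prems(2)]
  have "w \<in> N" if "w \<in> Fr k" "\<And>i. smul (Var i) w \<in> N" for w
    using ann[OF that(1)] that(2) by (auto simp: set_vars)
  then obtain x where x: "homogeneous 1 x" "\<And>w. w \<in> Fr k \<Longrightarrow> smul x w \<in> N \<Longrightarrow> w \<in> N"
    using ex_linear_nonzerodivisor[OF N] by blast
  define M where "M = {u + smul x v |u v. u \<in> N \<and> v \<in> Fr k}"
  have M: "graded_sub k M" unfolding M_def by (rule graded_sub_mod_linear[OF N x(1)])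
  have kv: "fmod.kvanish vars (Suc q) (Fr k) M"
    unfolding M_def
    by (rule fmod.kvanish_mod_nonzerodivisor[OF graded_subD(1)[OF N] subspace_Fr graded_subD(2)[OF N] x(2) Suc.prems(2)])
  have wN: "w \<notin> N" using w(3) by (auto simp: prime_ideal_def colon_def)
  obtain d v where v: "v \<in> Fr k" "hvec d v" "v \<notin> M" "colon N w \<subseteq> colon N v"
    using annihilated_mod_linear[OF N x w(1,2) wN subset_refl] unfolding M_def by blast
  have NM: "N \<subseteq> M"
  proof
    fix u assume "u \<in> N"
    moreover have "u = u + smul x 0" by simp
    ultimately show "u \<in> M" using fmod.subspace_0[OF subspace_Fr] unfolding M_def by blast
  qed
  have xM: "smul x v \<in> M"
  proof -
    have "smul x v = 0 + smul x v" by simp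
    then show ?thesis using fmod.subspace_0[OF graded_subD(1)[OF N]] v(1) unfolding M_def by blast
  qed
  obtain e' w' where w': "w' \<in> Fr k" "hvec e' w'" "prime_ideal (colon M w')" "colon M v \<subseteq> colon M w'"
    by (rule associated_prime_between[OF M graded_ideal_Irr prime_ideal_Irr v(1,2) colon_le_Irr[OF M v(2,3)]])
  obtain Ps where Ps: "length Ps = Suc q" "hd Ps = colon M w'" "set Ps \<subseteq> proj_points" "sorted_wrt (\<subset>) Ps"
    using Suc.IH[OF M kv w'(1-3)] by blast
  have "x \<in> colon M w'" using w'(4) xM by (auto simp: colon_def)
  moreover have "x \<notin> colon N w" using x(2)[OF w(1)] wN by (auto simp: colon_def)
  moreover have "colon N w \<subseteq> colon M w'" using v(4) w'(4) NM by (auto simp: colon_def)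
  ultimately have lt: "colon N w \<subset> hd Ps" using Ps(2) by blast
  obtain Q Qs where Q: "Ps = Q # Qs" using Ps(1) by (cases Ps) auto
  have "\<exists>i. Var i \<notin> colon N w" using lt Ps(3) by (auto simp: Q proj_points_iff)
  then have "colon N w \<in> proj_points"
    using w(3) graded_ideal_colon[OF N w(2)] by (simp add: proj_points_iff)
  moreover have "sorted_wrt (\<subset>) (colon N w # Ps)"
    using Ps(4) lt by (auto simp: Q)
  ultimately show ?case using Ps(1,3) by (intro exI[of _ "colon N w # Ps"]) auto
qed

section \<open>Chains of homogeneous primes\<close>

interpretation mpv: vector_space "const_scale :: 'k::field \<Rightarrow> ('v, 'k) mpoly \<Rightarrow> ('v, 'k) mpoly"
  by standard (simp_all add: const_scale_def algebra_simps single_add mult_single single_one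
      flip: mult.assoc)

lemma lookup_const_scale: "Poly_Mapping.lookup (const_scale c p :: ('v, 'k::comm_ring_1) mpoly) m = c * Poly_Mapping.lookup p m"
  using lookup_single_times[of 0 c p m] by (simp add: const_scale_def)

primrec multi_power :: "'a::comm_monoid_mult list \<Rightarrow> nat list \<Rightarrow> 'a" where
  "multi_power [] \<alpha> = 1"
| "multi_power (f # fs) \<alpha> = f ^ hd \<alpha> * multi_power fs (tl \<alpha>)"

definition exponents :: "nat \<Rightarrow> nat \<Rightarrow> nat list set" where
  "exponents M r = {\<alpha>. set \<alpha> \<subseteq> {..M} \<and> length \<alpha> = r}"

lemma finite_exponents [simp]: "finite (exponents M r)"
  unfolding exponents_def by (rule finite_lists_length_eq) simp

lemma card_exponents: "card (exponents M r) = Suc M ^ r"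
  unfolding exponents_def by (subst card_lists_length_eq) auto

lemma exponents_0: "exponents M 0 = {[]}"
  by (auto simp: exponents_def)

lemma exponents_Suc: "exponents M (Suc r) = (\<lambda>(a, \<beta>). a # \<beta>) ` ({..M} \<times> exponents M r)"
  by (auto simp: exponents_def length_Suc_conv image_iff)

lemma sum_exponents_Suc:
  "(\<Sum>\<alpha>\<in>exponents M (Suc r). g \<alpha>) = (\<Sum>a\<le>M. \<Sum>\<beta>\<in>exponents M r. g (a # \<beta>))"
proof -
  have "inj_on (\<lambda>(a, \<beta>). a # \<beta>) ({..M} \<times> exponents M r)" by (auto simp: inj_on_def)
  then show ?thesis
    unfolding exponents_Suc by (simp add: sum.reindex sum.cartesian_product split_def)
qed

text \<open>Each strict inclusion of a chain ending in \<open>Irr\<close> is recorded by a witness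
  \<open>f\<close>; these witnesses turn out to be algebraically independent.\<close>

fun prime_steps :: "('v::finite, 'k::comm_ring_1) mpoly set list \<Rightarrow> ('v, 'k) mpoly list \<Rightarrow> bool" where
  "prime_steps [P] [] \<longleftrightarrow> P = Irr"
| "prime_steps (P # Q # Ps) (f # fs) \<longleftrightarrow> prime_ideal P \<and> ring_ideal Q \<and> P \<subseteq> Q \<and> f \<in> Q \<and> f \<notin> P \<and> prime_steps (Q # Ps) fs"
| "prime_steps _ _ \<longleftrightarrow> False"

text \<open>Modulo the first prime \<open>P\<close>, divide a relation by the largest possible power of \<open>f \<notin> P\<close>; the
  remaining term without \<open>f\<close> is a relation modulo the next prime, which contains \<open>f\<close>.\<close>

lemma multi_power_independent:
  fixes fs :: "('v::finite, 'k::field) mpoly list"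
  assumes "prime_steps (P # Ps) fs"
    and "(\<Sum>\<alpha>\<in>exponents M (length fs). const_scale (c \<alpha>) (multi_power fs \<alpha>)) \<in> P"
    and "\<alpha> \<in> exponents M (length fs)"
  shows "c \<alpha> = 0"
  using assms
proof (induction fs arbitrary: P Ps c \<alpha>)
  case Nil
  then have "P = Irr" by (cases Ps) auto
  with Nil show ?case by (simp add: exponents_0 Irr_def lookup_const_scale lookup_one)
next
  case (Cons f fs)
  from Cons.prems(1) obtain Q Qs where Q: "Ps = Q # Qs" by (cases Ps) auto
  have P: "prime_ideal P" "ring_ideal Q" "P \<subseteq> Q" "f \<in> Q" "f \<notin> P" "prime_steps (Q # Qs) fs"
    using Cons.prems(1) by (auto simp: Q)
  define g where "g = (\<lambda>a. \<Sum>\<beta>\<in>exponents M (length fs). const_scale (c (a # \<beta>)) (multi_power fs \<beta>))"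
  have g0: "\<forall>\<beta>\<in>exponents M (length fs). c (a # \<beta>) = 0" if "g a \<in> Q" for a
    using Cons.IH[OF P(6), of "\<lambda>\<beta>. c (a # \<beta>)"] that unfolding g_def by blast
  have "(\<Sum>\<alpha>\<in>exponents M (length (f # fs)). const_scale (c \<alpha>) (multi_power (f # fs) \<alpha>)) = (\<Sum>a\<le>M. f ^ a * g a)"
    by (simp add: sum_exponents_Suc g_def sum_distrib_left const_scale_def mult.left_commute)
  with Cons.prems(2) have sumP: "(\<Sum>a\<le>M. f ^ a * g a) \<in> P" by simp
  have gQ: "g a \<in> Q" if "a \<le> M" for a
    using that
  proof (induction a rule: less_induct)
    case (less a)
    have "g b = 0" if "b < a" for b
      using g0[OF less.IH[OF that]] less.prems that unfolding g_def by (intro sum.neutral) auto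
    then have "(\<Sum>b\<le>M. f ^ b * g b) = (\<Sum>b\<in>{a..M}. f ^ b * g b)"
      using less.prems by (intro sum.mono_neutral_right) (auto simp: not_le)
    also have "\<dots> = (\<Sum>b\<in>{a..M}. f ^ a * (f ^ (b - a) * g b))"
      by (intro sum.cong) (auto simp: mult.assoc[symmetric] power_add[symmetric])
    also have "\<dots> = f ^ a * (\<Sum>b\<in>{a..M}. f ^ (b - a) * g b)" by (simp add: sum_distrib_left)
    finally have "f ^ a * (\<Sum>b\<in>{a..M}. f ^ (b - a) * g b) \<in> P" using sumP by simp
    moreover have "f ^ a \<notin> P"
    proof (induction a)
      case (Suc a)
      then show ?case using P(1,5) by (auto simp: prime_ideal_def)
    qed (use P(1) in \<open>auto simp: prime_ideal_def\<close>)
    ultimately have all: "(\<Sum>b\<in>{a..M}. f ^ (b - a) * g b) \<in> Q" using P(1,3) by (auto simp: prime_ideal_def)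
    have split: "(\<Sum>b\<in>{a..M}. f ^ (b - a) * g b) = g a + (\<Sum>b\<in>{Suc a..M}. f ^ (b - a) * g b)"
      using less.prems by (subst sum.atLeast_Suc_atMost) auto
    have rest: "(\<Sum>b\<in>{Suc a..M}. f ^ (b - a) * g b) \<in> Q"
    proof (rule ring_ideal_sum[OF P(2)])
      fix b assume "b \<in> {Suc a..M}"
      then have "b - a = Suc (b - Suc a)" by auto
      then obtain i where "b - a = Suc i" by blast
      then have "f ^ (b - a) * g b = (f ^ i * g b) * f" by (simp add: mult_ac)
      then show "f ^ (b - a) * g b \<in> Q" using ring_ideal_mult[OF P(2,4)] by simp
    qed
    show ?case
      using ring_ideal_diff[OF P(2) all rest] by (simp add: split)
  qed
  from Cons.prems(3) obtain a \<beta> where "\<alpha> = a # \<beta>" "a \<le> M" "\<beta> \<in> exponents M (length fs)"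
    by (auto simp: exponents_Suc)
  with g0[OF gQ] show ?case by blast
qed

section \<open>Counting bound on the length of chains of primes\<close>

definition deg_le :: "nat \<Rightarrow> ('v::finite, 'k::comm_ring_1) mpoly \<Rightarrow> bool" where
  "deg_le D p \<longleftrightarrow> (\<forall>m\<in>Poly_Mapping.keys p. mdeg m \<le> D)"

lemma deg_le_mult:
  assumes "deg_le D p" "deg_le E q"
  shows "deg_le (D + E) (p * q)"
  unfolding deg_le_def
proof
  fix m assume "m \<in> Poly_Mapping.keys (p * q)"
  then have "(\<Sum>a\<in>Poly_Mapping.keys p. \<Sum>b\<in>Poly_Mapping.keys q.
           if a + b = m then Poly_Mapping.lookup p a * Poly_Mapping.lookup q b else 0) \<noteq> 0"
    by (simp add: in_keys_iff lookup_times)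
  then obtain a where a: "a \<in> Poly_Mapping.keys p" "(\<Sum>b\<in>Poly_Mapping.keys q.
           if a + b = m then Poly_Mapping.lookup p a * Poly_Mapping.lookup q b else 0) \<noteq> 0"
    by (rule sum.not_neutral_contains_not_neutral)
  from a(2) obtain b where "b \<in> Poly_Mapping.keys q" "a + b = m"
    by (rule sum.not_neutral_contains_not_neutral) (auto split: if_splits)
  with a(1) assms show "mdeg m \<le> D + E" by (auto simp: deg_le_def intro!: add_mono)
qed

lemma deg_le_mono: "deg_le D p \<Longrightarrow> D \<le> E \<Longrightarrow> deg_le E p"
  by (auto simp: deg_le_def)

lemma deg_le_1: "deg_le 0 1"
  by (simp add: deg_le_def)

lemma deg_le_power: "deg_le D p \<Longrightarrow> deg_le (a * D) (p ^ a)"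
  by (induction a) (auto simp: deg_le_1 intro: deg_le_mult)

lemma deg_le_multi_power:
  "\<alpha> \<in> exponents M (length fs) \<Longrightarrow> (\<And>f. f \<in> set fs \<Longrightarrow> deg_le D f) \<Longrightarrow>
    deg_le (length fs * (M * D)) (multi_power fs \<alpha>)"
proof (induction fs arbitrary: \<alpha>)
  case (Cons f fs)
  then obtain a \<beta> where a: "\<alpha> = a # \<beta>" "a \<le> M" "\<beta> \<in> exponents M (length fs)"
    by (auto simp: exponents_Suc)
  have "deg_le (M * D) (f ^ a)"
    using deg_le_power[of D f a] Cons.prems(2) a(2) by (auto elim!: deg_le_mono)
  moreover have "deg_le (length fs * (M * D)) (multi_power fs \<beta>)"
    using Cons a(3) by simp
  ultimately show ?case using deg_le_mult by (auto simp: a(1))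
qed (simp add: deg_le_1)

lemma card_mdeg_le:
  "finite {m :: 'v::finite \<Rightarrow>\<^sub>0 nat. mdeg m \<le> L}" (is ?F)
  "card {m :: 'v::finite \<Rightarrow>\<^sub>0 nat. mdeg m \<le> L} \<le> Suc L ^ CARD('v)" (is ?C)
proof -
  let ?S = "{m :: 'v \<Rightarrow>\<^sub>0 nat. mdeg m \<le> L}"
  have le: "Poly_Mapping.lookup m i \<le> mdeg m" for m :: "'v \<Rightarrow>\<^sub>0 nat" and i
    unfolding mdeg_def by (rule member_le_sum) auto
  have sub: "Poly_Mapping.lookup ` ?S \<subseteq> (UNIV :: 'v set) \<rightarrow>\<^sub>E {..L}"
    using le order_trans by fastforce
  have fin: "finite ((UNIV :: 'v set) \<rightarrow>\<^sub>E {..L})" by (intro finite_PiE) auto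
  have inj: "inj_on Poly_Mapping.lookup ?S" by (auto simp: inj_on_def lookup_inject)
  show ?F using finite_imageD[OF finite_subset[OF sub fin] inj] .
  have "card ?S = card (Poly_Mapping.lookup ` ?S)" by (rule card_image[OF inj, symmetric])
  also have "\<dots> \<le> card ((UNIV :: 'v set) \<rightarrow>\<^sub>E {..L})" by (rule card_mono[OF fin sub])
  also have "\<dots> = Suc L ^ CARD('v)" by (simp add: card_PiE)
  finally show ?C .
qed

text \<open>The \<open>(M + 1) ^ r\<close> products of the witnesses with exponents up to
  \<open>M\<close> are linearly independent and of degree at most \<open>r M D\<close>. The space of
  such polynomials grows only like the power \<open>CARD('v)\<close> of \<open>M\<close>, so
  \<open>r\<close> cannot exceed it.\<close>

lemma prime_steps_length:
  fixes fs :: "('v::finite, 'k::field) mpoly list"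
  assumes "prime_steps (P # Ps) fs"
  shows "length fs \<le> CARD('v)"
proof (rule ccontr)
  assume "\<not> ?thesis"
  then have r: "Suc CARD('v) \<le> length fs" by simp
  define r where "r = length fs"
  define D where "D = Max (insert 0 (mdeg ` (\<Union>f\<in>set fs. Poly_Mapping.keys f)))"
  have D: "deg_le D f" if "f \<in> set fs" for f
    unfolding deg_le_def D_def using that by (intro ballI Max_ge) auto
  \<comment> \<open>With this \<open>M\<close> the dimension is at most
    \<open>((M + 1) (r D + 1)) ^ CARD('v) = (M + 1) ^ CARD('v) * M\<close>, just below
    \<open>(M + 1) ^ (CARD('v) + 1)\<close>.\<close>
  define M where "M = Suc (r * D) ^ CARD('v)"
  define A where "A = exponents M r"
  define L where "L = r * (M * D)"
  define B where "B = (\<lambda>m. Poly_Mapping.single m (1::'k)) ` {m :: 'v \<Rightarrow>\<^sub>0 nat. mdeg m \<le> L}"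
  have zero: "0 \<in> P" using assms by (cases Ps; cases fs) (auto simp: prime_ideal_def Irr_def intro: ring_ideal_0)
  have indep: "c \<alpha> = 0" if "(\<Sum>\<alpha>\<in>A. const_scale (c \<alpha>) (multi_power fs \<alpha>)) = 0" "\<alpha> \<in> A" for c \<alpha>
    using multi_power_independent[OF assms, of c M \<alpha>] that zero by (simp add: A_def r_def)
  have finA: "finite A" by (simp add: A_def)
  have inj: "inj_on (multi_power fs) A"
  proof (rule inj_onI, rule ccontr)
    fix \<alpha> \<beta> assume ab: "\<alpha> \<in> A" "\<beta> \<in> A" "multi_power fs \<alpha> = multi_power fs \<beta>" "\<alpha> \<noteq> \<beta>"
    define c :: "nat list \<Rightarrow> 'k" where "c = (\<lambda>\<gamma>. if \<gamma> = \<alpha> then 1 else if \<gamma> = \<beta> then - 1 else 0)"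
    have "(\<Sum>\<gamma>\<in>A. const_scale (c \<gamma>) (multi_power fs \<gamma>)) =
        (\<Sum>\<gamma>\<in>{\<alpha>, \<beta>}. const_scale (c \<gamma>) (multi_power fs \<gamma>))"
      using finA ab by (intro sum.mono_neutral_right) (auto simp: c_def)
    also have "\<dots> = 0" using ab by (simp add: c_def)
    finally have "c \<alpha> = 0" using ab(1) by (rule indep)
    then show False by (simp add: c_def)
  qed
  have "mpv.independent (multi_power fs ` A)"
  proof (rule mpv.independent_if_scalars_zero)
    show "finite (multi_power fs ` A)" using finA by simp
    fix c x assume c: "(\<Sum>x\<in>multi_power fs ` A. const_scale (c x) x) = 0" and x: "x \<in> multi_power fs ` A"
    then obtain \<alpha> where \<alpha>: "\<alpha> \<in> A" "x = multi_power fs \<alpha>" by blast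
    from c have "(\<Sum>\<alpha>\<in>A. const_scale (c (multi_power fs \<alpha>)) (multi_power fs \<alpha>)) = 0"
      by (simp add: sum.reindex[OF inj])
    from indep[OF this \<alpha>(1)] show "c x = 0" by (simp add: \<alpha>(2))
  qed
  moreover have "multi_power fs ` A \<subseteq> mpv.span B"
  proof
    fix x assume "x \<in> multi_power fs ` A"
    then have x: "deg_le L x"
      using deg_le_multi_power[of _ M fs D] D by (auto simp: A_def r_def L_def)
    have "const_scale (Poly_Mapping.lookup x m) (Poly_Mapping.single m 1) \<in> mpv.span B"
      if "m \<in> Poly_Mapping.keys x" for m
      using that x by (intro mpv.span_scale mpv.span_base) (auto simp: B_def deg_le_def)
    then have "(\<Sum>m\<in>Poly_Mapping.keys x. const_scale (Poly_Mapping.lookup x m) (Poly_Mapping.single m 1)) \<in> mpv.span B"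
      by (rule mpv.span_sum)
    moreover have "const_scale (Poly_Mapping.lookup x m) (Poly_Mapping.single m 1) = Poly_Mapping.single m (Poly_Mapping.lookup x m)" for m
      by (simp add: const_scale_def mult_single)
    ultimately show "x \<in> mpv.span B" using poly_mapping_sum_single[of x] by simp
  qed
  moreover have finB: "finite B" unfolding B_def by (intro finite_imageI card_mdeg_le)
  ultimately have "card (multi_power fs ` A) \<le> card B"
    using mpv.independent_span_bound by blast
  also have "card B \<le> card {m :: 'v \<Rightarrow>\<^sub>0 nat. mdeg m \<le> L}"
    unfolding B_def by (rule card_image_le[OF card_mdeg_le(1)])
  also have "\<dots> \<le> Suc L ^ CARD('v)" by (rule card_mdeg_le)
  also have "Suc L \<le> Suc M * Suc (r * D)"
    by (simp add: L_def algebra_simps)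
  then have "Suc L ^ CARD('v) \<le> (Suc M * Suc (r * D)) ^ CARD('v)" by (rule power_mono) simp
  also have "\<dots> = Suc M ^ CARD('v) * M" by (simp only: power_mult_distrib M_def)
  also have "\<dots> < Suc M ^ CARD('v) * Suc M" by simp
  also have "\<dots> = Suc M ^ Suc CARD('v)" by simp
  also have "\<dots> \<le> Suc M ^ r" using r by (intro power_increasing) (auto simp: r_def)
  also have "\<dots> = card (multi_power fs ` A)"
    using card_image[OF inj] by (simp add: A_def card_exponents)
  finally show False by simp
qed

lemma chain_prime_steps:
  fixes Ps :: "('v::finite, 'k::field) mpoly set list"
  assumes "set Ps \<subseteq> proj_points" "sorted_wrt (\<subset>) Ps"
  shows "\<exists>fs. length fs = length Ps \<and> prime_steps (Ps @ [Irr]) fs"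
  using assms
proof (induction Ps)
  case (Cons P Ps)
  then obtain fs where fs: "length fs = length Ps" "prime_steps (Ps @ [Irr]) fs" by auto
  have P: "graded_ideal P" "prime_ideal P" "\<exists>i. Var i \<notin> P" using Cons.prems(1) by (auto simp: proj_points_iff)
  show ?case
  proof (cases Ps)
    case Nil
    from P(3) obtain i where i: "Var i \<notin> P" by blast
    have "Var i \<in> Irr" by (simp add: Irr_def Var_def lookup_single when_def single_zero poly_mapping_eq_iff fun_eq_iff)
    then have "prime_steps ([P] @ [Irr]) [Var i]"
      using P i graded_ideal_le_Irr[of P] graded_idealD(1)[OF graded_ideal_Irr] by (auto simp: prime_ideal_def)
    then show ?thesis using Nil by (intro exI[of _ "[Var i]"]) simp
  next
    case (Cons Q Qs)
    have "P \<subset> Q" using Cons.prems(2) Cons by simp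
    then obtain f where "f \<in> Q" "f \<notin> P" by blast
    moreover have "ring_ideal Q" using Cons.prems(1) Cons by (auto simp: proj_points_iff prime_ideal_def)
    ultimately have "prime_steps ((P # Ps) @ [Irr]) (f # fs)"
      using P fs(2) \<open>P \<subset> Q\<close> by (auto simp: Cons)
    then show ?thesis using fs(1) by (intro exI[of _ "f # fs"]) simp
  qed
qed (auto intro!: exI[of _ "[]"])

text \<open>Points of projective space lie strictly below \<open>Irr\<close>; appending it yields
  exactly one witness per point.\<close>

theorem chain_proj_points_length:
  fixes Ps :: "('v::finite, 'k::field) mpoly set list"
  assumes "set Ps \<subseteq> proj_points" "sorted_wrt (\<subset>) Ps"
  shows "length Ps \<le> CARD('v)"
proof -
  obtain fs where fs: "length fs = length Ps" "prime_steps (Ps @ [Irr]) fs"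
    using chain_prime_steps[OF assms] by blast
  obtain P Qs where "Ps @ [Irr] = P # Qs" by (cases "Ps @ [Irr]") auto
  with fs prime_steps_length show ?thesis by metis
qed

section \<open>Chain lengths through a point and below associated primes\<close>

lemma chain_length_leI:
  assumes "\<And>Ps. Ps \<noteq> [] \<Longrightarrow> set Ps \<subseteq> S \<Longrightarrow> sorted_wrt (\<subset>) Ps \<Longrightarrow> length Ps \<le> Suc m"
  shows "chain_length S \<le> enat m"
  unfolding chain_length_def
proof (rule SUP_least)
  fix Ps assume "Ps \<in> {Ps. Ps \<noteq> [] \<and> set Ps \<subseteq> S \<and> sorted_wrt (\<subset>) Ps}"
  then have "length Ps \<le> Suc m" using assms by blast
  then show "enat (length Ps - 1) \<le> enat m" by simp
qed

lemma chain_length_geI: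
  assumes "Ps \<noteq> []" "set Ps \<subseteq> S" "sorted_wrt (\<subset>) Ps" "length Ps = Suc m"
  shows "enat m \<le> chain_length S"
  unfolding chain_length_def
  by (rule SUP_upper2[of Ps]) (use assms in auto)

text \<open>A longer chain is cut to the required length. The supremum over an empty family is 0, so
  nonemptiness supplies the chain for \<open>m = 0\<close>.\<close>

lemma chain_length_geD:
  assumes "enat m \<le> chain_length S" "S \<noteq> {}"
  obtains Ps where "set Ps \<subseteq> S" "sorted_wrt (\<subset>) Ps" "length Ps = Suc m"
proof -
  have "\<exists>Ps. Ps \<noteq> [] \<and> set Ps \<subseteq> S \<and> sorted_wrt (\<subset>) Ps \<and> m \<le> length Ps - 1"
  proof (cases m)
    case 0
    from assms(2) obtain x where "x \<in> S" by blast
    then show ?thesis using 0 by (intro exI[of _ "[x]"]) simp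
  next
    case (Suc m')
    show ?thesis
    proof (rule ccontr)
      assume no: "\<nexists>Ps. Ps \<noteq> [] \<and> set Ps \<subseteq> S \<and> sorted_wrt (\<subset>) Ps \<and> m \<le> length Ps - 1"
      have "chain_length S \<le> enat m'"
        by (rule chain_length_leI) (use no Suc in force)
      with assms(1) Suc show False by (metis Suc_n_not_le_n dual_order.trans enat_ord_simps(1))
    qed
  qed
  then obtain Ps where Ps: "Ps \<noteq> []" "set Ps \<subseteq> S" "sorted_wrt (\<subset>) Ps" "m \<le> length Ps - 1" by blast
  then have "length Ps \<ge> Suc m" by (cases Ps) auto
  then have "set (take (Suc m) Ps) \<subseteq> S" "sorted_wrt (\<subset>) (take (Suc m) Ps)" "length (take (Suc m) Ps) = Suc m"
    using Ps set_take_subset[of "Suc m" Ps] by (auto simp: sorted_wrt_take)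
  then show thesis by (rule that)
qed

lemma chain_through_point:
  fixes P :: "('v::finite, 'k::field) mpoly set"
  assumes Q: "set Qs \<subseteq> {Q \<in> proj_points. Q \<subseteq> P}" "sorted_wrt (\<subset>) Qs"
    and Ps: "set Ps \<subseteq> {Q \<in> proj_points. P \<subseteq> Q}" "sorted_wrt (\<subset>) Ps"
  shows "length Qs + length Ps \<le> Suc CARD('v)"
proof (cases "Ps = [] \<or> Qs = []")
  case True
  have "set Qs \<subseteq> proj_points" "set Ps \<subseteq> proj_points" using Q(1) Ps(1) by auto
  from chain_proj_points_length[OF this(1) Q(2)] chain_proj_points_length[OF this(2) Ps(2)]
  show ?thesis using True by auto
next
  case False
  \<comment> \<open>The lowest member above \<open>P\<close> may coincide with the highest member
    below \<open>P\<close>, so it is left out before the chains are joined; this accounts for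
    \<open>Suc\<close>.\<close>
  then obtain P' Ps' where P': "Ps = P' # Ps'" by (cases Ps) auto
  have "Q' \<subset> R" if "Q' \<in> set Qs" "R \<in> set Ps'" for Q' R
  proof -
    have "Q' \<subseteq> P" "P \<subseteq> P'" "P' \<subset> R" using that Q(1) Ps by (auto simp: P')
    then show ?thesis by blast
  qed
  then have "sorted_wrt (\<subset>) (Qs @ Ps')"
    using Q(2) Ps(2) by (auto simp: sorted_wrt_append P')
  moreover have "set (Qs @ Ps') \<subseteq> proj_points" using Q(1) Ps(1) by (auto simp: P')
  ultimately have "length (Qs @ Ps') \<le> CARD('v)" by (intro chain_proj_points_length)
  then show ?thesis by (simp add: P')
qed

text \<open>A chain of \<open>q + 1\<close> points upwards from the prime leaves room for at most
  \<open>CARD('v) - q\<close> points downwards.\<close>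

lemma chain_below_associated_prime:
  fixes N :: "(nat \<Rightarrow> ('v::finite, 'k::field_char_0) mpoly) set"
  assumes "graded_sub k N" "fmod.kvanish vars (Suc q) (Fr k) N"
    and "w \<in> Fr k" "hvec e w" "prime_ideal (colon N w)"
  shows "colon N w \<in> proj_points"
    "enat q \<le> chain_length {Q \<in> proj_points. colon N w \<subseteq> Q}"
    "chain_length {Q \<in> proj_points. Q \<subseteq> colon N w} \<le> enat (CARD('v) - Suc q)"
    "Suc q \<le> CARD('v)"
proof -
  obtain Ps where Ps: "length Ps = Suc q" "hd Ps = colon N w" "set Ps \<subseteq> proj_points" "sorted_wrt (\<subset>) Ps"
    using chain_above_associated_prime[OF assms] by blast
  have ne: "Ps \<noteq> []" using Ps(1) by auto
  show P: "colon N w \<in> proj_points" using Ps(3) hd_in_set[OF ne] unfolding Ps(2) by blast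
  have "colon N w \<subseteq> Q" if "Q \<in> set Ps" for Q
    using that Ps(2,4) ne by (cases Ps) auto
  then have sub: "set Ps \<subseteq> {Q \<in> proj_points. colon N w \<subseteq> Q}" using Ps(3) by blast
  then show "enat q \<le> chain_length {Q \<in> proj_points. colon N w \<subseteq> Q}"
    by (rule chain_length_geI[OF ne _ Ps(4,1)])
  have *: "length Qs + Suc q \<le> Suc CARD('v)"
    if "set Qs \<subseteq> {Q \<in> proj_points. Q \<subseteq> colon N w}" "sorted_wrt (\<subset>) Qs" for Qs
    using chain_through_point[OF that sub Ps(4)] Ps(1) by simp
  show le: "Suc q \<le> CARD('v)" using *[of "[colon N w]"] P by simp
  show "chain_length {Q \<in> proj_points. Q \<subseteq> colon N w} \<le> enat (CARD('v) - Suc q)"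
  proof (rule chain_length_leI)
    fix Qs assume "set Qs \<subseteq> {Q \<in> proj_points. Q \<subseteq> colon N w}" "sorted_wrt (\<subset>) Qs"
    from *[OF this] le show "length Qs \<le> Suc (CARD('v) - Suc q)" by simp
  qed
qed

text \<open>A nonzero element killed by \<open>I\<close> gives an associated prime containing \<open>I\<close>, whose
  dimension is at least the depth of the module.\<close>

lemma mem_if_codimension:
  fixes N :: "(nat \<Rightarrow> ('v::finite, 'k::field_char_0) mpoly) set"
  assumes N: "graded_sub k N" and kv: "fmod.kvanish vars (Suc q) (Fr k) N"
    and I: "graded_ideal I" and codim: "codimension I > enat (CARD('v) - Suc q)"
    and w: "w \<in> Fr k" "I \<subseteq> colon N w"
  shows "w \<in> N"
proof (rule mem_if_hcomp[OF graded_subD(1)[OF N] w(1)], rule ccontr)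
  fix e
  let ?w = "\<lambda>j. hcomp e (w j)"
  assume ne: "?w \<notin> N"
  have hw: "hvec e ?w" by (simp add: hvec_def)
  have wF: "?w \<in> Fr k" using w(1) by (simp add: Fr_def)
  have Iw: "I \<subseteq> colon N ?w"
  proof
    fix f assume f: "f \<in> I"
    show "f \<in> colon N ?w"
    proof (rule ring_ideal_if_hcomp[OF ring_ideal_colon[OF graded_subD(1)[OF N]]])
      fix i
      have "hcomp i f \<in> colon N w" using graded_idealD(2)[OF I f] w(2) by blast
      then have "(\<lambda>j. hcomp (i + e) (smul (hcomp i f) w j)) \<in> N"
        using graded_subD(3)[OF N] by (simp add: colon_def)
      then show "hcomp i f \<in> colon N ?w"
        using hcomp_smul[OF homogeneous_hcomp, of i e f w] by (simp add: colon_def)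
    qed
  qed
  obtain e' w' where w': "w' \<in> Fr k" "hvec e' w'" "prime_ideal (colon N w')" "colon N ?w \<subseteq> colon N w'"
    by (rule associated_prime_between[OF N graded_ideal_Irr prime_ideal_Irr wF hw colon_le_Irr[OF N hw ne]])
  note P = chain_below_associated_prime[OF N kv w'(1-3)]
  have "colon N w' \<in> points_of I" using P(1) w'(4) Iw by (auto simp: points_of_def)
  then have "codimension I \<le> chain_length {Q \<in> proj_points. Q \<subseteq> colon N w'}"
    unfolding codimension_def by (rule INF_lower)
  with P(3) codim show False by (meson leD le_less_trans order.trans)
qed

section \<open>Maximal minors\<close>

text \<open>\<open>minor B j\<close> is the signed maximal minor of the \<open>p \<times> (p + 1)\<close> matrix \<open>B\<close> without
  column \<open>j\<close>, obtained as a cofactor of the square matrix with an additional top row \<open>u\<close>; it does not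
  depend on \<open>u\<close>.\<close>

definition add_row :: "(nat \<Rightarrow> 'a) \<Rightarrow> 'a mat \<Rightarrow> 'a mat" where
  "add_row u B = mat (Suc (dim_row B)) (dim_col B) (\<lambda>(i, j). if i = 0 then u j else B $$ (i - 1, j))"

definition minor :: "'a::comm_ring_1 mat \<Rightarrow> nat \<Rightarrow> 'a" where
  "minor B j = cofactor (add_row (\<lambda>_. 0) B) 0 j"

context
  fixes B :: "'a::comm_ring_1 mat" and p :: nat
  assumes B: "B \<in> carrier_mat p (Suc p)"
begin

lemma add_row_carrier: "add_row u B \<in> carrier_mat (Suc p) (Suc p)"
  using B by (auto simp: add_row_def)

lemma add_row_index:
  "j < Suc p \<Longrightarrow> add_row u B $$ (0, j) = u j"
  "i < p \<Longrightarrow> j < Suc p \<Longrightarrow> add_row u B $$ (Suc i, j) = B $$ (i, j)"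
  using B by (auto simp: add_row_def)

lemma mat_delete_add_row:
  "mat_delete (add_row u B) 0 j = mat p p (\<lambda>(i, k). B $$ (i, insert_index j k))"
  using B by (intro eq_matI) (auto simp: mat_delete_def add_row_def insert_index_def)

lemma minor_eq: "minor B j = (- 1) ^ j * det (mat p p (\<lambda>(i, k). B $$ (i, insert_index j k)))"
  by (simp add: minor_def cofactor_def mat_delete_add_row)

lemma cofactor_add_row: "cofactor (add_row u B) 0 j = minor B j"
  by (simp add: minor_def cofactor_def mat_delete_add_row)

lemma det_add_row: "det (add_row u B) = (\<Sum>j<Suc p. u j * minor B j)"
proof -
  have "det (add_row u B) = (\<Sum>j<Suc p. add_row u B $$ (0, j) * cofactor (add_row u B) 0 j)"
    by (rule laplace_expansion_row[OF add_row_carrier]) simp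
  also have "\<dots> = (\<Sum>j<Suc p. u j * minor B j)"
    by (intro sum.cong) (auto simp: cofactor_add_row add_row_index)
  finally show ?thesis .
qed

lemma minor_relation:
  assumes "i < p"
  shows "(\<Sum>j<Suc p. B $$ (i, j) * minor B j) = 0"
proof -
  have "det (add_row (\<lambda>j. B $$ (i, j)) B) = 0"
    by (rule det_identical_rows[OF add_row_carrier, of 0 "Suc i"])
      (use assms B in \<open>auto intro!: eq_vecI simp: add_row_def\<close>)
  then show ?thesis by (simp only: det_add_row)
qed

lemma adj_mat_add_row:
  assumes "i < Suc p" "j < Suc p"
  shows "(\<Sum>k<Suc p. add_row u B $$ (i, k) * cofactor (add_row u B) j k) = (if i = j then det (add_row u B) else 0)"
    "(\<Sum>k<Suc p. cofactor (add_row u B) k i * add_row u B $$ (k, j)) = (if i = j then det (add_row u B) else 0)"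
proof -
  note A = add_row_carrier[of u]
  have d: "dim_row (add_row u B) = Suc p" "dim_col (add_row u B) = Suc p" using A by auto
  have "(add_row u B * adj_mat (add_row u B)) $$ (i, j) = (det (add_row u B) \<cdot>\<^sub>m 1\<^sub>m (Suc p)) $$ (i, j)"
    by (simp only: adj_mat(2)[OF A])
  then show "(\<Sum>k<Suc p. add_row u B $$ (i, k) * cofactor (add_row u B) j k) = (if i = j then det (add_row u B) else 0)"
    using assms adj_mat(1)[OF A] d
    by (simp add: scalar_prod_def adj_mat_def atLeast0LessThan del: sum.lessThan_Suc)
  have "(adj_mat (add_row u B) * add_row u B) $$ (i, j) = (det (add_row u B) \<cdot>\<^sub>m 1\<^sub>m (Suc p)) $$ (i, j)"
    by (simp only: adj_mat(3)[OF A])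
  then show "(\<Sum>k<Suc p. cofactor (add_row u B) k i * add_row u B $$ (k, j)) = (if i = j then det (add_row u B) else 0)"
    using assms adj_mat(1)[OF A] d
    by (simp add: scalar_prod_def adj_mat_def atLeast0LessThan del: sum.lessThan_Suc)
qed

lemma det_add_unit_row: "l < Suc p \<Longrightarrow> det (add_row (\<lambda>j. if j = l then 1 else 0) B) = minor B l"
proof -
  assume l: "l < Suc p"
  have "det (add_row (\<lambda>j. if j = l then 1 else 0) B) = (\<Sum>j<Suc p. if j = l then minor B j else 0)"
    unfolding det_add_row by (intro sum.cong) auto
  then show ?thesis using l by (simp del: sum.lessThan_Suc)
qed

text \<open>Cramer's rule with the unit row \<open>l\<close> on top of \<open>B\<close>: the
  determinant is then \<open>minor B l\<close>, multiplying \<open>w\<close> by the adjugate gives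
  the coefficients of the rows, and the coefficient of the top row is the sum of the
  \<open>w m * minor B m\<close>.\<close>

lemma minor_row_combination:
  assumes l: "l < Suc p"
  shows "\<exists>z. \<forall>j<Suc p. (\<Sum>i<p. z i * B $$ (i, j)) =
    minor B l * w j - (\<Sum>m<Suc p. w m * minor B m) * (if j = l then 1 else 0)"
proof -
  let ?A = "add_row (\<lambda>j. if j = l then 1 else 0) B"
  define y where "y = (\<lambda>i. \<Sum>m<Suc p. w m * cofactor ?A i m)"
  have y: "(\<Sum>i<Suc p. y i * ?A $$ (i, j)) = minor B l * w j" if j: "j < Suc p" for j
  proof -
    have "(\<Sum>i<Suc p. y i * ?A $$ (i, j)) = (\<Sum>i<Suc p. \<Sum>m<Suc p. w m * (cofactor ?A i m * ?A $$ (i, j)))"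
      by (simp only: y_def sum_distrib_right mult.assoc)
    also have "\<dots> = (\<Sum>m<Suc p. \<Sum>i<Suc p. w m * (cofactor ?A i m * ?A $$ (i, j)))" by (rule sum.swap)
    also have "\<dots> = (\<Sum>m<Suc p. w m * (if m = j then det ?A else 0))"
      by (intro sum.cong refl) (simp only: sum_distrib_left[symmetric] adj_mat_add_row(2) j lessThan_iff)
    also have "\<dots> = (\<Sum>m<Suc p. if m = j then w m * det ?A else 0)"
      by (intro sum.cong) auto
    also have "\<dots> = w j * det ?A" using j by (simp del: sum.lessThan_Suc)
    finally show ?thesis using l by (simp add: det_add_unit_row mult.commute)
  qed
  have y0: "y 0 = (\<Sum>m<Suc p. w m * minor B m)" by (simp only: y_def cofactor_add_row)
  have "(\<Sum>i<p. y (Suc i) * B $$ (i, j)) = minor B l * w j - y 0 * (if j = l then 1 else 0)" if j: "j < Suc p" for j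
  proof -
    have "(\<Sum>i<Suc p. y i * ?A $$ (i, j)) = y 0 * ?A $$ (0, j) + (\<Sum>i<p. y (Suc i) * ?A $$ (Suc i, j))"
      by (rule sum.lessThan_Suc_shift)
    also have "(\<Sum>i<p. y (Suc i) * ?A $$ (Suc i, j)) = (\<Sum>i<p. y (Suc i) * B $$ (i, j))"
      using j by (intro sum.cong) (auto simp: add_row_index)
    finally show ?thesis using y[OF j] j by (simp add: add_row_index algebra_simps)
  qed
  then show ?thesis unfolding y0 by (intro exI[of _ "\<lambda>i. y (Suc i)"] allI impI)
qed

text \<open>Vectors in the kernel of \<open>B\<close> are proportional to the vector of minors: with
  the unit row \<open>l\<close> on top, \<open>x\<close> is sent to \<open>x l\<close> times the
  first unit vector, and the adjugate recovers \<open>x\<close>.\<close>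

lemma minor_kernel:
  assumes x: "\<And>i. i < p \<Longrightarrow> (\<Sum>j<Suc p. B $$ (i, j) * x j) = 0" and l: "l < Suc p" and j: "j < Suc p"
  shows "minor B l * x j = minor B j * x l"
proof -
  let ?A = "add_row (\<lambda>j. if j = l then 1 else 0) B"
  have A: "(\<Sum>m<Suc p. ?A $$ (i, m) * x m) = (if i = 0 then x l else 0)" if i: "i < Suc p" for i
  proof (cases i)
    case 0
    have "(\<Sum>m<Suc p. ?A $$ (0, m) * x m) = (\<Sum>m<Suc p. if m = l then x m else 0)"
      by (intro sum.cong) (auto simp: add_row_index)
    then show ?thesis using l 0 by (simp del: sum.lessThan_Suc)
  next
    case (Suc i')
    have "(\<Sum>m<Suc p. ?A $$ (i, m) * x m) = (\<Sum>m<Suc p. B $$ (i', m) * x m)"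
      using Suc i by (intro sum.cong) (auto simp: add_row_index)
    then show ?thesis using x[of i'] i Suc by simp
  qed
  have "minor B l * x j = (\<Sum>m<Suc p. if j = m then det ?A * x m else 0)"
    using j l by (simp add: det_add_unit_row del: sum.lessThan_Suc)
  also have "\<dots> = (\<Sum>m<Suc p. (if j = m then det ?A else 0) * x m)" by (intro sum.cong) auto
  also have "\<dots> = (\<Sum>m<Suc p. \<Sum>i<Suc p. cofactor ?A i j * ?A $$ (i, m) * x m)"
    by (intro sum.cong refl, subst sum_distrib_right[symmetric], subst adj_mat_add_row(2)) (use j in auto)
  also have "\<dots> = (\<Sum>i<Suc p. \<Sum>m<Suc p. cofactor ?A i j * ?A $$ (i, m) * x m)" by (rule sum.swap)
  also have "\<dots> = (\<Sum>i<Suc p. cofactor ?A i j * (if i = 0 then x l else 0))"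
    by (intro sum.cong refl) (simp only: mult.assoc sum_distrib_left[symmetric] A lessThan_iff)
  also have "\<dots> = (\<Sum>i<Suc p. if i = 0 then cofactor ?A i j * x l else 0)" by (intro sum.cong) auto
  also have "\<dots> = minor B j * x l" by (simp add: cofactor_add_row del: sum.lessThan_Suc)
  finally show ?thesis .
qed

text \<open>The required vectors are the columns of the adjugate other than the one of the added
  row.\<close>

lemma minor_unit_vectors:
  assumes l: "l < Suc p" and k: "k < p"
  shows "\<exists>x. \<forall>i<p. (\<Sum>j<Suc p. B $$ (i, j) * x j) = (if i = k then minor B l else 0)"
proof -
  let ?A = "add_row (\<lambda>j. if j = l then 1 else 0) B"
  have "(\<Sum>j<Suc p. B $$ (i, j) * cofactor ?A (Suc k) j) = (if i = k then minor B l else 0)" if i: "i < p" for i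
  proof -
    have "(\<Sum>j<Suc p. B $$ (i, j) * cofactor ?A (Suc k) j) = (\<Sum>j<Suc p. ?A $$ (Suc i, j) * cofactor ?A (Suc k) j)"
      using i by (intro sum.cong) (auto simp: add_row_index)
    also have "\<dots> = (if Suc i = Suc k then det ?A else 0)"
      by (rule adj_mat_add_row(1)) (use i k in auto)
    finally show ?thesis using l by (simp add: det_add_unit_row)
  qed
  then show ?thesis by blast
qed

lemma submatrix_delete_col:
  assumes j: "j < Suc p"
  shows "submatrix B UNIV ({..<Suc p} - {j}) = mat p p (\<lambda>(i, k). B $$ (i, insert_index j k))"
proof -
  let ?J = "{..<Suc p} - {j}"
  have "{i. i < Suc p \<and> i \<in> ?J} = ?J" by auto
  moreover have "card ?J = p" using j by simp
  moreover have "pick ?J k = insert_index j k" if k: "k < p" for k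
  proof -
    have "card {a \<in> ?J. a < insert_index j k} = k"
    proof (cases "k < j")
      case True
      then have "{a \<in> ?J. a < insert_index j k} = {..<k}" using j by auto
      then show ?thesis by simp
    next
      case False
      then have "{a \<in> ?J. a < insert_index j k} = {..<Suc k} - {j}" using k by auto
      moreover have "card ({..<Suc k} - {j}) = k" using False by simp
      ultimately show ?thesis by simp
    qed
    moreover have "insert_index j k \<in> ?J" using k j by (auto simp: insert_index_def)
    ultimately show ?thesis using pick_card_in_set[of "insert_index j k" ?J] by simp
  qed
  ultimately show ?thesis
    using B unfolding submatrix_def by (intro eq_matI) (auto simp: pick_UNIV)
qed

text \<open>Choosing \<open>p\<close> columns means omitting one, and the two families of minors
  differ by signs.\<close>

lemma gen_ideal_maximal_minors: "gen_ideal (maximal_minors B) = gen_ideal (minor B ` {..<Suc p})"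
proof
  have dims: "dim_row B = p" "dim_col B = Suc p" using B by auto
  have sub: "det (submatrix B UNIV ({..<Suc p} - {j})) = (- 1) ^ j * minor B j" if "j < Suc p" for j
    unfolding submatrix_delete_col[OF that] minor_eq by (simp flip: mult.assoc power_mult_distrib)
  show "gen_ideal (maximal_minors B) \<subseteq> gen_ideal (minor B ` {..<Suc p})"
  proof (rule gen_ideal_minimal[OF ring_ideal_gen], rule subsetI)
    fix f assume "f \<in> maximal_minors B"
    then obtain J where J: "f = det (submatrix B UNIV J)" "J \<subseteq> {..<Suc p}" "card J = p"
      unfolding maximal_minors_def dims by blast
    have "card ({..<Suc p} - J) = 1" using J(2,3) by (simp add: card_Diff_subset finite_subset)
    then obtain j where j: "{..<Suc p} - J = {j}" by (rule card_1_singletonE)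
    then have "j < Suc p" "J = {..<Suc p} - {j}" using J(2) by auto
    then have "f = (- 1) ^ j * minor B j" using sub J(1) by simp
    then show "f \<in> gen_ideal (minor B ` {..<Suc p})"
      using gen_ideal_superset[of "minor B ` {..<Suc p}"] \<open>j < Suc p\<close>
      by (auto intro!: ring_ideal_mult[OF ring_ideal_gen])
  qed
  show "gen_ideal (minor B ` {..<Suc p}) \<subseteq> gen_ideal (maximal_minors B)"
  proof (rule gen_ideal_minimal[OF ring_ideal_gen], rule subsetI)
    fix f assume "f \<in> minor B ` {..<Suc p}"
    then obtain j where j: "j < Suc p" "f = minor B j" by blast
    have "f = (- 1) ^ j * det (submatrix B UNIV ({..<Suc p} - {j}))"
      unfolding sub[OF j(1)] j(2) by (simp flip: mult.assoc power_mult_distrib)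
    moreover have "det (submatrix B UNIV ({..<Suc p} - {j})) \<in> maximal_minors B"
      unfolding maximal_minors_def dims using j(1) by (intro CollectI exI[of _ "{..<Suc p} - {j}"]) auto
    ultimately show "f \<in> gen_ideal (maximal_minors B)"
      using gen_ideal_superset[of "maximal_minors B"] by (auto intro!: ring_ideal_mult[OF ring_ideal_gen])
  qed
qed

end

text \<open>Laplace expansion along the first \<open>q\<close> columns, one at a time. Deleting row
  \<open>i\<close> composes the selection \<open>\<rho>\<close> of the surviving rows with
  \<open>insert_index i\<close>.\<close>

lemma det_last_columns_mem:
  fixes I :: "'a::comm_ring_1 set"
  assumes I: "ring_ideal I"
    and A: "\<And>\<rho>. strict_mono \<rho> \<Longrightarrow> det (mat s s (\<lambda>(i, j). A (\<rho> i) j)) \<in> I"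
  shows "det (mat (q + s) (q + s) (\<lambda>(i, j). if j < q then B i j else A i (j - q))) \<in> I"
  using A
proof (induction q arbitrary: A B)
  case 0
  then show ?case using 0[of id] by (simp add: strict_mono_def)
next
  case (Suc q A B)
  let ?M = "mat (Suc q + s) (Suc q + s) (\<lambda>(i, j). if j < Suc q then B i j else A i (j - Suc q))"
  have M: "?M \<in> carrier_mat (Suc q + s) (Suc q + s)" by simp
  have "cofactor ?M i 0 \<in> I" if i: "i < Suc q + s" for i
  proof -
    have del: "mat_delete ?M i 0 = mat (q + s) (q + s) (\<lambda>(i', j).
        if j < q then B (insert_index i i') (Suc j) else A (insert_index i i') (j - q))"
      by (intro eq_matI) (auto simp: mat_delete_def insert_index_def)
    have "det (mat s s (\<lambda>(i', j). A (insert_index i (\<rho> i')) j)) \<in> I" if "strict_mono \<rho>" for \<rho>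
    proof -
      have "strict_mono (\<lambda>x. insert_index i (\<rho> x))"
      proof (rule strict_monoI)
        fix x y :: nat assume "x < y"
        then have "\<rho> x < \<rho> y" using that by (simp add: strict_mono_def)
        then show "insert_index i (\<rho> x) < insert_index i (\<rho> y)" by (auto simp: insert_index_def)
      qed
      then show ?thesis using Suc.prems[of "\<lambda>x. insert_index i (\<rho> x)"] by simp
    qed
    then have "det (mat_delete ?M i 0) \<in> I" unfolding del by (rule Suc.IH)
    then show ?thesis unfolding cofactor_def by (rule ring_ideal_mult[OF I])
  qed
  then have "(\<Sum>i<Suc q + s. ?M $$ (i, 0) * cofactor ?M i 0) \<in> I"
    by (intro ring_ideal_sum[OF I] ring_ideal_mult[OF I]) auto
  then show ?case by (subst laplace_expansion_column[OF M, of 0]) auto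
qed

text \<open>An increasing selection of \<open>s\<close> out of \<open>s + 1\<close> indices skips
  exactly one, the first place where \<open>\<rho>\<close> stops being the identity.\<close>

lemma strict_mono_insert_index:
  fixes \<rho> :: "nat \<Rightarrow> nat"
  assumes \<rho>: "strict_mono \<rho>" and le: "\<And>i. i < s \<Longrightarrow> \<rho> i \<le> s"
  obtains j where "j < Suc s" "\<And>i. i < s \<Longrightarrow> \<rho> i = insert_index j i"
proof -
  have ge: "i \<le> \<rho> i" for i using \<rho> by (rule strict_mono_imp_increasing)
  have step: "\<rho> i + k \<le> \<rho> (i + k)" for i k
  proof (induction k)
    case (Suc k)
    have "\<rho> (i + k) < \<rho> (i + Suc k)" using \<rho> by (auto simp: strict_mono_def)
    with Suc show ?case by simp
  qed simp
  have up: "\<rho> i \<le> Suc i" if "i < s" for i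
    using step[of i "s - 1 - i"] le[of "s - 1"] that by simp
  define j where "j = (LEAST i. i \<ge> s \<or> \<rho> i \<noteq> i)"
  have ex: "s \<ge> s \<or> \<rho> s \<noteq> s" by simp
  have j: "j \<ge> s \<or> \<rho> j \<noteq> j" unfolding j_def by (rule LeastI[of _ s]) simp
  have js: "j \<le> s" unfolding j_def by (rule Least_le) simp
  have below: "\<rho> i = i" if "i < j" for i using not_less_Least[of i "\<lambda>i. i \<ge> s \<or> \<rho> i \<noteq> i"] that unfolding j_def by blast
  have above: "\<rho> i = Suc i" if i: "j \<le> i" "i < s" for i
  proof -
    have "\<rho> i \<noteq> i"
      using i
    proof (induction i rule: dec_induct)
      case base
      then show ?case using j by auto
    next
      case (step n)
      then have "\<rho> n = Suc n" using ge[of n] up[of n] by simp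
      moreover have "\<rho> n < \<rho> (Suc n)" using \<rho> by (auto simp: strict_mono_def)
      ultimately show ?case by simp
    qed
    then show ?thesis using ge[of i] up[OF i(2)] by simp
  qed
  show thesis
    by (rule that[of j]) (use js below above in \<open>auto simp: insert_index_def\<close>)
qed

lemma homogeneous_det:
  fixes A :: "('v::finite, 'k::comm_ring_1) mpoly mat"
  assumes A: "A \<in> carrier_mat p p" "\<And>i j. i < p \<Longrightarrow> j < p \<Longrightarrow> homogeneous d (A $$ (i, j))"
  shows "homogeneous (int p * d) (det A)"
  unfolding det_def'[OF A(1)]
proof (rule homogeneous_sum)
  fix \<pi> assume \<pi>: "\<pi> \<in> {\<pi>. \<pi> permutes {0..<p}}"
  have "homogeneous (\<Sum>i = 0..<p. d) (\<Prod>i = 0..<p. A $$ (i, \<pi> i))"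
    using \<pi> permutes_in_image[of \<pi> "{0..<p}"] by (intro homogeneous_prod A(2)) auto
  then have "homogeneous (int p * d) (\<Prod>i = 0..<p. A $$ (i, \<pi> i))" by simp
  then show "homogeneous (int p * d) (signof \<pi> * (\<Prod>i = 0..<p. A $$ (i, \<pi> i)))"
    by (auto simp: sign_def intro: homogeneous_uminus)
qed

lemma homogeneous_minor:
  fixes B :: "('v::finite, 'k::comm_ring_1) mpoly mat"
  assumes B: "B \<in> carrier_mat p (Suc p)" "\<And>i j. i < p \<Longrightarrow> j < Suc p \<Longrightarrow> homogeneous d (B $$ (i, j))"
    and j: "j < Suc p"
  shows "homogeneous (int p * d) (minor B j)"
proof -
  have "homogeneous (int p * d) (det (mat p p (\<lambda>(i, k). B $$ (i, insert_index j k))))"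
    using j by (intro homogeneous_det) (auto simp: insert_index_def intro!: B(2))
  then have "homogeneous (int p * d) ((- 1) ^ j * det (mat p p (\<lambda>(i, k). B $$ (i, insert_index j k))))"
    by (cases "even j") (auto intro: homogeneous_uminus)
  then show ?thesis by (simp add: minor_eq[OF B(1)])
qed

section \<open>Matrices acting on free modules\<close>

text \<open>A map from rank \<open>a\<close> to rank \<open>b\<close>. The matrix is a bare
  function, which suits block matrices; cutting off at \<open>b\<close> keeps values in
  \<open>Fr b\<close>.\<close>

definition mv :: "nat \<Rightarrow> nat \<Rightarrow> (nat \<Rightarrow> nat \<Rightarrow> 'a::comm_ring_1) \<Rightarrow> (nat \<Rightarrow> 'a) \<Rightarrow> nat \<Rightarrow> 'a" where
  "mv a b M w = (\<lambda>i. if i < b then \<Sum>j<a. M i j * w j else 0)"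

lemma mv_Fr: "mv a b M w \<in> Fr b"
  by (simp add: mv_def Fr_def)

lemma module_hom_mv: "Modules.module_hom smul smul (mv a b M)"
  by standard (auto simp: mv_def fun_eq_iff smul_apply sum.distrib sum_distrib_left algebra_simps)

lemma Fr_eqI: "v \<in> Fr k \<Longrightarrow> w \<in> Fr k \<Longrightarrow> (\<And>j. j < k \<Longrightarrow> v j = w j) \<Longrightarrow> v = w"
  by (auto simp: Fr_def fun_eq_iff) (metis not_less)

lemma Fr_restrict: "(\<lambda>j. if j < k then v j else 0) \<in> Fr k"
  by (simp add: Fr_def)

lemma subspace_mv_image: "fmod.subspace (mv a b M ` Fr a)"
proof -
  interpret f: Modules.module_hom smul smul "mv a b M" by (rule module_hom_mv)
  show ?thesis by (rule f.subspace_image[OF subspace_Fr])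
qed

lemma graded_sub_mv_image:
  fixes M :: "nat \<Rightarrow> nat \<Rightarrow> ('v::finite, 'k::comm_ring_1) mpoly"
  assumes M: "\<And>i j. i < b \<Longrightarrow> j < a \<Longrightarrow> homogeneous (int d) (M i j)"
  shows "graded_sub b (mv a b M ` Fr a)"
  unfolding graded_sub_def
proof (intro conjI ballI allI)
  show "fmod.subspace (mv a b M ` Fr a)" by (rule subspace_mv_image)
  show "mv a b M ` Fr a \<subseteq> Fr b" using mv_Fr by blast
next
  fix w e assume "w \<in> mv a b M ` Fr a"
  then obtain v where v: "v \<in> Fr a" "w = mv a b M v" by blast
  define v' where "v' = (\<lambda>j. if d \<le> e then hcomp (e - d) (v j) else 0)"
  have "hcomp e (M i j * v j) = M i j * v' j" if "i < b" "j < a" for i j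
    using hcomp_mult[OF M[OF that], of e "v j"] by (simp add: v'_def)
  then have "(\<lambda>i. hcomp e (w i)) = mv a b M v'"
    by (auto simp: v(2) mv_def fun_eq_iff hcomp_sum intro!: sum.cong)
  moreover have "v' \<in> Fr a" using v(1) by (simp add: Fr_def v'_def)
  ultimately show "(\<lambda>i. hcomp e (w i)) \<in> mv a b M ` Fr a" by blast
qed

text \<open>The image is \<open>Fr a\<close> modulo the kernel, and free modules have the full range
  \<open>CARD('v)\<close>; passing to the cokernel costs one degree.\<close>

lemma kvanish_mv_quotient:
  fixes M :: "nat \<Rightarrow> nat \<Rightarrow> ('v::finite, 'k::comm_ring_1) mpoly"
  assumes K: "fmod.kvanish vars (Suc q) (Fr a) {w \<in> Fr a. mv a b M w = 0}" and q: "q \<le> CARD('v)"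
  shows "fmod.kvanish vars q (Fr b) (mv a b M ` Fr a)"
proof (rule fmod.kvanish_quotient[OF subspace_mv_image subspace_Fr])
  show "mv a b M ` Fr a \<subseteq> Fr b" using mv_Fr by blast
  show "fmod.kvanish vars (Suc q) (mv a b M ` Fr a) {0}"
    by (rule fmod.kvanish_image[OF module_hom_mv subspace_Fr K])
  show "fmod.kvanish vars q (Fr b :: (nat \<Rightarrow> ('v, 'k) mpoly) set) {0}"
    by (rule fmod.kvanish_mono[OF kvanish_Fr q])
qed

lemma kvanish_mv_injective:
  fixes M :: "nat \<Rightarrow> nat \<Rightarrow> ('v::finite, 'k::comm_ring_1) mpoly"
  assumes "{w \<in> Fr a. mv a b M w = 0} = {0}" and "Suc q = CARD('v)"
  shows "fmod.kvanish vars q (Fr b) (mv a b M ` Fr a)"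
  using kvanish_Fr[of a] assms by (intro kvanish_mv_quotient) auto


text \<open>Comparing components of degree \<open>e + d\<close> allows the coefficients to be
  replaced by their components of degree \<open>e\<close>; this keeps lifts
  degree-preserving.\<close>

lemma homogeneous_combination:
  fixes f :: "('v::finite, 'k::comm_ring_1) mpoly"
  assumes f: "f = (\<Sum>j\<in>A. c j * g j)" "homogeneous (int (e + d)) f"
    and g: "\<And>j. j \<in> A \<Longrightarrow> homogeneous (int d) (g j)"
  shows "f = (\<Sum>j\<in>A. hcomp e (c j) * g j)"
proof -
  have "f = hcomp (e + d) f" using hcomp_homogeneous[OF f(2), of "e + d"] by simp
  also have "\<dots> = (\<Sum>j\<in>A. hcomp (e + d) (g j * c j))" by (simp add: f(1) hcomp_sum mult.commute)
  also have "\<dots> = (\<Sum>j\<in>A. hcomp e (c j) * g j)"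
    using hcomp_mult[OF g] by (intro sum.cong) (auto simp: mult.commute)
  finally show ?thesis .
qed

section \<open>The Hilbert-Burch theorem\<close>

lemma prime_ideal_0: "prime_ideal {0 :: ('v::finite, 'k::field) mpoly}"
  using mpoly_no_zero_divisors by (auto simp: prime_ideal_def ring_ideal_def)

text \<open>The zero ideal is itself a point and has no point below it. This is what excludes the
  vanishing of all maximal minors.\<close>

lemma codimension_0: "codimension {0 :: ('v::finite, 'k::field) mpoly} \<le> enat 0"
proof -
  have "Poly_Mapping.lookup (Var i :: ('v, 'k) mpoly) (Poly_Mapping.single i 1) \<noteq> 0" for i
    by (simp add: Var_def)
  then have "Var i \<noteq> (0 :: ('v, 'k) mpoly)" for i by (metis lookup_zero)
  then have P: "{0} \<in> (proj_points :: ('v, 'k) mpoly set set)"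
    using prime_ideal_0 by (auto simp: proj_points_iff graded_ideal_def prime_ideal_def)
  have "chain_length {Q \<in> proj_points. Q \<subseteq> {0 :: ('v, 'k) mpoly}} \<le> enat 0"
  proof (rule chain_length_leI)
    fix Ps :: "('v, 'k) mpoly set list"
    assume Ps: "Ps \<noteq> []" "set Ps \<subseteq> {Q \<in> proj_points. Q \<subseteq> {0}}" "sorted_wrt (\<subset>) Ps"
    have "Q = {0}" if "Q \<in> set Ps" for Q
      using that Ps(2) by (auto simp: proj_points_iff prime_ideal_def dest: ring_ideal_0)
    with Ps(3) show "length Ps \<le> Suc 0"
      by (cases Ps; cases "tl Ps") auto
  qed
  moreover have "codimension {0 :: ('v, 'k) mpoly} \<le> chain_length {Q \<in> proj_points. Q \<subseteq> {0 :: ('v, 'k) mpoly}}"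
    unfolding codimension_def using P by (intro INF_lower) (simp add: points_of_def)
  ultimately show ?thesis by (rule order_trans[rotated])
qed

text \<open>Codimension at least 2 for the ideal of maximal minors is the geometric form of the
  depth condition that makes both the complex of \<open>F\<close> and its dual exact.\<close>

locale hilbert_burch =
  fixes F :: "('v::finite, 'k::field_char_0) mpoly mat" and s d :: nat
  assumes F: "F \<in> carrier_mat s (Suc s)"
    and homF: "\<And>i j. i < s \<Longrightarrow> j < Suc s \<Longrightarrow> homogeneous (int d) (F $$ (i, j))"
    and codim: "codimension (gen_ideal (minor F ` {..<Suc s})) > enat 1"
begin

abbreviation IF :: "('v, 'k) mpoly set" where "IF \<equiv> gen_ideal (minor F ` {..<Suc s})"

abbreviation FM :: "nat \<Rightarrow> nat \<Rightarrow> ('v, 'k) mpoly" where "FM \<equiv> (\<lambda>i j. F $$ (i, j))"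

abbreviation FT :: "nat \<Rightarrow> nat \<Rightarrow> ('v, 'k) mpoly" where "FT \<equiv> (\<lambda>i j. F $$ (j, i))"

abbreviation DM :: "nat \<Rightarrow> nat \<Rightarrow> ('v, 'k) mpoly" where "DM \<equiv> (\<lambda>i j. minor F i)"

lemma hom_minor: "j < Suc s \<Longrightarrow> homogeneous (int (s * d)) (minor F j)"
  using homogeneous_minor[OF F, of "int d"] homF by simp

lemma graded_IF: "graded_ideal IF"
proof (rule graded_ideal_gen)
  fix f assume "f \<in> minor F ` {..<Suc s}"
  then show "\<exists>d. homogeneous d f" using hom_minor by blast
qed

lemma ex_minor_nonzero: "\<exists>l<Suc s. minor F l \<noteq> 0"
proof (rule ccontr)
  assume "\<not> ?thesis"
  then have "minor F ` {..<Suc s} = {0}" by force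
  moreover have "gen_ideal {0 :: ('v, 'k) mpoly} = {0}"
    using gen_ideal_minimal[of "{0 :: ('v, 'k) mpoly}" "{0}"] gen_ideal_superset[of "{0 :: ('v, 'k) mpoly}"]
    by (auto simp: ring_ideal_def)
  ultimately have "codimension IF \<le> enat 0"
    using codimension_0[where ?'v = 'v and ?'k = 'k] by simp
  from less_le_trans[OF codim this] show False by simp
qed

text \<open>If \<open>w\<close> is orthogonal to the columns of \<open>F\<close>, pairing it with a
  vector that \<open>F\<close> sends to \<open>minor F l\<close> times a unit vector gives
  \<open>minor F l * w k = 0\<close>.\<close>

lemma FT_injective: "{w \<in> Fr s. mv s (Suc s) FT w = 0} = {0}"
proof
  show "{w \<in> Fr s. mv s (Suc s) FT w = 0} \<subseteq> {0}"
  proof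
    fix w assume "w \<in> {w \<in> Fr s. mv s (Suc s) FT w = 0}"
    then have w: "w \<in> Fr s" "mv s (Suc s) FT w = 0" by auto
    have w0: "(\<Sum>i<s. F $$ (i, j) * w i) = 0" if "j < Suc s" for j
      using fun_cong[OF w(2), of j] that by (simp add: mv_def)
    obtain l where l: "l < Suc s" "minor F l \<noteq> 0" using ex_minor_nonzero by blast
    have "w k = 0" if k: "k < s" for k
    proof -
      obtain x where x: "\<forall>i<s. (\<Sum>j<Suc s. F $$ (i, j) * x j) = (if i = k then minor F l else 0)"
        using minor_unit_vectors[OF F l(1) k] by blast
      have "minor F l * w k = (\<Sum>i<s. if i = k then minor F l * w i else 0)" using k by simp
      also have "\<dots> = (\<Sum>i<s. (\<Sum>j<Suc s. F $$ (i, j) * x j) * w i)"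
        using x by (intro sum.cong) (auto simp del: sum.lessThan_Suc)
      also have "\<dots> = (\<Sum>i<s. \<Sum>j<Suc s. x j * (F $$ (i, j) * w i))"
        unfolding sum_distrib_right by (intro sum.cong refl) (simp add: mult_ac)
      also have "\<dots> = (\<Sum>j<Suc s. \<Sum>i<s. x j * (F $$ (i, j) * w i))" by (rule sum.swap)
      also have "\<dots> = (\<Sum>j<Suc s. x j * 0)"
        unfolding sum_distrib_left[symmetric] using w0 by (intro sum.cong) auto
      finally have "minor F l * w k = 0" by simp
      then show ?thesis using l(2) mpoly_no_zero_divisors by blast
    qed
    then have "w = 0" using w(1) fmod.subspace_0[OF subspace_Fr] by (intro Fr_eqI[of w s 0]) auto
    then show "w \<in> {0}" by simp
  qed
  show "{0} \<subseteq> {w \<in> Fr s. mv s (Suc s) FT w = 0}"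
    by (auto simp: Fr_def mv_def fun_eq_iff)
qed

lemma DM_injective: "{w \<in> Fr 1. mv 1 (Suc s) DM w = 0} = {0}"
proof -
  obtain l where l: "l < Suc s" "minor F l \<noteq> 0" using ex_minor_nonzero by blast
  have "w = 0" if w: "w \<in> Fr 1" "mv 1 (Suc s) DM w = 0" for w
  proof -
    have "minor F l * w 0 = 0" using fun_cong[OF w(2), of l] l(1) by (simp add: mv_def)
    then have "w 0 = 0" using l(2) mpoly_no_zero_divisors by blast
    then show ?thesis using w(1) by (intro Fr_eqI[of w 1 0]) (auto simp: Fr_def)
  qed
  then show ?thesis by (auto simp: Fr_def mv_def fun_eq_iff)
qed

context
  fixes n :: nat
  assumes n: "CARD('v) = Suc n" "n \<ge> 1"
begin

text \<open>By Cramer's rule every minor moves a syzygy \<open>v\<close> into the row space of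
  \<open>F\<close>. The cokernel of the transpose has vanishing range \<open>n\<close>, so its
  associated primes have codimension at most 1, whereas the minors have codimension at least
  2.\<close>

lemma kernel_minors:
  assumes v: "v \<in> Fr (Suc s)" "(\<Sum>j<Suc s. v j * minor F j) = 0"
  shows "v \<in> mv s (Suc s) FT ` Fr s"
proof (rule mem_if_codimension[OF graded_sub_mv_image _ graded_IF, where q = "n - 1"])
  show "\<And>i j. i < Suc s \<Longrightarrow> j < s \<Longrightarrow> homogeneous (int d) (F $$ (j, i))" by (rule homF)
  show "fmod.kvanish vars (Suc (n - 1)) (Fr (Suc s)) (mv s (Suc s) FT ` Fr s)"
    using n by (intro kvanish_mv_injective[OF FT_injective]) auto
  show "enat (CARD('v) - Suc (n - 1)) < codimension IF" using codim n by simp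
  show "v \<in> Fr (Suc s)" by (rule v)
  show "IF \<subseteq> colon (mv s (Suc s) FT ` Fr s) v"
  proof (rule gen_ideal_minimal[OF ring_ideal_colon[OF subspace_mv_image]], rule image_subsetI)
    fix l assume "l \<in> {..<Suc s}"
    then obtain z where z: "\<forall>j<Suc s. (\<Sum>i<s. z i * F $$ (i, j)) =
        minor F l * v j - (\<Sum>m<Suc s. v m * minor F m) * (if j = l then 1 else 0)"
      using minor_row_combination[OF F, of l v] by blast
    define z' where "z' = (\<lambda>i. if i < s then z i else 0)"
    have "smul (minor F l) v = mv s (Suc s) FT z'"
    proof (rule Fr_eqI[OF smul_Fr[OF v(1)] mv_Fr])
      fix j assume j: "j < Suc s"
      have "mv s (Suc s) FT z' j = (\<Sum>i<s. z i * F $$ (i, j))"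
        using j by (simp add: mv_def z'_def mult.commute)
      then show "smul (minor F l) v j = mv s (Suc s) FT z' j"
        using z[rule_format, OF j] v(2) by (simp add: smul_apply)
    qed
    moreover have "z' \<in> Fr s" unfolding z'_def by (rule Fr_restrict)
    ultimately show "minor F l \<in> colon (mv s (Suc s) FT ` Fr s) v"
      by (simp add: colon_def)
  qed
qed

lemma kvanish_DM: "fmod.kvanish vars n (Fr (Suc s)) (mv 1 (Suc s) DM ` Fr 1)"
  using n by (intro kvanish_mv_injective[OF DM_injective]) auto

text \<open>Exactness of the dual complex: \<open>minor_kernel\<close> shows that each minor moves
  \<open>x\<close> into the multiples of the vector of minors, and the codimension argument of
  \<open>kernel_minors\<close> applies to that cokernel.\<close>

lemma kernel_FM: "{x \<in> Fr (Suc s). mv (Suc s) s FM x = 0} = mv 1 (Suc s) DM ` Fr 1"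
proof
  show "{x \<in> Fr (Suc s). mv (Suc s) s FM x = 0} \<subseteq> mv 1 (Suc s) DM ` Fr 1"
  proof
    fix x assume "x \<in> {x \<in> Fr (Suc s). mv (Suc s) s FM x = 0}"
    then have x: "x \<in> Fr (Suc s)" "mv (Suc s) s FM x = 0" by auto
    have x0: "(\<Sum>j<Suc s. F $$ (i, j) * x j) = 0" if "i < s" for i
      using fun_cong[OF x(2), of i] that by (simp add: mv_def)
    show "x \<in> mv 1 (Suc s) DM ` Fr 1"
    proof (rule mem_if_codimension[OF graded_sub_mv_image _ graded_IF, where q = "n - 1"])
      show "\<And>i j. i < Suc s \<Longrightarrow> j < 1 \<Longrightarrow> homogeneous (int (s * d)) (minor F i)" by (rule hom_minor)
      show "fmod.kvanish vars (Suc (n - 1)) (Fr (Suc s)) (mv 1 (Suc s) DM ` Fr 1)"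
        using kvanish_DM n by simp
      show "enat (CARD('v) - Suc (n - 1)) < codimension IF" using codim n by simp
      show "x \<in> Fr (Suc s)" by (rule x)
      show "IF \<subseteq> colon (mv 1 (Suc s) DM ` Fr 1) x"
      proof (rule gen_ideal_minimal[OF ring_ideal_colon[OF subspace_mv_image]], rule image_subsetI)
        fix l assume "l \<in> {..<Suc s}"
        then have l: "l < Suc s" by simp
        define c where "c = (\<lambda>j::nat. if j < 1 then x l else 0)"
        have "smul (minor F l) x = mv 1 (Suc s) DM c"
        proof (rule Fr_eqI[OF smul_Fr[OF x(1)] mv_Fr])
          fix j assume j: "j < Suc s"
          show "smul (minor F l) x j = mv 1 (Suc s) DM c j"
            using minor_kernel[OF F x0 l j] j by (simp add: smul_apply mv_def c_def)
        qed
        moreover have "c \<in> Fr 1" unfolding c_def by (rule Fr_restrict)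
        ultimately show "minor F l \<in> colon (mv 1 (Suc s) DM ` Fr 1) x"
          by (simp add: colon_def)
      qed
    qed
  qed
  show "mv 1 (Suc s) DM ` Fr 1 \<subseteq> {x \<in> Fr (Suc s). mv (Suc s) s FM x = 0}"
  proof (rule image_subsetI)
    fix w :: "nat \<Rightarrow> ('v, 'k) mpoly"
    have inner: "mv 1 (Suc s) DM w j = minor F j * w 0" if "j < Suc s" for j
      using that by (simp add: mv_def)
    have "mv (Suc s) s FM (mv 1 (Suc s) DM w) i = 0" for i
    proof (cases "i < s")
      case True
      then have "mv (Suc s) s FM (mv 1 (Suc s) DM w) i = (\<Sum>j<Suc s. F $$ (i, j) * mv 1 (Suc s) DM w j)"
        by (simp only: mv_def[of "Suc s" s] if_True)
      also have "\<dots> = (\<Sum>j<Suc s. F $$ (i, j) * minor F j * w 0)"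
        by (intro sum.cong refl) (simp only: inner lessThan_iff mult.assoc)
      also have "\<dots> = 0"
        using minor_relation[OF F True] by (simp only: sum_distrib_right[symmetric] mult_zero_left)
      finally show ?thesis .
    qed (simp add: mv_def[of "Suc s" s])
    then have "mv (Suc s) s FM (mv 1 (Suc s) DM w) = 0" by (simp add: fun_eq_iff)
    then show "mv 1 (Suc s) DM w \<in> {x \<in> Fr (Suc s). mv (Suc s) s FM x = 0}"
      using mv_Fr by blast
  qed
qed

text \<open>The cokernel of \<open>F\<close> is resolved by two maps, which leaves
  \<open>n + 1 - 2\<close> degrees.\<close>

lemma kvanish_FM:
  assumes "n \<ge> 1"
  shows "fmod.kvanish vars (n - 1) (Fr s) (mv (Suc s) s FM ` Fr (Suc s))"
  using kvanish_DM n by (intro kvanish_mv_quotient) (auto simp: kernel_FM)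

end

text \<open>Each minor times each unit vector lies in the column space by
  \<open>minor_unit_vectors\<close>.\<close>

lemma IF_annihilates_cokernel:
  assumes "f \<in> IF" "w \<in> Fr s"
  shows "smul f w \<in> mv (Suc s) s FM ` Fr (Suc s)" (is "_ \<in> ?N")
proof -
  have "IF \<subseteq> colon ?N w"
  proof (rule gen_ideal_minimal[OF ring_ideal_colon[OF subspace_mv_image]], rule image_subsetI)
    fix l assume "l \<in> {..<Suc s}"
    then have l: "l < Suc s" by simp
    have "\<forall>k. \<exists>x. k < s \<longrightarrow> (\<forall>i<s. (\<Sum>j<Suc s. F $$ (i, j) * x j) = (if i = k then minor F l else 0))"
      using minor_unit_vectors[OF F l] by blast
    from choice[OF this] obtain x where x: "\<And>k i. k < s \<Longrightarrow> i < s \<Longrightarrow>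
        (\<Sum>j<Suc s. F $$ (i, j) * x k j) = (if i = k then minor F l else 0)" by blast
    define u where "u = (\<lambda>j. if j < Suc s then \<Sum>k<s. w k * x k j else 0)"
    have "smul (minor F l) w = mv (Suc s) s FM u"
    proof (rule Fr_eqI[OF smul_Fr[OF assms(2)] mv_Fr])
      fix i assume i: "i < s"
      have "mv (Suc s) s FM u i = (\<Sum>j<Suc s. \<Sum>k<s. w k * (F $$ (i, j) * x k j))"
        using i by (simp add: mv_def u_def sum_distrib_left mult.left_commute del: sum.lessThan_Suc)
      also have "\<dots> = (\<Sum>k<s. \<Sum>j<Suc s. w k * (F $$ (i, j) * x k j))" by (rule sum.swap)
      also have "\<dots> = (\<Sum>k<s. w k * (if i = k then minor F l else 0))"
        unfolding sum_distrib_left[symmetric] using x i by (intro sum.cong) auto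
      also have "\<dots> = (\<Sum>k<s. if k = i then minor F l * w i else 0)" by (intro sum.cong) auto
      also have "\<dots> = minor F l * w i" using i by simp
      finally show "smul (minor F l) w i = mv (Suc s) s FM u i" by (simp add: smul_apply)
    qed
    moreover have "u \<in> Fr (Suc s)" unfolding u_def by (rule Fr_restrict)
    ultimately show "minor F l \<in> colon ?N w" by (simp add: colon_def)
  qed
  with assms(1) show ?thesis by (auto simp: colon_def)
qed

end

section \<open>The intersection of the two determinantal schemes\<close>

lemma sum_lessThan_add:
  "(\<Sum>j<a + b. g j) = (\<Sum>j<a. g j) + (\<Sum>j<b. g (a + j :: nat) :: 'a::comm_monoid_add)"
  by (induction b) (auto simp: add.assoc)

text \<open>\<open>B\<close> is the larger matrix, column \<open>Suc r + k\<close> holding row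
  \<open>k\<close> of \<open>F\<close>; \<open>t = r + s\<close> avoids natural subtraction.
  \<open>codim_J\<close> is what the absence of a common component provides.\<close>

locale determinantal_pair = hilbert_burch F s d
  for F :: "('v::finite, 'k::field_char_0) mpoly mat" and s d :: nat +
  fixes G :: "('v, 'k) mpoly mat" and r t n :: nat and B :: "('v, 'k) mpoly mat"
    and J :: "('v, 'k) mpoly set"
  assumes t: "t = r + s" and r: "r \<ge> 1" and s: "s \<ge> 1" and d: "d \<ge> 1"
    and n: "CARD('v) = Suc n" "n \<ge> 3"
    and G: "G \<in> carrier_mat t (Suc r)"
    and homG: "\<And>i j. i < t \<Longrightarrow> j < Suc r \<Longrightarrow> homogeneous (int d) (G $$ (i, j))"
    and B_def: "B = mat t (Suc t) (\<lambda>(i, j). if j < Suc r then G $$ (i, j)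
                 else if i < Suc s then F $$ (j - Suc r, i) else 0)"
    and J_def: "J = gen_ideal (minor F ` {..<Suc s} \<union> minor B ` {..<Suc t})"
    and codim_J: "codimension J > enat 2"
begin

definition \<delta> :: "nat \<Rightarrow> ('v, 'k) mpoly" where "\<delta> k = minor B (Suc r + k)"

lemma B: "B \<in> carrier_mat t (Suc t)"
  by (simp add: B_def)

lemma B_F: "i < t \<Longrightarrow> k < s \<Longrightarrow> B $$ (i, Suc r + k) = (if i < Suc s then F $$ (k, i) else 0)"
  by (simp add: B_def t)

lemma hom_\<delta>: "k < s \<Longrightarrow> homogeneous (int (t * d)) (\<delta> k)"
  unfolding \<delta>_def of_nat_mult
  by (rule homogeneous_minor[OF B]) (auto simp: B_def t intro!: homG homF)

text \<open>Omitting a column of \<open>G\<close> keeps all columns of the \<open>F\<close> block.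
  Expanding along the other \<open>r\<close> columns leaves determinants that contain a zero row or
  are maximal minors of \<open>F\<close> up to sign.\<close>

lemma minor_B_mem:
  assumes j: "j < Suc r"
  shows "minor B j \<in> IF"
proof -
  define A where "A = (\<lambda>i k. if i < Suc s then F $$ (k, i) else 0)"
  have A: "det (mat s s (\<lambda>(i, k). A (\<rho> i) k)) \<in> IF" if \<rho>: "strict_mono \<rho>" for \<rho>
  proof (cases "\<exists>i<s. \<not> \<rho> i < Suc s")
    case True
    then obtain i where i: "i < s" "\<not> \<rho> i < Suc s" by blast
    let ?M = "mat s s (\<lambda>(i, k). A (\<rho> i) k)"
    have "det ?M = (\<Sum>k<s. ?M $$ (i, k) * cofactor ?M i k)"
      by (rule laplace_expansion_row) (use i in auto)
    also have "\<dots> = 0" using i by (intro sum.neutral) (auto simp: A_def)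
    finally show ?thesis by (simp add: ring_ideal_0 ring_ideal_gen)
  next
    case False
    then have "\<And>i. i < s \<Longrightarrow> \<rho> i \<le> s" by auto
    from strict_mono_insert_index[OF \<rho> this] obtain l where
      l: "l < Suc s" "\<And>i. i < s \<Longrightarrow> \<rho> i = insert_index l i" by blast
    have "mat s s (\<lambda>(i, k). A (\<rho> i) k) = transpose_mat (mat s s (\<lambda>(i, k). F $$ (i, insert_index l k)))"
      using l by (intro eq_matI) (auto simp: A_def insert_index_def)
    then have "det (mat s s (\<lambda>(i, k). A (\<rho> i) k)) = det (mat s s (\<lambda>(i, k). F $$ (i, insert_index l k)))"
      by (simp add: det_transpose[of _ s])
    also have "\<dots> = (- 1) ^ l * minor F l"
      by (simp add: minor_eq[OF F] flip: mult.assoc power_mult_distrib)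
    also have "\<dots> \<in> IF"
      using l(1) gen_ideal_superset[of "minor F ` {..<Suc s}"]
      by (intro ring_ideal_mult ring_ideal_gen) auto
    finally show ?thesis .
  qed
  have "mat t t (\<lambda>(i, k). B $$ (i, insert_index j k)) =
      mat (r + s) (r + s) (\<lambda>(i, k). if k < r then B $$ (i, insert_index j k) else A i (k - r))"
    using j by (intro eq_matI) (auto simp: B_def t A_def insert_index_def)
  moreover have "det (mat (r + s) (r + s) (\<lambda>(i, k). if k < r then B $$ (i, insert_index j k) else A i (k - r))) \<in> IF"
    by (rule det_last_columns_mem[OF ring_ideal_gen A])
  ultimately have "det (mat t t (\<lambda>(i, k). B $$ (i, insert_index j k))) \<in> IF" by metis
  then show ?thesis
    unfolding minor_eq[OF B] by (rule ring_ideal_mult[OF ring_ideal_gen])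
qed

text \<open>This makes \<open>\<delta>\<close> well defined from the cokernel of \<open>F\<close> to
  the quotient by \<open>IF\<close>: in the relation among the minors given by row \<open>i\<close>
  of \<open>B\<close>, the terms of the columns of \<open>G\<close> lie in
  \<open>IF\<close>.\<close>

lemma \<delta>_F_mem:
  assumes i: "i < Suc s"
  shows "(\<Sum>k<s. \<delta> k * F $$ (k, i)) \<in> IF"
proof -
  have it: "i < t" using i r by (simp add: t)
  have "0 = (\<Sum>j<Suc r + s. B $$ (i, j) * minor B j)"
    using minor_relation[OF B it] by (simp add: t)
  also have "\<dots> = (\<Sum>j<Suc r. B $$ (i, j) * minor B j) + (\<Sum>k<s. B $$ (i, Suc r + k) * minor B (Suc r + k))"
    by (rule sum_lessThan_add)
  also have "(\<Sum>k<s. B $$ (i, Suc r + k) * minor B (Suc r + k)) = (\<Sum>k<s. \<delta> k * F $$ (k, i))"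
    using i it by (intro sum.cong) (simp_all add: B_F \<delta>_def mult.commute del: add_Suc)
  finally have "0 = (\<Sum>j<Suc r. B $$ (i, j) * minor B j) + (\<Sum>k<s. \<delta> k * F $$ (k, i))" .
  from minus_unique[OF this[symmetric], symmetric]
  have "(\<Sum>k<s. \<delta> k * F $$ (k, i)) = - (\<Sum>j<Suc r. B $$ (i, j) * minor B j)" .
  also have "\<dots> \<in> IF"
    by (intro ring_ideal_minus ring_ideal_sum ring_ideal_mult ring_ideal_gen minor_B_mem) simp
  finally show ?thesis .
qed

text \<open>The minors of \<open>B\<close> omitting a column of \<open>G\<close> are redundant by
  \<open>minor_B_mem\<close>; the remaining \<open>2 s + 1\<close> generators index the first module
  of the resolution.\<close>

lemma J_eq_gen: "J = gen_ideal (minor F ` {..<Suc s} \<union> \<delta> ` {..<s})" (is "_ = gen_ideal ?S")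
proof
  have IF: "IF \<subseteq> gen_ideal ?S"
    using gen_ideal_superset[of ?S] by (intro gen_ideal_minimal ring_ideal_gen) auto
  have "minor B j \<in> gen_ideal ?S" if j: "j < Suc t" for j
  proof (cases "j < Suc r")
    case True
    then show ?thesis using minor_B_mem IF by blast
  next
    case False
    then have "minor B j = \<delta> (j - Suc r)" "j - Suc r < s" using j by (auto simp: \<delta>_def t)
    then show ?thesis using gen_ideal_superset[of ?S] by auto
  qed
  then show "J \<subseteq> gen_ideal ?S"
    unfolding J_def using gen_ideal_superset[of ?S] by (intro gen_ideal_minimal ring_ideal_gen) auto
  have "?S \<subseteq> minor F ` {..<Suc s} \<union> minor B ` {..<Suc t}" by (auto simp: \<delta>_def t)
  then show "gen_ideal ?S \<subseteq> J"
    unfolding J_def using gen_ideal_superset[of "minor F ` {..<Suc s} \<union> minor B ` {..<Suc t}"]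
    by (intro gen_ideal_minimal ring_ideal_gen) (rule order_trans)
qed

lemma graded_J: "graded_ideal J"
  unfolding J_eq_gen
proof (rule graded_ideal_gen)
  fix f assume "f \<in> minor F ` {..<Suc s} \<union> \<delta> ` {..<s}"
  then show "\<exists>d. homogeneous d f" using hom_minor hom_\<delta> by blast
qed

text \<open>In the cokernel \<open>C\<close> of \<open>F\<close> one has \<open>\<delta>\<^sub>l w = (\<Sum>\<^sub>k \<delta>\<^sub>k w\<^sub>k) e\<^sub>l\<close>, and \<open>C\<close> is killed by the
  minors of \<open>F\<close>. Hence a \<open>w\<close> with \<open>\<Sum>\<^sub>k \<delta>\<^sub>k w\<^sub>k\<close> in their ideal is killed by \<open>J\<close>, so it vanishes in
  \<open>C\<close> because \<open>C\<close> has depth \<open>n - 1\<close> and \<open>J\<close> has codimension at least \<open>3\<close>.\<close>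

lemma \<delta>_injective:
  assumes w: "w \<in> Fr s" "(\<Sum>k<s. \<delta> k * w k) \<in> IF"
  shows "w \<in> mv (Suc s) s FM ` Fr (Suc s)" (is "_ \<in> ?N")
proof (rule mem_if_codimension[OF graded_sub_mv_image _ graded_J, where q = "n - 2"])
  show "\<And>i j. i < s \<Longrightarrow> j < Suc s \<Longrightarrow> homogeneous (int d) (F $$ (i, j))" by (rule homF)
  show "fmod.kvanish vars (Suc (n - 2)) (Fr s) ?N"
  proof -
    have "fmod.kvanish vars (n - 1) (Fr s) ?N" using n by (intro kvanish_FM) auto
    then show ?thesis using n(2) by (simp add: numeral_2_eq_2 Suc_diff_Suc)
  qed
  show "enat (CARD('v) - Suc (n - 2)) < codimension J"
  proof -
    have "CARD('v) - Suc (n - 2) = 2" using n by simp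
    with codim_J show ?thesis by simp
  qed
  show "w \<in> Fr s" by (rule w)
  show "J \<subseteq> colon ?N w"
    unfolding J_eq_gen
  proof (rule gen_ideal_minimal[OF ring_ideal_colon[OF subspace_mv_image]], rule subsetI)
    fix f assume "f \<in> minor F ` {..<Suc s} \<union> \<delta> ` {..<s}"
    then consider "f \<in> IF" | l where "l < s" "f = \<delta> l"
      using gen_ideal_superset[of "minor F ` {..<Suc s}"] by blast
    then show "f \<in> colon ?N w"
    proof cases
      case 1
      then show ?thesis using IF_annihilates_cokernel[OF _ w(1)] by (simp add: colon_def)
    next
      case (2 l)
      \<comment> \<open>Zeros on the columns of \<open>G\<close>, so that only the minors
        \<open>\<delta>\<close> enter the sum.\<close>
      define w' where "w' = (\<lambda>j. if j < Suc r then 0 else w (j - Suc r))"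
      define c where "c = (\<Sum>k<s. \<delta> k * w k)"
      have c: "(\<Sum>m<Suc t. w' m * minor B m) = c"
      proof -
        have "(\<Sum>m<Suc t. w' m * minor B m) = (\<Sum>m<Suc r + s. w' m * minor B m)" by (simp add: t)
        also have "\<dots> = (\<Sum>m<Suc r. w' m * minor B m) + (\<Sum>k<s. w' (Suc r + k) * minor B (Suc r + k))"
          by (rule sum_lessThan_add)
        also have "(\<Sum>m<Suc r. w' m * minor B m) = 0" by (intro sum.neutral) (auto simp: w'_def)
        also have "(\<Sum>k<s. w' (Suc r + k) * minor B (Suc r + k)) = c"
          unfolding c_def by (intro sum.cong) (auto simp: w'_def \<delta>_def mult.commute)
        finally show ?thesis by simp
      qed
      have "Suc r + l < Suc t" using 2(1) by (simp add: t)
      from minor_row_combination[OF B this, of w'] obtain z where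
        z: "\<And>j. j < Suc t \<Longrightarrow> (\<Sum>i<t. z i * B $$ (i, j)) = \<delta> l * w' j - c * (if j = Suc r + l then 1 else 0)"
        unfolding c \<delta>_def[symmetric] by blast
      \<comment> \<open>The coefficients of the rows below the \<open>F\<close> block are dropped,
        as the columns of that block vanish there.\<close>
      define x where "x = (\<lambda>i. if i < Suc s then z i else 0)"
      define e where "e = (\<lambda>k. if k = l then (1 :: ('v, 'k) mpoly) else 0)"
      have e: "e \<in> Fr s" using 2(1) by (simp add: Fr_def e_def)
      have "mv (Suc s) s FM x + smul c e = smul (\<delta> l) w"
      proof (rule Fr_eqI)
        show "mv (Suc s) s FM x + smul c e \<in> Fr s"
          by (intro fmod.subspace_add[OF subspace_Fr] mv_Fr smul_Fr e)
        show "smul (\<delta> l) w \<in> Fr s" by (rule smul_Fr[OF w(1)])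
        fix k assume k: "k < s"
        have kt: "Suc r + k < Suc t" using k by (simp add: t)
        have "(\<Sum>i<t. z i * B $$ (i, Suc r + k)) = (\<Sum>i<t. if i < Suc s then F $$ (k, i) * z i else 0)"
          using k by (intro sum.cong) (auto simp: B_F simp del: add_Suc)
        also have "\<dots> = (\<Sum>i<Suc s. F $$ (k, i) * z i)"
          using r by (intro sum.mono_neutral_cong_right) (auto simp: t)
        also have "\<dots> = mv (Suc s) s FM x k"
          using k by (simp add: mv_def x_def del: sum.lessThan_Suc)
        finally have "mv (Suc s) s FM x k = \<delta> l * w k - c * e k"
          using z[OF kt] by (simp add: w'_def e_def)
        then show "(mv (Suc s) s FM x + smul c e) k = smul (\<delta> l) w k" by (simp add: smul_apply)
      qed
      moreover have "mv (Suc s) s FM x \<in> ?N" by (rule imageI) (simp add: x_def Fr_def)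
      moreover have "smul c e \<in> ?N" using IF_annihilates_cokernel[OF _ e] w(2) by (simp add: c_def)
      ultimately have "smul (\<delta> l) w \<in> ?N"
        using fmod.subspace_add[OF subspace_mv_image] by metis
      then show ?thesis by (simp add: colon_def 2(2))
    qed
  qed
qed

text \<open>\<open>H\<close> lifts \<open>\<delta>\<close> to the next stage of the two complexes.
  Its degree makes up the difference between \<open>(t + 1) d\<close> for the left-hand side and
  \<open>s d\<close> for the minors.\<close>

lemma ex_H:
  "\<exists>H. \<forall>i<Suc s. (\<forall>j. homogeneous (int ((Suc t - s) * d)) (H j i)) \<and>
     (\<Sum>k<s. \<delta> k * F $$ (k, i)) = (\<Sum>j<Suc s. H j i * minor F j)"
proof -
  have "\<exists>c. (\<forall>j. homogeneous (int ((Suc t - s) * d)) (c j)) \<and>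
      (\<Sum>k<s. \<delta> k * F $$ (k, i)) = (\<Sum>j<Suc s. c j * minor F j)" if i: "i < Suc s" for i
  proof -
    let ?f = "\<Sum>k<s. \<delta> k * F $$ (k, i)"
    have "?f \<in> {\<Sum>j\<in>{..<Suc s}. c j * minor F j |c. True}"
      using \<delta>_F_mem[OF i] by (simp only: gen_ideal_image finite_lessThan)
    then obtain c where c: "?f = (\<Sum>j<Suc s. c j * minor F j)" by blast
    have "homogeneous (int (t * d) + int d) ?f"
      using i by (intro homogeneous_sum homogeneous_mult hom_\<delta> homF) auto
    moreover have "int (t * d) + int d = int ((Suc t - s) * d + s * d)"
      by (simp add: t algebra_simps flip: of_nat_add of_nat_mult)
    ultimately have "homogeneous (int ((Suc t - s) * d + s * d)) ?f" by simp
    from homogeneous_combination[OF c this] hom_minor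
    have "?f = (\<Sum>j<Suc s. hcomp ((Suc t - s) * d) (c j) * minor F j)" by blast
    then show ?thesis
      by (intro exI[of _ "\<lambda>j. hcomp ((Suc t - s) * d) (c j)"] conjI allI homogeneous_hcomp)
  qed
  then have "\<forall>i. \<exists>c. i < Suc s \<longrightarrow> (\<forall>j. homogeneous (int ((Suc t - s) * d)) (c j)) \<and>
      (\<Sum>k<s. \<delta> k * F $$ (k, i)) = (\<Sum>j<Suc s. c j * minor F j)" by blast
  from choice[OF this] obtain c where "\<forall>i<Suc s. (\<forall>j. homogeneous (int ((Suc t - s) * d)) (c i j)) \<and>
      (\<Sum>k<s. \<delta> k * F $$ (k, i)) = (\<Sum>j<Suc s. c i j * minor F j)" by blast
  then show ?thesis by (intro exI[of _ "\<lambda>j i. c i j"])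
qed

definition H :: "nat \<Rightarrow> nat \<Rightarrow> ('v, 'k) mpoly" where
  "H = (SOME H. \<forall>i<Suc s. (\<forall>j. homogeneous (int ((Suc t - s) * d)) (H j i)) \<and>
     (\<Sum>k<s. \<delta> k * F $$ (k, i)) = (\<Sum>j<Suc s. H j i * minor F j))"

lemma H: "i < Suc s \<Longrightarrow> homogeneous (int ((Suc t - s) * d)) (H j i)"
    "i < Suc s \<Longrightarrow> (\<Sum>k<s. \<delta> k * F $$ (k, i)) = (\<Sum>j<Suc s. H j i * minor F j)"
  using someI_ex[OF ex_H] unfolding H_def by blast+

text \<open>The last lift. Pairing \<open>H\<close> applied to the minors with the minors again
  gives, after exchanging the sums, \<open>\<delta>\<close> paired with the row relations of
  \<open>F\<close>, hence 0; so this vector is a syzygy of the minors and comes from the transpose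
  of \<open>F\<close>.\<close>

lemma ex_y:
  "\<exists>y. (\<forall>k<s. homogeneous (int (t * d)) (y k)) \<and>
     (\<forall>j<Suc s. (\<Sum>i<Suc s. H j i * minor F i) = (\<Sum>k<s. F $$ (k, j) * y k))"
proof -
  define u where "u = (\<lambda>j. if j < Suc s then \<Sum>i<Suc s. H j i * minor F i else 0)"
  have "(\<Sum>j<Suc s. u j * minor F j) = (\<Sum>j<Suc s. \<Sum>i<Suc s. H j i * minor F i * minor F j)"
    by (intro sum.cong refl) (simp only: u_def lessThan_iff if_True sum_distrib_right)
  also have "\<dots> = (\<Sum>i<Suc s. \<Sum>j<Suc s. H j i * minor F i * minor F j)" by (rule sum.swap)
  also have "\<dots> = (\<Sum>i<Suc s. (\<Sum>j<Suc s. H j i * minor F j) * minor F i)"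
    by (intro sum.cong refl) (simp only: sum_distrib_left sum_distrib_right mult_ac)
  also have "\<dots> = (\<Sum>i<Suc s. (\<Sum>k<s. \<delta> k * F $$ (k, i)) * minor F i)"
    by (intro sum.cong refl) (simp only: H(2) lessThan_iff)
  also have "\<dots> = (\<Sum>i<Suc s. \<Sum>k<s. \<delta> k * (F $$ (k, i) * minor F i))"
    by (intro sum.cong refl) (simp only: sum_distrib_right mult.assoc)
  also have "\<dots> = (\<Sum>k<s. \<Sum>i<Suc s. \<delta> k * (F $$ (k, i) * minor F i))" by (rule sum.swap)
  also have "\<dots> = (\<Sum>k<s. \<delta> k * 0)"
    by (intro sum.cong refl) (simp only: sum_distrib_left[symmetric] minor_relation[OF F] lessThan_iff)
  finally have "(\<Sum>j<Suc s. u j * minor F j) = 0" by simp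
  moreover have "u \<in> Fr (Suc s)" unfolding u_def by (rule Fr_restrict)
  ultimately obtain y where y: "y \<in> Fr s" "u = mv s (Suc s) FT y"
    using kernel_minors[OF n(1), of u] n(2) by auto
  have "(\<Sum>i<Suc s. H j i * minor F i) = (\<Sum>k<s. F $$ (k, j) * hcomp (t * d) (y k))" if j: "j < Suc s" for j
  proof -
    have "(\<Sum>i<Suc s. H j i * minor F i) = (\<Sum>k<s. y k * F $$ (k, j))"
      using fun_cong[OF y(2), of j] j by (simp add: u_def mv_def mult.commute del: sum.lessThan_Suc)
    moreover have "homogeneous (int (t * d + d)) (\<Sum>i<Suc s. H j i * minor F i)"
    proof (rule homogeneous_sum)
      fix i assume i: "i \<in> {..<Suc s}"
      have "homogeneous (int ((Suc t - s) * d) + int (s * d)) (H j i * minor F i)"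
        using i by (intro homogeneous_mult H hom_minor) auto
      moreover have "int ((Suc t - s) * d) + int (s * d) = int (t * d + d)"
        by (simp add: t algebra_simps flip: of_nat_add of_nat_mult)
      ultimately show "homogeneous (int (t * d + d)) (H j i * minor F i)" by simp
    qed
    ultimately have "(\<Sum>i<Suc s. H j i * minor F i) = (\<Sum>k<s. hcomp (t * d) (y k) * F $$ (k, j))"
      using j by (intro homogeneous_combination) (auto intro!: homF)
    then show ?thesis by (simp add: mult.commute)
  qed
  then show ?thesis by (intro exI[of _ "\<lambda>k. hcomp (t * d) (y k)"]) (simp del: of_nat_mult sum.lessThan_Suc)
qed

definition y :: "nat \<Rightarrow> ('v, 'k) mpoly" where
  "y = (SOME y. (\<forall>k<s. homogeneous (int (t * d)) (y k)) \<and>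
     (\<forall>j<Suc s. (\<Sum>i<Suc s. H j i * minor F i) = (\<Sum>k<s. F $$ (k, j) * y k)))"

lemma y: "k < s \<Longrightarrow> homogeneous (int (t * d)) (y k)"
    "j < Suc s \<Longrightarrow> (\<Sum>i<Suc s. H j i * minor F i) = (\<Sum>k<s. F $$ (k, j) * y k)"
  using someI_ex[OF ex_y] unfolding y_def by blast+

text \<open>The resolution is the mapping cone of a comparison map, given by \<open>\<delta>\<close>, \<open>H\<close> and \<open>y\<close>, between
  the Hilbert-Burch complex of \<open>F\<close> and its dual.\<close>

definition m :: nat where "m = s + Suc s"

definition M1 :: "nat \<Rightarrow> nat \<Rightarrow> ('v, 'k) mpoly" where
  "M1 i j = (if j < s then \<delta> j else minor F (j - s))"

text \<open>The columns belong first to the source of \<open>F\<close>, then to that of its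
  transpose. The sign of \<open>H\<close> cancels the contribution of \<open>\<delta>\<close>
  composed with \<open>F\<close>.\<close>

definition M2 :: "nat \<Rightarrow> nat \<Rightarrow> ('v, 'k) mpoly" where
  "M2 i j = (if i < s then if j < Suc s then F $$ (i, j) else 0
             else if j < Suc s then - H (i - s) j else F $$ (j - Suc s, i - s))"

definition M3 :: "nat \<Rightarrow> nat \<Rightarrow> ('v, 'k) mpoly" where
  "M3 i j = (if i < Suc s then minor F i else y (i - Suc s))"

lemma mv_M1: "mv m 1 M1 w 0 = (\<Sum>k<s. \<delta> k * w k) + (\<Sum>j<Suc s. minor F j * w (s + j))"
  by (simp add: m_def mv_def M1_def sum_lessThan_add del: sum.lessThan_Suc add_Suc_right)

lemma mv_M2:
  "i < s \<Longrightarrow> mv m m M2 w i = (\<Sum>j<Suc s. F $$ (i, j) * w j)"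
  "j < Suc s \<Longrightarrow> mv m m M2 w (s + j) =
     (\<Sum>k<s. F $$ (k, j) * w (Suc s + k)) - (\<Sum>i<Suc s. H j i * w i)"
proof -
  have sum: "(\<Sum>l<m. g l) = (\<Sum>j<Suc s. g j) + (\<Sum>k<s. g (Suc s + k))" for g :: "nat \<Rightarrow> ('v, 'k) mpoly"
    using sum_lessThan_add[of g "Suc s" s] by (simp add: m_def add.commute)
  have sm: "i < s \<Longrightarrow> i < m" "j < Suc s \<Longrightarrow> s + j < m" for i j by (auto simp: m_def)
  show "i < s \<Longrightarrow> mv m m M2 w i = (\<Sum>j<Suc s. F $$ (i, j) * w j)"
    using sm by (simp add: mv_def M2_def sum del: sum.lessThan_Suc)
  show "j < Suc s \<Longrightarrow> mv m m M2 w (s + j) =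
     (\<Sum>k<s. F $$ (k, j) * w (Suc s + k)) - (\<Sum>i<Suc s. H j i * w i)"
    using sm by (simp add: mv_def M2_def sum sum_negf del: sum.lessThan_Suc)
qed

lemma mv_M3:
  "i < Suc s \<Longrightarrow> mv 1 m M3 w i = minor F i * w 0"
  "k < s \<Longrightarrow> mv 1 m M3 w (Suc s + k) = y k * w 0"
  by (simp_all add: mv_def M3_def m_def)

lemma image_M1: "mv m 1 M1 ` Fr m = {w \<in> Fr 1. w 0 \<in> J}"
proof
  have gen: "\<delta> k \<in> J" "j < Suc s \<Longrightarrow> minor F j \<in> J" if "k < s" for k j
    unfolding J_eq_gen using gen_ideal_superset[of "minor F ` {..<Suc s} \<union> \<delta> ` {..<s}"] that by auto
  have RJ: "ring_ideal J" by (rule graded_idealD(1)[OF graded_J])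
  have "mv m 1 M1 w 0 \<in> J" for w
    unfolding mv_M1 using gen s by (intro ring_ideal_add[OF RJ] ring_ideal_sum[OF RJ] ring_ideal_mult2[OF RJ]) auto
  then show "mv m 1 M1 ` Fr m \<subseteq> {w \<in> Fr 1. w 0 \<in> J}" using mv_Fr by blast
  have "J \<subseteq> (\<lambda>w. mv m 1 M1 w 0) ` Fr m"
  proof -
    let ?I = "(\<lambda>w. mv m 1 M1 w 0) ` Fr m"
    interpret f: Modules.module_hom smul smul "mv m 1 M1" by (rule module_hom_mv)
    have "ring_ideal ?I"
      unfolding ring_ideal_def
    proof (intro conjI ballI allI)
      show "0 \<in> ?I"
        by (rule image_eqI[of _ _ 0]) (simp_all only: f.zero zero_fun_apply fmod.subspace_0[OF subspace_Fr])
      fix a assume "a \<in> ?I"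
      then obtain v where v: "v \<in> Fr m" "a = mv m 1 M1 v 0" by blast
      show "a + b \<in> ?I" if b: "b \<in> ?I" for b
      proof -
        obtain w where w: "w \<in> Fr m" "b = mv m 1 M1 w 0" using b by blast
        show ?thesis
          by (rule image_eqI[of _ _ "v + w"]) (simp_all only: v w f.add plus_fun_apply fmod.subspace_add[OF subspace_Fr])
      qed
      show "c * a \<in> ?I" for c
        by (rule image_eqI[of _ _ "smul c v"]) (simp_all only: v f.scale smul_apply smul_Fr)
    qed
    moreover have "minor F ` {..<Suc s} \<union> \<delta> ` {..<s} \<subseteq> ?I"
    proof
      fix f assume "f \<in> minor F ` {..<Suc s} \<union> \<delta> ` {..<s}"
      then consider j where "j < Suc s" "f = minor F j" | k where "k < s" "f = \<delta> k" by blast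
      then show "f \<in> ?I"
      proof cases
        case (1 j)
        define w where "w = (\<lambda>i. if i = s + j then (1 :: ('v, 'k) mpoly) else 0)"
        have "(\<Sum>j<Suc s. minor F j * w (s + j)) = (\<Sum>j'<Suc s. if j' = j then minor F j' else 0)"
          by (intro sum.cong) (auto simp: w_def)
        moreover have "(\<Sum>k<s. \<delta> k * w k) = 0" by (intro sum.neutral) (auto simp: w_def)
        ultimately have "f = mv m 1 M1 w 0" unfolding mv_M1 using 1 by (simp del: sum.lessThan_Suc)
        moreover have "w \<in> Fr m" using 1 by (simp add: Fr_def w_def m_def)
        ultimately show ?thesis by (rule image_eqI)
      next
        case (2 k)
        define w where "w = (\<lambda>i. if i = k then (1 :: ('v, 'k) mpoly) else 0)"
        have "(\<Sum>k<s. \<delta> k * w k) = (\<Sum>k'<s. if k' = k then \<delta> k' else 0)"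
          by (intro sum.cong) (auto simp: w_def)
        moreover have "(\<Sum>j<Suc s. minor F j * w (s + j)) = 0"
          using 2 by (intro sum.neutral) (auto simp: w_def)
        ultimately have "f = mv m 1 M1 w 0" unfolding mv_M1 using 2 by (simp del: sum.lessThan_Suc)
        moreover have "w \<in> Fr m" using 2 by (simp add: Fr_def w_def m_def)
        ultimately show ?thesis by (rule image_eqI)
      qed
    qed
    ultimately show ?thesis unfolding J_eq_gen by (rule gen_ideal_minimal)
  qed
  show "{w \<in> Fr 1. w 0 \<in> J} \<subseteq> mv m 1 M1 ` Fr m"
  proof
    fix w assume w: "w \<in> {w \<in> Fr 1. w 0 \<in> J}"
    then obtain v where v: "v \<in> Fr m" "w 0 = mv m 1 M1 v 0"
      using \<open>J \<subseteq> (\<lambda>w. mv m 1 M1 w 0) ` Fr m\<close> by blast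
    have "w = mv m 1 M1 v"
      by (rule Fr_eqI[of _ 1]) (use w v(2) mv_Fr in auto)
    with v(1) show "w \<in> mv m 1 M1 ` Fr m" by blast
  qed
qed

text \<open>The first block of a syzygy has \<open>\<delta>\<close>-value in \<open>IF\<close>, so
  it is \<open>F x\<close> by \<open>\<delta>_injective\<close>. Correcting the second block by
  \<open>H x\<close> leaves a syzygy of the minors alone, which \<open>kernel_minors\<close> puts in
  the image of the transpose.\<close>

lemma kernel_M1: "{w \<in> Fr m. mv m 1 M1 w = 0} = mv m m M2 ` Fr m"
proof
  show "{w \<in> Fr m. mv m 1 M1 w = 0} \<subseteq> mv m m M2 ` Fr m"
  proof
    fix w assume "w \<in> {w \<in> Fr m. mv m 1 M1 w = 0}"
    then have w: "w \<in> Fr m" "(\<Sum>k<s. \<delta> k * w k) + (\<Sum>j<Suc s. minor F j * w (s + j)) = 0"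
      using mv_M1[of w] by (auto simp del: sum.lessThan_Suc)
    define a where "a = (\<lambda>k. if k < s then w k else 0)"
    have "(\<Sum>k<s. \<delta> k * a k) = (\<Sum>k<s. \<delta> k * w k)" by (simp add: a_def)
    also have "\<dots> = - (\<Sum>j<Suc s. minor F j * w (s + j))" using w(2) by (simp only: eq_neg_iff_add_eq_0)
    also have "\<dots> \<in> IF"
      by (intro ring_ideal_minus ring_ideal_sum ring_ideal_mult2 ring_ideal_gen)
        (use gen_ideal_superset[of "minor F ` {..<Suc s}"] in auto)
    finally obtain x where x: "x \<in> Fr (Suc s)" "a = mv (Suc s) s FM x"
      using \<delta>_injective[of a] Fr_restrict[of s w] unfolding a_def by blast
    have ax: "w k = (\<Sum>j<Suc s. F $$ (k, j) * x j)" if "k < s" for k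
      using fun_cong[OF x(2), of k] that by (simp add: a_def mv_def del: sum.lessThan_Suc)
    \<comment> \<open>\<open>M2\<close> contributes \<open>- H x\<close> to this block, so the part
      due to the transpose of \<open>F\<close> is obtained by adding \<open>H x\<close>.\<close>
    define b where "b = (\<lambda>j. if j < Suc s then w (s + j) + (\<Sum>i<Suc s. H j i * x i) else 0)"
    have "(\<Sum>j<Suc s. b j * minor F j) =
        (\<Sum>j<Suc s. minor F j * w (s + j)) + (\<Sum>j<Suc s. \<Sum>i<Suc s. H j i * x i * minor F j)"
      by (simp add: b_def distrib_left distrib_right sum.distrib sum_distrib_left sum_distrib_right mult_ac
        del: sum.lessThan_Suc)
    also have "(\<Sum>j<Suc s. \<Sum>i<Suc s. H j i * x i * minor F j) = (\<Sum>i<Suc s. \<Sum>j<Suc s. H j i * x i * minor F j)"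
      by (rule sum.swap)
    also have "\<dots> = (\<Sum>i<Suc s. (\<Sum>j<Suc s. H j i * minor F j) * x i)"
      by (intro sum.cong refl) (simp only: sum_distrib_left sum_distrib_right mult_ac)
    also have "\<dots> = (\<Sum>i<Suc s. (\<Sum>k<s. \<delta> k * F $$ (k, i)) * x i)"
      by (intro sum.cong refl) (simp only: H(2) lessThan_iff)
    also have "\<dots> = (\<Sum>i<Suc s. \<Sum>k<s. \<delta> k * (F $$ (k, i) * x i))"
      by (intro sum.cong refl) (simp only: sum_distrib_right mult.assoc)
    also have "\<dots> = (\<Sum>k<s. \<Sum>i<Suc s. \<delta> k * (F $$ (k, i) * x i))" by (rule sum.swap)
    also have "\<dots> = (\<Sum>k<s. \<delta> k * w k)"
      by (intro sum.cong refl) (simp only: sum_distrib_left[symmetric] ax lessThan_iff)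
    finally have "(\<Sum>j<Suc s. b j * minor F j) = 0" using w(2) by (simp add: add.commute del: sum.lessThan_Suc)
    moreover have "b \<in> Fr (Suc s)" unfolding b_def by (rule Fr_restrict)
    ultimately obtain z where z: "z \<in> Fr s" "b = mv s (Suc s) FT z"
      using kernel_minors[OF n(1), of b] n(2) by auto
    define v where "v = (\<lambda>i. if i < Suc s then x i else z (i - Suc s))"
    have "v \<in> Fr m" using z(1) by (simp add: v_def Fr_def m_def)
    moreover have "w = mv m m M2 v"
    proof (rule Fr_eqI[OF w(1) mv_Fr])
      fix i assume i: "i < m"
      show "w i = mv m m M2 v i"
      proof (cases "i < s")
        case True
        then show ?thesis by (simp add: mv_M2 ax v_def del: sum.lessThan_Suc)
      next
        case False
        define j where "j = i - s"
        have j: "i = s + j" "j < Suc s" using False i by (auto simp: j_def m_def)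
        have "b j = (\<Sum>k<s. F $$ (k, j) * z k)" using j(2) by (simp add: z(2) mv_def)
        then show ?thesis
          using j(2) unfolding j(1) mv_M2(2)[OF j(2)]
          by (simp add: b_def v_def algebra_simps del: sum.lessThan_Suc)
      qed
    qed
    ultimately show "w \<in> mv m m M2 ` Fr m" by blast
  qed
  show "mv m m M2 ` Fr m \<subseteq> {w \<in> Fr m. mv m 1 M1 w = 0}"
  proof (rule image_subsetI)
    fix v :: "nat \<Rightarrow> ('v, 'k) mpoly"
    let ?x = "\<lambda>i. v i" and ?z = "\<lambda>k. v (Suc s + k)"
    have "(\<Sum>k<s. \<delta> k * mv m m M2 v k) = (\<Sum>k<s. \<Sum>i<Suc s. \<delta> k * F $$ (k, i) * v i)"
      by (intro sum.cong refl) (simp only: mv_M2 lessThan_iff sum_distrib_left mult.assoc)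
    also have "\<dots> = (\<Sum>i<Suc s. \<Sum>k<s. \<delta> k * F $$ (k, i) * v i)" by (rule sum.swap)
    also have "\<dots> = (\<Sum>i<Suc s. (\<Sum>j<Suc s. H j i * minor F j) * v i)"
      by (intro sum.cong refl) (simp only: sum_distrib_right[symmetric] H(2) lessThan_iff)
    finally have 1: "(\<Sum>k<s. \<delta> k * mv m m M2 v k) = (\<Sum>i<Suc s. (\<Sum>j<Suc s. H j i * minor F j) * v i)" .
    have "(\<Sum>j<Suc s. minor F j * (\<Sum>i<Suc s. H j i * v i)) = (\<Sum>j<Suc s. \<Sum>i<Suc s. H j i * minor F j * v i)"
      by (intro sum.cong refl) (simp only: sum_distrib_left mult_ac)
    also have "\<dots> = (\<Sum>i<Suc s. \<Sum>j<Suc s. H j i * minor F j * v i)" by (rule sum.swap)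
    also have "\<dots> = (\<Sum>k<s. \<delta> k * mv m m M2 v k)" unfolding 1 by (simp only: sum_distrib_right)
    finally have 2: "(\<Sum>j<Suc s. minor F j * (\<Sum>i<Suc s. H j i * v i)) = (\<Sum>k<s. \<delta> k * mv m m M2 v k)" .
    have "(\<Sum>j<Suc s. minor F j * (\<Sum>k<s. F $$ (k, j) * ?z k)) = (\<Sum>j<Suc s. \<Sum>k<s. F $$ (k, j) * minor F j * ?z k)"
      by (intro sum.cong refl) (simp only: sum_distrib_left mult_ac)
    also have "\<dots> = (\<Sum>k<s. \<Sum>j<Suc s. F $$ (k, j) * minor F j * ?z k)" by (rule sum.swap)
    also have "\<dots> = (\<Sum>k<s. 0 * ?z k)"
      by (intro sum.cong refl) (simp only: sum_distrib_right[symmetric] minor_relation[OF F] lessThan_iff)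
    finally have 3: "(\<Sum>j<Suc s. minor F j * (\<Sum>k<s. F $$ (k, j) * ?z k)) = 0" by simp
    have "(\<Sum>j<Suc s. minor F j * mv m m M2 v (s + j)) =
        (\<Sum>j<Suc s. minor F j * (\<Sum>k<s. F $$ (k, j) * ?z k) - minor F j * (\<Sum>i<Suc s. H j i * v i))"
      by (intro sum.cong refl) (simp only: mv_M2 lessThan_iff right_diff_distrib)
    also have "\<dots> = - (\<Sum>k<s. \<delta> k * mv m m M2 v k)"
      unfolding sum_subtractf 2 3 by simp
    finally have "mv m 1 M1 (mv m m M2 v) 0 = 0" unfolding mv_M1 by simp
    then have "mv m 1 M1 (mv m m M2 v) = 0" by (intro Fr_eqI[OF mv_Fr fmod.subspace_0[OF subspace_Fr]]) simp
    then show "mv m m M2 v \<in> {w \<in> Fr m. mv m 1 M1 w = 0}" using mv_Fr by blast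
  qed
qed

text \<open>The first block lies in the kernel of \<open>F\<close>, hence is \<open>c\<close> times
  the vector of minors. After subtraction of \<open>c y\<close> the second block is killed by the
  transpose of \<open>F\<close>, which is injective.\<close>

lemma kernel_M2: "{w \<in> Fr m. mv m m M2 w = 0} = mv 1 m M3 ` Fr 1"
proof
  show "{w \<in> Fr m. mv m m M2 w = 0} \<subseteq> mv 1 m M3 ` Fr 1"
  proof
    fix w assume "w \<in> {w \<in> Fr m. mv m m M2 w = 0}"
    then have w: "w \<in> Fr m" "\<And>i. mv m m M2 w i = 0" by auto
    define x where "x = (\<lambda>j. if j < Suc s then w j else 0)"
    have x: "x \<in> Fr (Suc s)" unfolding x_def by (rule Fr_restrict)
    have "mv (Suc s) s FM x = 0"
    proof (rule Fr_eqI[OF mv_Fr fmod.subspace_0[OF subspace_Fr]])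
      fix i assume i: "i < s"
      have "mv (Suc s) s FM x i = (\<Sum>j<Suc s. F $$ (i, j) * w j)"
        using i by (simp add: mv_def x_def del: sum.lessThan_Suc)
      then show "mv (Suc s) s FM x i = 0 i" using w(2)[of i] i by (simp add: mv_M2 del: sum.lessThan_Suc)
    qed
    then have "x \<in> mv 1 (Suc s) DM ` Fr 1" using kernel_FM[OF n(1)] n(2) x by auto
    then obtain c where c: "c \<in> Fr 1" "x = mv 1 (Suc s) DM c" by blast
    have wc: "w j = minor F j * c 0" if "j < Suc s" for j
      using fun_cong[OF c(2), of j] that by (simp add: x_def mv_def)
    define z where "z = (\<lambda>k. if k < s then w (Suc s + k) - y k * c 0 else 0)"
    have "mv s (Suc s) FT z = 0"
    proof (rule Fr_eqI[OF mv_Fr fmod.subspace_0[OF subspace_Fr]])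
      fix j assume j: "j < Suc s"
      have "(\<Sum>i<Suc s. H j i * w i) = (\<Sum>i<Suc s. H j i * minor F i) * c 0"
        unfolding sum_distrib_right by (intro sum.cong refl) (simp only: wc lessThan_iff mult.assoc)
      also have "\<dots> = (\<Sum>k<s. F $$ (k, j) * (y k * c 0))"
        unfolding y(2)[OF j] by (simp only: sum_distrib_right mult.assoc)
      finally have "(\<Sum>i<Suc s. H j i * w i) = (\<Sum>k<s. F $$ (k, j) * (y k * c 0))" .
      moreover have "(\<Sum>k<s. F $$ (k, j) * w (Suc s + k)) = (\<Sum>i<Suc s. H j i * w i)"
        using w(2)[of "s + j"] unfolding mv_M2(2)[OF j] by simp
      moreover have "mv s (Suc s) FT z j = (\<Sum>k<s. F $$ (k, j) * w (Suc s + k)) - (\<Sum>k<s. F $$ (k, j) * (y k * c 0))"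
        using j by (simp add: mv_def z_def right_diff_distrib sum_subtractf)
      ultimately show "mv s (Suc s) FT z j = 0 j" by simp
    qed
    moreover have "z \<in> Fr s" unfolding z_def by (rule Fr_restrict)
    ultimately have "z = 0" using FT_injective by blast
    then have z0: "w (Suc s + k) = y k * c 0" if "k < s" for k
    proof -
      have "z k = 0" using \<open>z = 0\<close> by simp
      then show ?thesis using that by (simp add: z_def)
    qed
    have "w = mv 1 m M3 c"
    proof (rule Fr_eqI[OF w(1) mv_Fr])
      fix i assume i: "i < m"
      show "w i = mv 1 m M3 c i"
      proof (cases "i < Suc s")
        case True
        then show ?thesis by (simp only: mv_M3 wc)
      next
        case False
        then have "i = Suc s + (i - Suc s)" "i - Suc s < s" using i by (auto simp: m_def)
        then show ?thesis using mv_M3(2) z0 by metis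
      qed
    qed
    with c(1) show "w \<in> mv 1 m M3 ` Fr 1" by blast
  qed
  show "mv 1 m M3 ` Fr 1 \<subseteq> {w \<in> Fr m. mv m m M2 w = 0}"
  proof (rule image_subsetI)
    fix c :: "nat \<Rightarrow> ('v, 'k) mpoly"
    have "mv m m M2 (mv 1 m M3 c) = 0"
    proof (rule Fr_eqI[OF mv_Fr fmod.subspace_0[OF subspace_Fr]])
      fix i assume i: "i < m"
      show "mv m m M2 (mv 1 m M3 c) i = 0 i"
      proof (cases "i < s")
        case True
        have "mv m m M2 (mv 1 m M3 c) i = (\<Sum>j<Suc s. F $$ (i, j) * minor F j * c 0)"
          unfolding mv_M2(1)[OF True] by (intro sum.cong refl) (simp only: mv_M3 lessThan_iff mult.assoc)
        also have "\<dots> = 0" by (simp only: sum_distrib_right[symmetric] minor_relation[OF F True] mult_zero_left)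
        finally show ?thesis by simp
      next
        case False
        define j where "j = i - s"
        have j: "i = s + j" "j < Suc s" using False i by (auto simp: j_def m_def)
        have "(\<Sum>k<s. F $$ (k, j) * mv 1 m M3 c (Suc s + k)) = (\<Sum>k<s. F $$ (k, j) * y k * c 0)"
          by (intro sum.cong refl) (simp only: mv_M3 lessThan_iff mult.assoc)
        moreover have "(\<Sum>i<Suc s. H j i * mv 1 m M3 c i) = (\<Sum>i<Suc s. H j i * minor F i * c 0)"
          by (intro sum.cong refl) (simp only: mv_M3 lessThan_iff mult.assoc)
        ultimately show ?thesis
          unfolding j(1) mv_M2(2)[OF j(2)] by (simp only: sum_distrib_right[symmetric] y(2)[OF j(2)]) simp
      qed
    qed
    then show "mv 1 m M3 c \<in> {w \<in> Fr m. mv m m M2 w = 0}" using mv_Fr by blast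
  qed
qed

lemma kernel_M3: "{w \<in> Fr 1. mv 1 m M3 w = 0} = {0}"
proof -
  have "w = 0" if w: "w \<in> Fr 1" "mv 1 m M3 w = 0" for w
  proof -
    have "mv 1 (Suc s) DM w = 0"
    proof (rule Fr_eqI[OF mv_Fr fmod.subspace_0[OF subspace_Fr]])
      fix j assume j: "j < Suc s"
      have "mv 1 (Suc s) DM w j = mv 1 m M3 w j"
        using j by (simp add: mv_M3[unfolded One_nat_def]) (simp add: mv_def)
      then show "mv 1 (Suc s) DM w j = 0 j" using w(2) by simp
    qed
    then show ?thesis using DM_injective w(1) by blast
  qed
  then show ?thesis by (auto simp: Fr_def mv_def fun_eq_iff)
qed

text \<open>Three maps of the resolution reduce the range \<open>n + 1\<close> to
  \<open>n - 2\<close>.\<close>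

lemma kvanish_J: "fmod.kvanish vars (n - 2) (Fr 1) {w \<in> Fr 1. w 0 \<in> J}"
proof -
  have "fmod.kvanish vars n (Fr m) {w \<in> Fr m. mv m m M2 w = 0}"
    unfolding kernel_M2 using n by (intro kvanish_mv_injective[OF kernel_M3]) auto
  then have "fmod.kvanish vars (n - 1) (Fr m) {w \<in> Fr m. mv m 1 M1 w = 0}"
    unfolding kernel_M1 using n by (intro kvanish_mv_quotient) auto
  then show ?thesis
    unfolding image_M1[symmetric] using n by (intro kvanish_mv_quotient) (auto simp: Suc_diff_Suc numeral_2_eq_2)
qed

end

section \<open>Subschemes of large depth\<close>

lemma ring_ideal_saturation_superset: "ring_ideal I \<Longrightarrow> I \<subseteq> saturation I"
  by (auto simp: saturation_def intro: ring_ideal_mult)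

text \<open>An element killed modulo \<open>I\<close> by all variables is in \<open>I\<close> by
  vanishing in degree 0. Otherwise \<open>Var j * f\<close> satisfies the hypothesis with the
  exponent of \<open>Var j\<close> lowered by one, so induction on the sum of the exponents
  applies.\<close>

lemma saturation_eq:
  fixes I :: "('v::finite, 'k::comm_ring_1) mpoly set"
  assumes I: "graded_ideal I" and K: "fmod.kvanish vars (Suc q) (Fr 1) {w \<in> Fr 1. w 0 \<in> I}"
  shows "saturation I = I"
proof
  note R = graded_idealD(1)[OF I]
  have ann: "f \<in> I" if "\<And>i. Var i * f \<in> I" for f
  proof -
    define w where "w = (\<lambda>j::nat. if j < 1 then f else 0)"
    have "w \<in> Fr 1" unfolding w_def by (rule Fr_restrict)
    moreover have "smul x w \<in> {w \<in> Fr 1. w 0 \<in> I}" if "x \<in> set vars" for x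
      using that \<open>\<And>i. Var i * f \<in> I\<close> smul_Fr[OF \<open>w \<in> Fr 1\<close>] by (auto simp: set_vars smul_apply w_def)
    ultimately have "w \<in> {w \<in> Fr 1. w 0 \<in> I}"
      by (rule fmod.kvanish_annihilated[OF graded_subD(1)[OF graded_sub_ideal[OF I]] K])
    then show ?thesis by (simp add: w_def)
  qed
  have "f \<in> I" if "\<And>i. Var i ^ e i * f \<in> I" for e f
    using that
  proof (induction "sum e UNIV" arbitrary: e f rule: less_induct)
    case less
    show ?case
    proof (cases "\<exists>j. e j = 0")
      case True
      then show ?thesis using less.prems by (metis mult_1 power_0)
    next
      case False
      show ?thesis
      proof (rule ann)
        fix j
        obtain k where k: "e j = Suc k" using False by (metis not0_implies_Suc)
        define e' where "e' = e(j := k)"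
        have "sum e' UNIV = k + sum e (UNIV - {j})"
          by (simp add: e'_def sum.remove[of UNIV j])
        moreover have "sum e UNIV = Suc k + sum e (UNIV - {j})"
          by (simp add: sum.remove[of UNIV j e] k)
        ultimately have "sum e' UNIV < sum e UNIV" by simp
        moreover have "Var i ^ e' i * (Var j * f) \<in> I" for i
        proof (cases "i = j")
          case True
          have "Var j ^ k * (Var j * f) = Var j ^ e j * f" by (simp add: k mult_ac)
          then show ?thesis using less.prems[of j] True by (simp add: e'_def)
        next
          case False
          have "Var i ^ e i * (Var j * f) = Var j * (Var i ^ e i * f)" by (simp add: mult_ac)
          also have "\<dots> \<in> I" by (rule ring_ideal_mult[OF R less.prems])
          finally show ?thesis using False by (simp add: e'_def)
        qed
        ultimately show "Var j * f \<in> I" by (rule less.hyps)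
      qed
    qed
  qed
  then have mem: "f \<in> I" if "\<forall>i. \<exists>k. Var i ^ k * f \<in> I" for f using choice[OF that] by blast
  then show "saturation I \<subseteq> I" by (auto simp: saturation_def)
  show "I \<subseteq> saturation I" by (rule ring_ideal_saturation_superset[OF R])
qed

text \<open>The class of 1 has annihilator \<open>I\<close>, so an associated prime lies between
  \<open>I\<close> and \<open>P\<close>.\<close>

lemma ex_associated_prime_of_ideal:
  fixes I :: "('v::finite, 'k::field_char_0) mpoly set"
  assumes I: "graded_ideal I" and K: "fmod.kvanish vars (Suc q) (Fr 1) {w \<in> Fr 1. w 0 \<in> I}"
    and P: "graded_ideal P" "prime_ideal P" "I \<subseteq> P"
  shows "\<exists>Q\<in>points_of I. Q \<subseteq> P \<and> enat q \<le> chain_length {Q' \<in> proj_points. Q \<subseteq> Q'} \<and>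
    chain_length {Q' \<in> proj_points. Q' \<subseteq> Q} \<le> enat (CARD('v) - Suc q)"
proof -
  define w where "w = (\<lambda>j::nat. if j < 1 then (1 :: ('v, 'k) mpoly) else 0)"
  let ?N = "{w \<in> Fr 1. w 0 \<in> I}"
  have w: "w \<in> Fr 1" unfolding w_def by (rule Fr_restrict)
  have h: "hvec 0 w" by (simp add: hvec_def w_def)
  have c: "colon ?N w = I" using smul_Fr[OF w] by (auto simp: colon_def smul_apply w_def)
  obtain e' w' where w': "w' \<in> Fr 1" "hvec e' w'" "prime_ideal (colon ?N w')"
      "colon ?N w \<subseteq> colon ?N w'" "colon ?N w' \<subseteq> P"
    by (rule associated_prime_between[OF graded_sub_ideal[OF I] P(1,2) w h]) (use c P(3) in auto)
  note Q = chain_below_associated_prime[OF graded_sub_ideal[OF I] K w'(1-3)]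
  show ?thesis
    using Q w'(4,5) c by (intro bexI[of _ "colon ?N w'"]) (auto simp: points_of_def)
qed

text \<open>A component equals the associated prime below it, so at least \<open>q\<close> steps
  lead upwards from it; the \<open>c\<close> steps downwards at every point allow no more. The
  codimension is attained at an associated prime below \<open>Irr\<close>.\<close>

theorem is_subscheme_if_kvanish:
  fixes I :: "('v::finite, 'k::field_char_0) mpoly set"
  assumes I: "graded_ideal I" "1 \<notin> I" and K: "fmod.kvanish vars (Suc q) (Fr 1) {w \<in> Fr 1. w 0 \<in> I}"
    and c: "enat c \<le> codimension I" "Suc (q + c) = CARD('v)"
  shows "is_subscheme I" "codimension I = enat c"
proof -
  have above: "chain_length {Q \<in> proj_points. P \<subseteq> Q} \<le> enat q" if P: "P \<in> points_of I" for P
  proof (rule chain_length_leI)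
    fix Ps assume Ps: "set Ps \<subseteq> {Q \<in> proj_points. P \<subseteq> Q}" "sorted_wrt (\<subset>) Ps"
    have "codimension I \<le> chain_length {Q \<in> proj_points. Q \<subseteq> P}"
      unfolding codimension_def using P by (rule INF_lower)
    with c(1) have "enat c \<le> chain_length {Q \<in> proj_points. Q \<subseteq> P}" by (rule order_trans)
    moreover have "{Q \<in> proj_points. Q \<subseteq> P} \<noteq> {}" using P by (auto simp: points_of_def)
    ultimately obtain Qs where Qs: "set Qs \<subseteq> {Q \<in> proj_points. Q \<subseteq> P}" "sorted_wrt (\<subset>) Qs" "length Qs = Suc c"
      by (rule chain_length_geD)
    from chain_through_point[OF Qs(1,2) Ps] Qs(3) c(2) show "length Ps \<le> Suc q" by simp
  qed
  have "chain_length {Q \<in> proj_points. P \<subseteq> Q} = enat q" if "P \<in> components I" for P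
  proof (rule antisym)
    have P: "P \<in> points_of I" "\<And>Q. Q \<in> points_of I \<Longrightarrow> Q \<subseteq> P \<Longrightarrow> Q = P"
      using that by (auto simp: components_def)
    show "chain_length {Q \<in> proj_points. P \<subseteq> Q} \<le> enat q" by (rule above[OF P(1)])
    have "graded_ideal P" "prime_ideal P" "I \<subseteq> P" using P(1) by (auto simp: points_of_def proj_points_iff)
    from ex_associated_prime_of_ideal[OF I(1) K this] P(2)
    show "enat q \<le> chain_length {Q \<in> proj_points. P \<subseteq> Q}" by blast
  qed
  then have "equidimensional I" unfolding equidimensional_def by blast
  then show "is_subscheme I"
    using saturation_eq[OF I(1) K] I(1) by (simp add: is_subscheme_def homogeneous_ideal_iff)
  obtain P where P: "P \<in> points_of I" "chain_length {Q \<in> proj_points. Q \<subseteq> P} \<le> enat (CARD('v) - Suc q)"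
    using ex_associated_prime_of_ideal[OF I(1) K graded_ideal_Irr prime_ideal_Irr graded_ideal_le_Irr[OF I]] by blast
  have "codimension I \<le> chain_length {Q \<in> proj_points. Q \<subseteq> P}"
    unfolding codimension_def using P(1) by (rule INF_lower)
  also have "\<dots> \<le> enat c"
  proof -
    have "CARD('v) - Suc q = c" using c(2) by simp
    with P(2) show ?thesis by simp
  qed
  finally show "codimension I = enat c" using c(1) by (rule antisym)
qed

text \<open>A point of \<open>J\<close> is not generic on one of \<open>X\<close> and
  \<open>Y\<close>, so it properly contains a point \<open>Q\<close> of that scheme, and it extends
  every chain ending below \<open>Q\<close>.\<close>

lemma codimension_intersection:
  fixes X Y J :: "('v::finite, 'k::comm_ring_1) mpoly set"
  assumes X: "enat c \<le> codimension X" and Y: "enat c \<le> codimension Y"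
    and disj: "components X \<inter> components Y = {}" and J: "X \<subseteq> J" "Y \<subseteq> J"
  shows "enat (Suc c) \<le> codimension J"
  unfolding codimension_def
proof (rule INF_greatest)
  fix P assume P: "P \<in> points_of J"
  have PX: "P \<in> points_of X" "P \<in> points_of Y" using P J by (auto simp: points_of_def)
  have "\<exists>Q\<in>proj_points. Q \<subset> P \<and> enat c \<le> chain_length {Q' \<in> proj_points. Q' \<subseteq> Q}"
  proof -
    have "\<exists>Q\<in>points_of Z. Q \<subset> P" if "P \<in> points_of Z" "P \<notin> components Z" for Z
      using that by (auto simp: components_def)
    moreover have "P \<notin> components X \<or> P \<notin> components Y" using disj by blast
    ultimately obtain Z Q where Z: "enat c \<le> codimension Z" "Q \<in> points_of Z" "Q \<subset> P"
      using PX X Y by blast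
    have "codimension Z \<le> chain_length {Q' \<in> proj_points. Q' \<subseteq> Q}"
      unfolding codimension_def using Z(2) by (rule INF_lower)
    with Z(1) have "enat c \<le> chain_length {Q' \<in> proj_points. Q' \<subseteq> Q}" by (rule order_trans)
    moreover have "Q \<in> proj_points" using Z(2) by (simp add: points_of_def)
    ultimately show ?thesis using Z(3) by blast
  qed
  then obtain Q where Q: "Q \<in> proj_points" "Q \<subset> P" "enat c \<le> chain_length {Q' \<in> proj_points. Q' \<subseteq> Q}" by blast
  have ne: "{Q' \<in> proj_points. Q' \<subseteq> Q} \<noteq> {}" using Q(1) by blast
  obtain Qs where Qs: "set Qs \<subseteq> {Q' \<in> proj_points. Q' \<subseteq> Q}" "sorted_wrt (\<subset>) Qs" "length Qs = Suc c"
    using chain_length_geD[OF Q(3) ne] by blast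
  show "enat (Suc c) \<le> chain_length {Q \<in> proj_points. Q \<subseteq> P}"
  proof (rule chain_length_geI)
    show "set (Qs @ [P]) \<subseteq> {Q \<in> proj_points. Q \<subseteq> P}"
      using Qs(1) Q(2) P by (auto simp: points_of_def)
    show "sorted_wrt (\<subset>) (Qs @ [P])" using Qs(1,2) Q(2) by (auto simp: sorted_wrt_append)
  qed (use Qs(3) in auto)
qed

section \<open>Free resolutions\<close>

text \<open>\<open>vec a\<close> is a bijection from \<open>Fr a\<close> to the vectors of dimension
  \<open>a\<close>; through it the kernels and images computed for functions become those of
  \<open>mat_kernel\<close> and \<open>mat_image\<close>.\<close>

lemma mult_mat_vec_mv:
  "mat b a (\<lambda>(i, j). M i j) *\<^sub>v vec a w = vec b (mv a b M w)"
  by (rule eq_vecI) (auto simp: scalar_prod_def mv_def atLeast0LessThan)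

lemma vec_Fr_bij: "v \<in> carrier_vec a \<Longrightarrow> \<exists>w\<in>Fr a. v = vec a w"
  by (rule bexI[of _ "\<lambda>j. if j < a then v $ j else 0"]) (auto simp: Fr_def)

lemma vec_eq_iff_Fr: "v \<in> Fr a \<Longrightarrow> w \<in> Fr a \<Longrightarrow> vec a v = vec a w \<longleftrightarrow> v = w"
proof
  assume "v \<in> Fr a" "w \<in> Fr a" "vec a v = vec a w"
  then show "v = w" by (intro Fr_eqI[of v a w]) (metis index_vec)+
qed simp

lemma mat_image_mv: "mat_image (mat b a (\<lambda>(i, j). M i j)) = vec b ` mv a b M ` Fr a"
proof -
  have "carrier_vec a = vec a ` (Fr a :: (nat \<Rightarrow> 'a) set)" using vec_Fr_bij by auto
  then show ?thesis by (simp add: mat_image_def image_image mult_mat_vec_mv)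
qed

lemma mat_kernel_mv: "mat_kernel (mat b a (\<lambda>(i, j). M i j)) = vec a ` {w \<in> Fr a. mv a b M w = 0}"
proof -
  have 0: "vec b (mv a b M w) = 0\<^sub>v b \<longleftrightarrow> mv a b M w = 0" for w
    using vec_eq_iff_Fr[OF mv_Fr[of a b M w] fmod.subspace_0[OF subspace_Fr]]
    by (simp add: zero_vec_def zero_fun_def)
  have "mat_kernel (mat b a (\<lambda>(i, j). M i j)) = {v \<in> vec a ` Fr a. mat b a (\<lambda>(i, j). M i j) *\<^sub>v v = 0\<^sub>v b}"
    using vec_Fr_bij by (auto simp: mat_kernel_def)
  also have "\<dots> = vec a ` {w \<in> Fr a. mat b a (\<lambda>(i, j). M i j) *\<^sub>v vec a w = 0\<^sub>v b}" by blast
  finally show ?thesis by (simp only: mult_mat_vec_mv 0)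
qed

section \<open>Codimension and minimal free resolution of \<open>J\<close>\<close>

context determinantal_pair
begin

lemma one_notin_J: "1 \<notin> J"
proof -
  have "minor F ` {..<Suc s} \<union> \<delta> ` {..<s} \<subseteq> Irr"
  proof
    fix f assume "f \<in> minor F ` {..<Suc s} \<union> \<delta> ` {..<s}"
    then have "homogeneous (int (s * d)) f \<or> homogeneous (int (t * d)) f"
      using hom_minor hom_\<delta> by blast
    moreover have "s * d \<noteq> 0" "t * d \<noteq> 0" using s d by (auto simp: t)
    ultimately show "f \<in> Irr" by (auto simp: homogeneous_iff Irr_def dest!: spec[of _ 0] simp del: of_nat_mult)
  qed
  then have "J \<subseteq> Irr" unfolding J_eq_gen by (rule gen_ideal_minimal[OF graded_idealD(1)[OF graded_ideal_Irr]])
  then show ?thesis by (auto simp: Irr_def lookup_one)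
qed

theorem is_subscheme_J: "is_subscheme J" and codimension_J: "codimension J = enat 3"
proof -
  have "Suc (n - 3) = n - 2" using n(2) by simp
  then have K: "fmod.kvanish vars (Suc (n - 3)) (Fr 1) {w \<in> Fr 1. w 0 \<in> J}" using kvanish_J by simp
  have "enat 3 \<le> codimension J" using ileI1[OF codim_J] by (simp add: eSuc_enat numeral_3_eq_3)
  from is_subscheme_if_kvanish[OF graded_J one_notin_J K this] n
  show "is_subscheme J" "codimension J = enat 3" by auto
qed

definition shifts1 :: "int list" where
  "shifts1 = replicate s (int (t * d)) @ replicate (Suc s) (int (d * s))"

definition shifts2 :: "int list" where
  "shifts2 = replicate (Suc s) (int (d * Suc t)) @ replicate s (int (d * Suc s))"

text \<open>The twist \<open>d (t + 1)\<close> plus the degree \<open>s d\<close> of the minors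
  equals \<open>d (s + 1)\<close> plus the degree \<open>t d\<close> of \<open>y\<close>, so both
  blocks of \<open>M3\<close> agree.\<close>

definition shifts3 :: "int list" where
  "shifts3 = [int (d * (t + s + 1))]"

lemma nth_shifts1: "q < m \<Longrightarrow> shifts1 ! q = (if q < s then int (t * d) else int (d * s))"
  by (auto simp: shifts1_def nth_append m_def simp del: of_nat_mult replicate_Suc)

lemma nth_shifts2: "q < m \<Longrightarrow> shifts2 ! q = (if q < Suc s then int (d * Suc t) else int (d * Suc s))"
  by (auto simp: shifts2_def nth_append m_def simp del: of_nat_mult mult_Suc_right replicate_Suc)

lemma hom_M1: "q < m \<Longrightarrow> homogeneous (shifts1 ! q) (M1 p q)"
  using hom_\<delta>[of q] hom_minor[of "q - s"]
  by (auto simp: M1_def nth_shifts1 m_def mult.commute)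

lemma hom_M2:
  assumes "p < m" "q < m"
  shows "homogeneous (shifts2 ! q - shifts1 ! p) (M2 p q)"
proof -
  have e1: "int (d * Suc t) - int (t * d) = int d" "int (d * Suc s) - int (d * s) = int d"
    by (simp_all add: algebra_simps)
  have "(Suc t - s) * d + d * s = d * Suc t"
    by (simp add: t algebra_simps)
  then have e2: "int (d * Suc t) - int (d * s) = int ((Suc t - s) * d)"
    by (metis add_diff_cancel_right' of_nat_add)
  note q = nth_shifts2[OF assms(2)] and p = nth_shifts1[OF assms(1)]
  show ?thesis
  proof (cases "q < Suc s")
    case True
    then show ?thesis
      using assms H(1)[OF True, of "p - s"] homF[of p q]
      unfolding p q M2_def by (auto simp: e1 e2 homogeneous_uminus simp del: of_nat_mult mult_Suc_right)
  next
    case False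
    then show ?thesis
      using assms homF[of "q - Suc s" "p - s"]
      unfolding p q M2_def by (auto simp: e1 m_def simp del: of_nat_mult mult_Suc_right)
  qed
qed

lemma hom_M3:
  assumes "p < m"
  shows "homogeneous (shifts3 ! 0 - shifts2 ! p) (M3 p 0)"
proof -
  note p = nth_shifts2[OF assms]
  have "int (d * (t + s + 1)) - int (d * Suc t) = int (s * d)" "int (d * (t + s + 1)) - int (d * Suc s) = int (t * d)"
    by (simp_all add: algebra_simps)
  then show ?thesis
    using assms hom_minor[of p] y(1)[of "p - Suc s"]
    unfolding p M3_def by (auto simp: shifts3_def m_def simp del: of_nat_mult mult_Suc_right)
qed

lemma length_shifts: "length shifts1 = m" "length shifts2 = m" "length shifts3 = 1"
  by (simp_all add: shifts1_def shifts2_def shifts3_def m_def)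

lemma irrelevant_idealI:
  fixes f :: "('v, 'k) mpoly"
  assumes "homogeneous (int e) f" "e > 0"
  shows "f \<in> irrelevant_ideal"
proof -
  have "Poly_Mapping.single m (c :: 'k) \<in> irrelevant_ideal" if "mdeg m > 0" for m :: "'v \<Rightarrow>\<^sub>0 nat" and c
  proof -
    have "m \<noteq> 0" using that by auto
    then obtain i where "Poly_Mapping.lookup m i \<noteq> 0" by (metis lookup_zero poly_mapping_eqI)
    then obtain b where "m = Poly_Mapping.single i 1 + b" using add_single_if_lookup[of m i] by blast
    then have "Poly_Mapping.single m c = Poly_Mapping.single b c * Var i"
      by (simp add: Var_def mult_single add.commute)
    moreover have "Var i \<in> (irrelevant_ideal :: ('v, 'k) mpoly set)"
      unfolding irrelevant_ideal_eq by (rule subsetD[OF gen_ideal_superset]) (rule rangeI)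
    ultimately show ?thesis
      unfolding irrelevant_ideal_eq using ring_ideal_mult[OF ring_ideal_gen] by metis
  qed
  moreover have "mdeg m > 0" if "m \<in> Poly_Mapping.keys f" for m
    using assms that by (auto simp: homogeneous_iff in_keys_iff)
  ultimately have "(\<Sum>m\<in>Poly_Mapping.keys f. Poly_Mapping.single m (Poly_Mapping.lookup f m)) \<in> irrelevant_ideal"
    unfolding irrelevant_ideal_eq by (intro ring_ideal_sum ring_ideal_gen) blast
  then show ?thesis using poly_mapping_sum_single[of f] by simp
qed

text \<open>The nonzero entries have degree \<open>d\<close> or \<open>(t + 1 - s) d\<close>, both
  positive; no comparison map contributes a constant, so the cone is already minimal.\<close>

lemma M2_irrelevant: "p < m \<Longrightarrow> q < m \<Longrightarrow> M2 p q \<in> irrelevant_ideal"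
proof -
  assume p: "p < m" and q: "q < m"
  have F: "F $$ (i, j) \<in> irrelevant_ideal" if "i < s" "j < Suc s" for i j
    using irrelevant_idealI[OF homF[OF that]] d by simp
  have "(Suc t - s) * d > 0" using d by (simp add: t)
  then have H: "- H j i \<in> irrelevant_ideal" if "i < Suc s" for i j
    using irrelevant_idealI[OF homogeneous_uminus[OF H(1)[OF that]]] by blast
  have "0 \<in> (irrelevant_ideal :: ('v, 'k) mpoly set)"
    unfolding irrelevant_ideal_eq by (intro ring_ideal_0 ring_ideal_gen)
  then show ?thesis using F H p q by (auto simp: M2_def m_def)
qed

lemma M3_irrelevant: "p < m \<Longrightarrow> M3 p q \<in> irrelevant_ideal"
proof -
  assume p: "p < m"
  have "s * d > 0" "t * d > 0" using s d by (auto simp: t)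
  then show ?thesis
    using p irrelevant_idealI[OF hom_minor[of p]] irrelevant_idealI[OF y(1)[of "p - Suc s"]]
    by (auto simp: M3_def m_def)
qed

theorem minimal_free_resolution_J:
  "minimal_free_resolution J [shifts1, shifts2, shifts3]
     [mat 1 m (\<lambda>(i, j). M1 i j), mat m m (\<lambda>(i, j). M2 i j), mat m 1 (\<lambda>(i, j). M3 i j)]"
    (is "minimal_free_resolution J ?Fs ?\<phi>")
  unfolding minimal_free_resolution_def
proof (intro conjI allI impI)
  show "homogeneous_ideal J" using graded_J by (simp add: homogeneous_ideal_iff)
next
  fix i assume "i < length ?Fs"
  then consider "i = 0" | "i = 1" | "i = 2" by fastforce
  then show "graded_hom (?Fs ! i) (([0] # ?Fs) ! i) (?\<phi> ! i)"
    by cases (auto simp: graded_hom_def length_shifts hom_M1 hom_M2 hom_M3)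
next
  show "(\<lambda>v. v $ 0) ` mat_image (?\<phi> ! 0) = J"
  proof -
    have "(\<lambda>w. w 0) ` {w \<in> Fr 1. w 0 \<in> J} = J"
    proof
      show "J \<subseteq> (\<lambda>w. w 0) ` {w \<in> Fr 1. w 0 \<in> J}"
        by (auto intro!: image_eqI[of _ _ "\<lambda>j. if j < 1 then _ else 0"] simp: Fr_def)
    qed auto
    then show ?thesis by (simp add: mat_image_mv image_image image_M1[unfolded One_nat_def, symmetric])
  qed
next
  fix i assume "Suc i < length ?Fs"
  then consider "i = 0" | "i = 1" by fastforce
  then show "mat_kernel (?\<phi> ! i) = mat_image (?\<phi> ! Suc i)"
    by cases (simp_all add: mat_kernel_mv mat_image_mv kernel_M1[unfolded One_nat_def] kernel_M2[unfolded One_nat_def])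
next
  have "vec 1 (0 :: nat \<Rightarrow> ('v, 'k) mpoly) = 0\<^sub>v 1" by (auto simp: zero_vec_def)
  then show "mat_kernel (last ?\<phi>) = {0\<^sub>v (length (last ?Fs))}"
    by (simp add: mat_kernel_mv kernel_M3[unfolded One_nat_def] length_shifts)
next
  fix i assume "0 < i \<and> i < length ?Fs"
  then consider "i = 1" | "i = 2" by fastforce
  then show "elements_mat (?\<phi> ! i) \<subseteq> irrelevant_ideal"
    by cases (auto simp: elements_mat_def M2_irrelevant M3_irrelevant)
qed auto

end

section \<open>Hilbert functions\<close>

text \<open>Extend a basis \<open>K\<close> of the kernel to a basis \<open>C\<close> of
  \<open>V\<close>. A kernel vector in the span of \<open>C - K\<close> has a representation
  supported in both \<open>K\<close> and \<open>C - K\<close>, hence is zero, so \<open>f\<close> is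
  injective there. The finite \<open>B\<close> keeps all cardinalities meaningful.\<close>

lemma rank_nullity:
  assumes f: "Vector_Spaces.linear s1 s2 f" and V: "Modules.module.subspace s1 V"
    and B: "V \<subseteq> Modules.module.span s1 B" "finite B"
  shows "vector_space.dim s1 V =
    vector_space.dim s1 {v \<in> V. f v = 0} + vector_space.dim s2 (f ` V)"
proof -
  interpret f: Vector_Spaces.linear s1 s2 f by fact
  let ?K = "{v \<in> V. f v = 0}"
  obtain K where K: "K \<subseteq> ?K" "f.vs1.independent K" "?K \<subseteq> f.vs1.span K"
    by (rule f.vs1.maximal_independent_subset)
  have "K \<subseteq> V" using K(1) by blast
  obtain C where C: "K \<subseteq> C" "C \<subseteq> V" "f.vs1.independent C" "V \<subseteq> f.vs1.span C"
    by (rule f.vs1.maximal_independent_subset_extend[OF \<open>K \<subseteq> V\<close> K(2)])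
  have finC: "finite C"
    using f.vs1.independent_span_bound[OF B(2) C(3)] C(2) B(1) by blast
  have indD: "f.vs1.independent (C - K)" by (rule f.vs1.independent_mono[OF C(3)]) blast
  have spanV: "f.vs1.span (C - K) \<subseteq> V"
    using C(2) by (intro f.vs1.span_minimal[OF _ V]) blast
  have inj: "inj_on f (f.vs1.span (C - K))"
  proof (subst f.inj_on_iff_eq_0[OF f.vs1.subspace_span], intro ballI impI)
    fix v assume v: "v \<in> f.vs1.span (C - K)" "f v = 0"
    then have vK: "v \<in> f.vs1.span K" using spanV K(3) by blast
    have "f.vs1.representation C v = f.vs1.representation K v"
      by (rule f.vs1.representation_extend[OF C(3) vK C(1)])
    moreover have "f.vs1.representation C v = f.vs1.representation (C - K) v"
      by (rule f.vs1.representation_extend[OF C(3) v(1)]) blast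
    ultimately have r: "f.vs1.representation K v = f.vs1.representation (C - K) v" by simp
    have "f.vs1.representation K v b = 0" for b
    proof (rule ccontr)
      assume "f.vs1.representation K v b \<noteq> 0"
      then have "b \<in> K" "b \<in> C - K"
        using r by (metis f.vs1.representation_ne_zero)+
      then show False by blast
    qed
    moreover have "(\<Sum>b\<in>K. s1 (f.vs1.representation K v b) b) = v"
      by (rule f.vs1.sum_representation_eq[OF K(2) vK finite_subset[OF C(1) finC]]) simp
    ultimately show "v = 0" by simp
  qed
  have "f.vs2.independent (f ` (C - K))"
    by (rule f.independent_injective_image[OF indD inj])
  moreover have "f ` (C - K) \<subseteq> f ` V" using C(2) by blast
  moreover have "f ` V \<subseteq> f.vs2.span (f ` (C - K))"
  proof -
    have "f ` V \<subseteq> f ` f.vs1.span C" using C(4) by blast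
    also have "\<dots> = f.vs2.span (f ` C)" by (rule f.span_image[symmetric])
    also have "f ` C \<subseteq> f.vs2.span (f ` (C - K))"
    proof (rule image_subsetI)
      fix c assume "c \<in> C"
      then show "f c \<in> f.vs2.span (f ` (C - K))"
        using K(1) f.vs2.span_zero f.vs2.span_base[of "f c" "f ` (C - K)"] by (cases "c \<in> K") auto
    qed
    then have "f.vs2.span (f ` C) \<subseteq> f.vs2.span (f ` (C - K))"
      by (rule f.vs2.span_minimal) (rule f.vs2.subspace_span)
    finally show ?thesis .
  qed
  ultimately have "f.vs2.dim (f ` V) = card (f ` (C - K))"
    by (metis f.vs2.basis_card_eq_dim)
  also have "\<dots> = card (C - K)"
    using f.vs1.span_superset inj by (intro card_image inj_on_subset[OF inj])
  finally have "f.vs2.dim (f ` V) = card (C - K)" .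
  moreover have "f.vs1.dim V = card C" using f.vs1.basis_card_eq_dim[OF C(2,4,3)] by simp
  moreover have "f.vs1.dim ?K = card K" using f.vs1.basis_card_eq_dim[OF K(1,3,2)] by simp
  moreover have "card C = card K + card (C - K)"
    using card_Diff_subset[OF finite_subset[OF C(1) finC] C(1)] card_mono[OF finC C(1)] by simp
  ultimately show ?thesis by simp
qed

section \<open>Dimensions of the graded pieces of free modules\<close>

lemma card_mdeg: "CARD('v) = Suc n \<Longrightarrow> card {m :: 'v::finite \<Rightarrow>\<^sub>0 nat. mdeg m = e} = (e + n) choose n"
proof -
  assume n: "CARD('v) = Suc n"
  obtain vs :: "'v list" where vs: "distinct vs" "set vs = UNIV"
    using finite_distinct_list[of "UNIV :: 'v set"] by auto
  have len: "length vs = Suc n" using distinct_card[OF vs(1)] vs(2) n by simp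
  have sum: "sum_list (map g vs) = sum g UNIV" for g :: "'v \<Rightarrow> nat"
    using sum_list_distinct_conv_sum_set[OF vs(1), of g] vs(2) by simp
  have "bij_betw (\<lambda>m. map (Poly_Mapping.lookup m) vs) {m. mdeg m = e} {l. length l = Suc n \<and> sum_list l = e}"
    unfolding bij_betw_def
  proof
    show "inj_on (\<lambda>m. map (Poly_Mapping.lookup m) vs) {m. mdeg m = e}"
      using vs(2) by (auto simp: inj_on_def intro!: poly_mapping_eqI)
    show "(\<lambda>m. map (Poly_Mapping.lookup m) vs) ` {m. mdeg m = e} = {l. length l = Suc n \<and> sum_list l = e}"
    proof
      show "(\<lambda>m. map (Poly_Mapping.lookup m) vs) ` {m. mdeg m = e} \<subseteq> {l. length l = Suc n \<and> sum_list l = e}"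
        by (auto simp: len sum mdeg_def)
      show "{l. length l = Suc n \<and> sum_list l = e} \<subseteq> (\<lambda>m. map (Poly_Mapping.lookup m) vs) ` {m. mdeg m = e}"
      proof
        fix l assume "l \<in> {l. length l = Suc n \<and> sum_list l = e}"
        then have l: "length l = Suc n" "sum_list l = e" by auto
        define g where "g = (\<lambda>x. the (map_of (zip vs l) x))"
        have gl: "map g vs = l"
        proof (rule nth_equalityI)
          fix i assume i: "i < length (map g vs)"
          then show "map g vs ! i = l ! i"
            using map_of_zip_nth[of vs l i] vs(1) l(1) len by (simp add: g_def)
        qed (simp add: l len)
        define m where "m = Abs_poly_mapping g"
        have lm: "Poly_Mapping.lookup m = g" unfolding m_def by (rule lookup_Abs_poly_mapping) simp
        have "mdeg m = e" using sum[of g] gl l(2) by (simp add: mdeg_def lm)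
        moreover have "l = map (Poly_Mapping.lookup m) vs" using gl lm by simp
        ultimately show "l \<in> (\<lambda>m. map (Poly_Mapping.lookup m) vs) ` {m. mdeg m = e}" by blast
      qed
    qed
  qed
  then have "card {m :: 'v \<Rightarrow>\<^sub>0 nat. mdeg m = e} = card {l :: nat list. length l = Suc n \<and> sum_list l = e}"
    by (rule bij_betw_same_card)
  then show ?thesis by (simp add: card_length_sum_list binomial_symmetric[of n "e + n"])
qed

definition fscale :: "'k::field \<Rightarrow> (nat \<Rightarrow> ('v, 'k) mpoly) \<Rightarrow> nat \<Rightarrow> ('v, 'k) mpoly" where
  "fscale c w = (\<lambda>j. const_scale c (w j))"

lemma vector_space_fscale: "vector_space (fscale :: 'k::field \<Rightarrow> (nat \<Rightarrow> ('v, 'k) mpoly) \<Rightarrow> _)"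
  by standard (simp_all add: fscale_def fun_eq_iff mpv.scale_right_distrib mpv.scale_left_distrib)

interpretation fv: vector_space "fscale :: 'k::field \<Rightarrow> (nat \<Rightarrow> ('v, 'k) mpoly) \<Rightarrow> _"
  by (rule vector_space_fscale)

definition graded_piece :: "int \<Rightarrow> int list \<Rightarrow> (nat \<Rightarrow> ('v::finite, 'k::field) mpoly) set" where
  "graded_piece e a = {w \<in> Fr (length a). \<forall>q<length a. homogeneous (e - a ! q) (w q)}"

lemma homogeneous_const_scale: "homogeneous d p \<Longrightarrow> homogeneous d (const_scale c p)"
  using homogeneous_mult[of 0 "Poly_Mapping.single 0 c" d p] homogeneous_single[of 0 c]
  by (simp add: const_scale_def)

lemma subspace_graded_piece: "fv.subspace (graded_piece e a)"
  unfolding fv.subspace_def graded_piece_def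
  by (auto simp: Fr_def fscale_def homogeneous_add homogeneous_const_scale)

text \<open>The degree is an integer, so twists exceeding the degree contribute 0.\<close>

definition mono_count :: "'v::finite itself \<Rightarrow> int \<Rightarrow> nat" where
  "mono_count _ e = card {m :: 'v \<Rightarrow>\<^sub>0 nat. int (mdeg m) = e}"

lemma finite_int_mdeg: "finite {m :: 'v::finite \<Rightarrow>\<^sub>0 nat. int (mdeg m) = e}"
  by (rule finite_subset[OF _ finite_mdeg[of "nat e"]]) auto

lemma mono_count_eq:
  "CARD('v::finite) = Suc n \<Longrightarrow> mono_count TYPE('v) (int e) = (e + n) choose n"
  using card_mdeg[where ?'v = 'v, of n e] by (simp add: mono_count_def)

definition piece_index :: "int \<Rightarrow> int list \<Rightarrow> (nat \<times> ('v::finite \<Rightarrow>\<^sub>0 nat)) set" where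
  "piece_index e a = (SIGMA q:{..<length a}. {m. int (mdeg m) = e - a ! q})"

definition unit_monomial :: "nat \<times> ('v \<Rightarrow>\<^sub>0 nat) \<Rightarrow> nat \<Rightarrow> ('v, 'k::field) mpoly" where
  "unit_monomial x = (\<lambda>j. if j = fst x then Poly_Mapping.single (snd x) 1 else 0)"

lemma finite_piece_index: "finite (piece_index e a)"
  unfolding piece_index_def by (intro finite_SigmaI finite_int_mdeg) simp

lemma lookup_unit_monomial_sum:
  assumes "finite E"
  shows "Poly_Mapping.lookup ((\<Sum>x\<in>E. fscale (c x) (unit_monomial x :: nat \<Rightarrow> ('v, 'k::field) mpoly)) j) m =
    (if (j, m) \<in> E then c (j, m) else 0)"
proof -
  have "Poly_Mapping.lookup ((\<Sum>x\<in>E. fscale (c x) (unit_monomial x :: nat \<Rightarrow> ('v, 'k) mpoly)) j) m =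
      (\<Sum>x\<in>E. if x = (j, m) then c x else 0)"
    unfolding sum_fun_apply lookup_sum
    by (intro sum.cong) (auto simp: fscale_def lookup_const_scale unit_monomial_def lookup_single when_def)
  then show ?thesis using assms by simp
qed

lemma graded_piece_span:
  "graded_piece e a \<subseteq> fv.span ((unit_monomial :: _ \<Rightarrow> nat \<Rightarrow> ('v::finite, 'k::field) mpoly) ` piece_index e a)"
proof
  fix w :: "nat \<Rightarrow> ('v, 'k) mpoly" assume w: "w \<in> graded_piece e a"
  have "w = (\<Sum>x\<in>piece_index e a. fscale (Poly_Mapping.lookup (w (fst x)) (snd x)) (unit_monomial x))"
  proof (rule ext, rule poly_mapping_eqI)
    fix j m
    have "Poly_Mapping.lookup (w j) m = 0" if "(j, m) \<notin> piece_index e a"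
    proof (cases "j < length a")
      case True
      then have "homogeneous (e - a ! j) (w j)" using w by (simp add: graded_piece_def)
      then show ?thesis
        using that True unfolding homogeneous_def piece_index_def
        by (auto simp: in_keys_iff mdeg_def)
    qed (use w in \<open>auto simp: graded_piece_def Fr_def\<close>)
    then show "Poly_Mapping.lookup (w j) m = Poly_Mapping.lookup
        ((\<Sum>x\<in>piece_index e a. fscale (Poly_Mapping.lookup (w (fst x)) (snd x)) (unit_monomial x)) j) m"
      by (simp add: lookup_unit_monomial_sum[OF finite_piece_index])
  qed
  also have "\<dots> \<in> fv.span (unit_monomial ` piece_index e a)"
    by (intro fv.span_sum fv.span_scale fv.span_base) auto
  finally show "w \<in> fv.span (unit_monomial ` piece_index e a)" .
qed

lemma dim_graded_piece:
  "fv.dim (graded_piece e a :: (nat \<Rightarrow> ('v::finite, 'k::field) mpoly) set) =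
    (\<Sum>q<length a. mono_count TYPE('v) (e - a ! q))"
proof -
  let ?u = "unit_monomial :: _ \<Rightarrow> nat \<Rightarrow> ('v, 'k) mpoly"
  let ?E = "piece_index e a :: (nat \<times> ('v \<Rightarrow>\<^sub>0 nat)) set"
  have inj: "inj_on ?u ?E"
  proof (rule inj_onI)
    fix x y :: "nat \<times> ('v \<Rightarrow>\<^sub>0 nat)" assume "?u x = ?u y"
    from arg_cong[OF this, of "\<lambda>f. Poly_Mapping.lookup (f (fst x)) (snd x)"]
    show "x = y" by (auto simp: unit_monomial_def lookup_single when_def prod_eq_iff split: if_splits)
  qed
  have "fv.independent (?u ` ?E)"
  proof (rule fv.independent_if_scalars_zero)
    show "finite (?u ` ?E)" using finite_piece_index by blast
    fix c x assume "(\<Sum>x\<in>?u ` ?E. fscale (c x) x) = 0" and x: "x \<in> ?u ` ?E"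
    then have z: "(\<Sum>x\<in>?E. fscale (c (?u x)) (?u x)) = 0" by (simp add: sum.reindex[OF inj])
    obtain j m where jm: "(j, m) \<in> ?E" "x = ?u (j, m)" using x by auto
    have "Poly_Mapping.lookup ((\<Sum>x\<in>?E. fscale (c (?u x)) (?u x)) j) m = 0" unfolding z by simp
    then show "c x = 0" using jm by (simp add: lookup_unit_monomial_sum[OF finite_piece_index])
  qed
  moreover have "?u ` ?E \<subseteq> graded_piece e a"
    by (auto simp: piece_index_def graded_piece_def unit_monomial_def Fr_def homogeneous_def mdeg_def
      split: if_splits)
  ultimately have "fv.dim (graded_piece e a :: (nat \<Rightarrow> ('v, 'k) mpoly) set) = card (?u ` ?E)"
    using graded_piece_span fv.basis_card_eq_dim by metis
  also have "\<dots> = card ?E" by (rule card_image[OF inj])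
  also have "\<dots> = (\<Sum>q<length a. mono_count TYPE('v) (e - a ! q))"
    unfolding piece_index_def mono_count_def by (subst card_SigmaI) (auto intro: finite_int_mdeg)
  finally show ?thesis .
qed

definition icomp :: "int \<Rightarrow> ('v::finite, 'k::comm_ring_1) mpoly \<Rightarrow> ('v, 'k) mpoly" where
  "icomp e p = (if e < 0 then 0 else hcomp (nat e) p)"

lemma homogeneous_icomp: "homogeneous e (icomp e p)"
  using homogeneous_hcomp[of "nat e" p] by (cases "e < 0") (simp_all add: icomp_def)

lemma icomp_homogeneous: "homogeneous e p \<Longrightarrow> icomp e p = p"
  using hcomp_homogeneous[of "nat e" p "nat e"] by (auto simp: icomp_def homogeneous_neg)

lemma icomp_sum: "icomp e (sum f A) = (\<Sum>x\<in>A. icomp e (f x))"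
  by (simp add: icomp_def hcomp_sum)

lemma icomp_mult:
  assumes p: "homogeneous d p"
  shows "icomp (e + d) (p * q) = p * icomp e q"
proof (cases "d < 0")
  case True
  then have "p = 0" using p by (simp add: homogeneous_neg)
  then show ?thesis by (simp add: icomp_def)
next
  case False
  then have "homogeneous (int (nat d)) p" using p by simp
  from hcomp_mult[OF this, of "nat (e + d)" q] show ?thesis
    using False by (auto simp: icomp_def nat_add_distrib nat_diff_distrib')
qed

text \<open>Exactness passes to graded pieces: a preimage of a homogeneous vector may be replaced by
  its components of degrees \<open>e - b ! q\<close>.\<close>

lemma graded_piece_image:
  fixes M :: "nat \<Rightarrow> nat \<Rightarrow> ('v::finite, 'k::field) mpoly"
  assumes M: "\<And>p q. p < length a \<Longrightarrow> q < length b \<Longrightarrow> homogeneous (b ! q - a ! p) (M p q)"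
  shows "mv (length b) (length a) M ` graded_piece e b =
    mv (length b) (length a) M ` Fr (length b) \<inter> graded_piece e a"
proof
  show "mv (length b) (length a) M ` graded_piece e b \<subseteq> mv (length b) (length a) M ` Fr (length b) \<inter> graded_piece e a"
  proof (rule image_subsetI)
    fix w :: "nat \<Rightarrow> ('v, 'k) mpoly" assume w: "w \<in> graded_piece e b"
    have "homogeneous (e - a ! p) (mv (length b) (length a) M w p)" if "p < length a" for p
    proof -
      have "homogeneous (e - a ! p) (M p q * w q)" if q: "q < length b" for q
        using homogeneous_mult[OF M[OF \<open>p < length a\<close> q], of "e - b ! q" "w q"] w q
        by (simp add: graded_piece_def)
      then show ?thesis using that by (auto simp: mv_def intro!: homogeneous_sum)
    qed
    then have "mv (length b) (length a) M w \<in> graded_piece e a" using mv_Fr by (simp add: graded_piece_def)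
    moreover have "w \<in> Fr (length b)" using w by (simp add: graded_piece_def)
    ultimately show "mv (length b) (length a) M w \<in> mv (length b) (length a) M ` Fr (length b) \<inter> graded_piece e a"
      by blast
  qed
  show "mv (length b) (length a) M ` Fr (length b) \<inter> graded_piece e a \<subseteq> mv (length b) (length a) M ` graded_piece e b"
  proof
    fix u assume "u \<in> mv (length b) (length a) M ` Fr (length b) \<inter> graded_piece e a"
    then obtain w where w: "u = mv (length b) (length a) M w" "u \<in> graded_piece e a" by blast
    define w' where "w' = (\<lambda>q. if q < length b then icomp (e - b ! q) (w q) else 0)"
    have "w' \<in> graded_piece e b" by (auto simp: w'_def graded_piece_def Fr_def homogeneous_icomp)
    moreover have "u = mv (length b) (length a) M w'"
    proof (rule Fr_eqI[OF _ mv_Fr])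
      show "u \<in> Fr (length a)" using w(2) by (simp add: graded_piece_def)
      fix p assume p: "p < length a"
      have "u p = icomp (e - a ! p) (u p)"
        using w(2) p icomp_homogeneous[of "e - a ! p" "u p"] by (simp add: graded_piece_def)
      also have "\<dots> = (\<Sum>q<length b. icomp (e - a ! p) (M p q * w q))"
        using p by (simp add: w(1) mv_def icomp_sum)
      also have "\<dots> = (\<Sum>q<length b. M p q * w' q)"
      proof (intro sum.cong refl)
        fix q assume "q \<in> {..<length b}"
        then have q: "q < length b" by simp
        show "icomp (e - a ! p) (M p q * w q) = M p q * w' q"
          using icomp_mult[OF M[OF p q], of "e - b ! q" "w q"] q by (simp add: w'_def)
      qed
      also have "\<dots> = mv (length b) (length a) M w' p" using p by (simp add: mv_def)
      finally show "u p = mv (length b) (length a) M w' p" .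
    qed
    ultimately show "u \<in> mv (length b) (length a) M ` graded_piece e b" by blast
  qed
qed

lemma linear_mv: "Vector_Spaces.linear fscale fscale (mv a b (M :: nat \<Rightarrow> nat \<Rightarrow> ('v::finite, 'k::field) mpoly))"
proof -
  interpret m: Modules.module_hom smul smul "mv a b M" by (rule module_hom_mv)
  have f: "fscale c w = smul (Poly_Mapping.single 0 c) w" for c and w :: "nat \<Rightarrow> ('v, 'k) mpoly"
    by (simp add: fun_eq_iff fscale_def smul_apply const_scale_def)
  show ?thesis
    by (rule Vector_Spaces.linear.intro[OF vector_space_fscale vector_space_fscale],
        rule module_hom.intro[OF fv.module_axioms fv.module_axioms], unfold_locales)
      (simp_all add: f m.add m.scale)
qed

lemma rank_nullity_mv:
  fixes M :: "nat \<Rightarrow> nat \<Rightarrow> ('v::finite, 'k::field) mpoly"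
  shows "fv.dim (graded_piece e b :: (nat \<Rightarrow> ('v, 'k) mpoly) set) =
    fv.dim {w \<in> graded_piece e b. mv (length b) k M w = 0} + fv.dim (mv (length b) k M ` graded_piece e b)"
  by (rule rank_nullity[OF linear_mv subspace_graded_piece graded_piece_span])
    (intro finite_imageI finite_piece_index)

lemma fv_dim_0: "fv.dim {0 :: nat \<Rightarrow> ('v, 'k::field) mpoly} = 0"
  using fv.dim_span[of "{} :: (nat \<Rightarrow> ('v, 'k) mpoly) set"]
    fv.dim_eq_card_independent[of "{} :: (nat \<Rightarrow> ('v, 'k) mpoly) set"] fv.independent_empty by simp

text \<open>Evaluation at 0 identifies the two spaces; its kernel on \<open>Fr 1\<close> is zero, so
  \<open>rank_nullity\<close> compares the dimensions.\<close>

lemma dim_ideal_piece: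
  fixes I :: "('v::finite, 'k::field) mpoly set"
  assumes I: "ring_ideal I"
  shows "mpv.dim {f \<in> I. homogeneous e f} = fv.dim ({w \<in> Fr 1. w 0 \<in> I} \<inter> graded_piece e [0])"
proof -
  let ?V = "{w \<in> Fr 1. w 0 \<in> I} \<inter> graded_piece e [0]"
  have lin: "Vector_Spaces.linear fscale const_scale (\<lambda>w :: nat \<Rightarrow> ('v, 'k) mpoly. w 0)"
    by (rule Vector_Spaces.linear.intro[OF vector_space_fscale mpv.vector_space_axioms],
        rule module_hom.intro[OF fv.module_axioms mpv.module_axioms], unfold_locales)
      (simp_all add: fscale_def)
  have sub: "fv.subspace ?V"
    using I fv.subspace_0[OF subspace_graded_piece] fv.subspace_add[OF subspace_graded_piece]
      fv.subspace_scale[OF subspace_graded_piece]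
    unfolding fv.subspace_def
    by (auto simp: Fr_def fscale_def const_scale_def intro: ring_ideal_0 ring_ideal_add ring_ideal_mult)
  have "fv.dim ?V = fv.dim {w \<in> ?V. w 0 = 0} + mpv.dim ((\<lambda>w. w 0) ` ?V)"
    by (rule rank_nullity[OF lin sub order_trans[OF Int_lower2 graded_piece_span]])
      (intro finite_imageI finite_piece_index)
  also have "{w \<in> ?V. w 0 = 0} = {0}"
    using I by (auto simp: Fr_def graded_piece_def fun_eq_iff ring_ideal_0) (metis One_nat_def Suc_leI neq0_conv)
  also have "fv.dim {0 :: nat \<Rightarrow> ('v, 'k) mpoly} = 0" by (rule fv_dim_0)
  also have "(\<lambda>w. w 0) ` ?V = {f \<in> I. homogeneous e f}"
  proof
    show "{f \<in> I. homogeneous e f} \<subseteq> (\<lambda>w. w 0) ` ?V"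
      by (auto intro!: image_eqI[of _ _ "\<lambda>j. if j < 1 then _ else 0"] simp: Fr_def graded_piece_def)
  qed (auto simp: graded_piece_def)
  finally show ?thesis by simp
qed

text \<open>\<open>hilbert_function\<close> subtracts natural numbers; this bound shows that the
  subtraction is not truncated.\<close>

lemma mpv_dim_mono:
  fixes A B :: "('v::finite, 'k::field) mpoly set"
  assumes "A \<subseteq> B" "B \<subseteq> mpv.span S" "finite S"
  shows "mpv.dim A \<le> mpv.dim B"
proof -
  obtain a where a: "a \<subseteq> A" "mpv.independent a" "A \<subseteq> mpv.span a"
    by (rule mpv.maximal_independent_subset)
  have "a \<subseteq> B" using a(1) assms(1) by blast
  obtain b where b: "a \<subseteq> b" "b \<subseteq> B" "mpv.independent b" "B \<subseteq> mpv.span b"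
    by (rule mpv.maximal_independent_subset_extend[OF \<open>a \<subseteq> B\<close> a(2)])
  have "finite b" using mpv.independent_span_bound[OF assms(3) b(3)] b(2) assms(2) by blast
  then have "card a \<le> card b" using b(1) by (rule card_mono)
  then show ?thesis
    using mpv.basis_card_eq_dim[OF a(1,3,2)] mpv.basis_card_eq_dim[OF b(2,4,3)] by simp
qed

section \<open>The Hilbert function from the resolution\<close>

context determinantal_pair
begin

text \<open>Rank-nullity for each of the three maps in degree \<open>e\<close>, with kernels
  replaced by images through exactness, gives the alternating sum.\<close>

lemma hilbert_function_J:
  "int (hilbert_function J e) = int (mono_count TYPE('v) (int e))
     - (\<Sum>q<m. int (mono_count TYPE('v) (int e - shifts1 ! q)))
     + (\<Sum>q<m. int (mono_count TYPE('v) (int e - shifts2 ! q)))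
     - int (mono_count TYPE('v) (int e - shifts3 ! 0))"
proof -
  let ?g = "\<lambda>a. graded_piece (int e) a :: (nat \<Rightarrow> ('v, 'k) mpoly) set"
  let ?J = "mpv.dim {f \<in> J. homogeneous (int e) f}"
  have len: "length shifts1 = m" "length shifts2 = m" "length shifts3 = 1" "length [0 :: int] = 1"
    by (simp_all add: length_shifts)
  have "mv m 1 M1 ` ?g shifts1 = {w \<in> Fr 1. w 0 \<in> J} \<inter> ?g [0]"
    using graded_piece_image[of "[0]" shifts1 M1 "int e"] hom_M1
    unfolding len image_M1 by auto
  then have J: "fv.dim (mv m 1 M1 ` ?g shifts1) = ?J"
    using dim_ideal_piece[OF graded_idealD(1)[OF graded_J], of "int e"] by simp
  have im2: "mv m m M2 ` ?g shifts2 = mv m m M2 ` Fr m \<inter> ?g shifts1"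
    using graded_piece_image[of shifts1 shifts2 M2 "int e"] hom_M2 unfolding len by auto
  have im3: "mv 1 m M3 ` ?g shifts3 = mv 1 m M3 ` Fr 1 \<inter> ?g shifts2"
    using graded_piece_image[of shifts2 shifts3 M3 "int e"] hom_M3 unfolding len by auto
  have k1: "{w \<in> ?g shifts1. mv m 1 M1 w = 0} = mv m m M2 ` ?g shifts2"
    unfolding im2 kernel_M1[symmetric] using len by (auto simp: graded_piece_def)
  have k2: "{w \<in> ?g shifts2. mv m m M2 w = 0} = mv 1 m M3 ` ?g shifts3"
    unfolding im3 kernel_M2[symmetric] using len by (auto simp: graded_piece_def)
  have "{w \<in> ?g shifts3. mv 1 m M3 w = 0} \<subseteq> {0}"
    unfolding kernel_M3[symmetric] using len by (auto simp: graded_piece_def)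
  then have k3: "{w \<in> ?g shifts3. mv 1 m M3 w = 0} = {0}"
    using fv.subspace_0[OF subspace_graded_piece] by (auto simp: mv_def fun_eq_iff)
  have d0: "fv.dim {0 :: nat \<Rightarrow> ('v, 'k) mpoly} = 0" by (rule fv_dim_0)
  have r1: "(\<Sum>q<m. mono_count TYPE('v) (int e - shifts1 ! q)) = fv.dim (mv m m M2 ` ?g shifts2) + ?J"
    using rank_nullity_mv[of "int e" shifts1 1 M1] unfolding len k1 J dim_graded_piece .
  have r2: "(\<Sum>q<m. mono_count TYPE('v) (int e - shifts2 ! q)) = fv.dim (mv 1 m M3 ` ?g shifts3) + fv.dim (mv m m M2 ` ?g shifts2)"
    using rank_nullity_mv[of "int e" shifts2 m M2] unfolding len k2 dim_graded_piece .
  have r3: "mono_count TYPE('v) (int e - shifts3 ! 0) = fv.dim (mv 1 m M3 ` ?g shifts3)"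
    using rank_nullity_mv[of "int e" shifts3 m M3] unfolding len k3 dim_graded_piece d0 by simp
  let ?R = "{f :: ('v, 'k) mpoly. homogeneous (int e) f}"
  have R: "mpv.dim ?R = mono_count TYPE('v) (int e)"
  proof -
    have "?R = {f \<in> UNIV. homogeneous (int e) f}" by simp
    moreover have "{w \<in> Fr 1. w 0 \<in> (UNIV :: ('v, 'k) mpoly set)} \<inter> ?g [0] = ?g [0]"
      by (auto simp: graded_piece_def)
    ultimately show ?thesis
      using dim_ideal_piece[of "UNIV :: ('v, 'k) mpoly set" "int e"] dim_graded_piece[where ?'k = 'k, of "int e" "[0]"]
      by (simp add: ring_ideal_def)
  qed
  have "?R \<subseteq> mpv.span ((\<lambda>m. Poly_Mapping.single m 1) ` {m. mdeg m = e})"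
  proof
    fix f :: "('v, 'k) mpoly" assume f: "f \<in> ?R"
    have "f = (\<Sum>m\<in>Poly_Mapping.keys f. const_scale (Poly_Mapping.lookup f m) (Poly_Mapping.single m 1))"
      using poly_mapping_sum_single[of f] by (simp add: const_scale_def mult_single)
    also have "\<dots> \<in> mpv.span ((\<lambda>m. Poly_Mapping.single m 1) ` {m. mdeg m = e})"
      using f by (intro mpv.span_sum mpv.span_scale mpv.span_base) (auto simp: homogeneous_iff in_keys_iff)
    finally show "f \<in> mpv.span ((\<lambda>m. Poly_Mapping.single m 1) ` {m. mdeg m = e})" .
  qed
  then have "?J \<le> mpv.dim ?R"
    by (intro mpv_dim_mono[of _ ?R]) (auto intro: finite_mdeg)
  then have "int (hilbert_function J e) = int (mpv.dim ?R) - int ?J"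
    by (simp add: hilbert_function_def of_nat_diff)
  moreover have "int ?J = (\<Sum>q<m. int (mono_count TYPE('v) (int e - shifts1 ! q)))
      - ((\<Sum>q<m. int (mono_count TYPE('v) (int e - shifts2 ! q))) - int (mono_count TYPE('v) (int e - shifts3 ! 0)))"
    unfolding of_nat_sum[symmetric] r1 r2 r3 by simp
  ultimately show ?thesis unfolding R by simp
qed

end

section \<open>The Hilbert polynomial\<close>

text \<open>The binomial coefficient \<open>x - a + n\<close> over \<open>n\<close> as a polynomial
  in \<open>x\<close>, the Hilbert polynomial of \<open>R(-a)\<close>.\<close>

definition binom_poly :: "nat \<Rightarrow> int \<Rightarrow> rat poly" where
  "binom_poly n a = Polynomial.smult (1 / fact n) (\<Prod>i<n. [:of_nat n - of_nat i - of_int a, 1:])"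

lemma poly_binom_poly:
  assumes "CARD('v::finite) = Suc n" "a \<le> int e"
  shows "poly (binom_poly n a) (of_nat e) = of_nat (mono_count TYPE('v) (int e - a))"
proof -
  define k where "k = nat (int e - a)"
  have k: "int e - a = int k" using assms(2) by (simp add: k_def)
  have "a = int e - int k" using k by simp
  then have ka: "(of_nat e :: rat) - of_int a = of_nat k" by simp
  have "poly (binom_poly n a) (of_nat e) = (\<Prod>i<n. of_nat n - of_nat i - of_int a + of_nat e) / fact n"
    by (simp add: binom_poly_def poly_prod)
  also have "(\<Prod>i<n. of_nat n - of_nat i - of_int a + of_nat e) = (\<Prod>i<n. of_nat (k + n) - of_nat i :: rat)"
    by (intro prod.cong) (simp_all add: ka[symmetric] algebra_simps)
  also have "\<dots> / fact n = of_nat (k + n) gchoose n"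
    by (simp add: gbinomial_prod_rev atLeast0LessThan)
  also have "\<dots> = of_nat ((k + n) choose n)" by (simp only: binomial_gbinomial)
  also have "(k + n) choose n = mono_count TYPE('v) (int e - a)"
    unfolding k by (rule mono_count_eq[OF assms(1), symmetric])
  finally show ?thesis .
qed

lemma binom_poly_pcompose: "binom_poly n a = pcompose (binom_poly n 0) [:- of_int a, 1:]"
  by (simp add: binom_poly_def pcompose_smult pcompose_prod pcompose_pCons)

lemma pcompose_power: "pcompose (p ^ k) q = pcompose p q ^ k"
  by (induction k) (simp_all add: pcompose_1 pcompose_mult)

lemma degree_binom_poly: "degree (binom_poly n a) \<le> n"
  unfolding binom_poly_def
  using degree_prod_sum_le[of "{..<n}" "\<lambda>i. [:of_nat n - of_nat i - of_int a, 1:] :: rat poly"] by simp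

lemma coeff_binom_poly_top: "coeff (binom_poly n a) n = 1 / fact n"
proof -
  let ?p = "\<Prod>i<n. [:of_nat n - of_nat i - of_int a, 1:] :: rat poly"
  have "degree ?p = n" by (subst degree_prod_eq_sum_degree) auto
  moreover have "lead_coeff ?p = 1" by (simp add: lead_coeff_prod)
  ultimately show ?thesis by (simp add: binom_poly_def)
qed

lemma coeff_binom_poly:
  "coeff (binom_poly n a) j =
    (\<Sum>k=j..n. coeff (binom_poly n 0) k * of_nat (k choose j) * (- of_int a) ^ (k - j))"
proof -
  let ?b = "binom_poly n 0"
  have "binom_poly n a = (\<Sum>k\<le>n. Polynomial.smult (coeff ?b k) ([:- of_int a, 1:] ^ k))"
  proof -
    have "?b = (\<Sum>k\<le>n. monom (coeff ?b k) k)" by (rule poly_as_sum_of_monoms'[OF degree_binom_poly, symmetric])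
    then have "binom_poly n a = pcompose (\<Sum>k\<le>n. monom (coeff ?b k) k) [:- of_int a, 1:]"
      using binom_poly_pcompose[of n a] by simp
    also have "\<dots> = (\<Sum>k\<le>n. Polynomial.smult (coeff ?b k) ([:- of_int a, 1:] ^ k))"
      by (simp add: pcompose_sum monom_altdef pcompose_smult pcompose_power pcompose_pCons)
    finally show ?thesis .
  qed
  then have "coeff (binom_poly n a) j = (\<Sum>k\<le>n. coeff ?b k * coeff ([:- of_int a, 1:] ^ k) j)"
    by (simp add: coeff_sum)
  also have "\<dots> = (\<Sum>k=j..n. coeff ?b k * coeff ([:- of_int a, 1:] ^ k) j)"
  proof (rule sum.mono_neutral_right)
    show "\<forall>k\<in>{..n} - {j..n}. coeff ?b k * coeff ([:- of_int a, 1:] ^ k) j = 0"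
    proof
      fix k assume "k \<in> {..n} - {j..n}"
      then have "degree ([:- of_int a, 1 :: rat:] ^ k) < j"
        using degree_power_le[of "[:- of_int a, 1 :: rat:]" k] by auto
      then show "coeff ?b k * coeff ([:- of_int a, 1:] ^ k) j = 0" by (simp add: coeff_eq_0)
    qed
  qed auto
  also have "\<dots> = (\<Sum>k=j..n. coeff ?b k * of_nat (k choose j) * (- of_int a) ^ (k - j))"
    by (intro sum.cong) (simp_all add: coeff_linear_poly_power)
  finally show ?thesis .
qed

text \<open>Power sums of the negated shifts. By the binomial expansion in
  \<open>coeff_binom_poly\<close> the coefficients of \<open>binom_comb\<close> depend on
  \<open>L\<close> only through them.\<close>

definition moment :: "nat \<Rightarrow> (rat \<times> int) list \<Rightarrow> rat" where
  "moment e L = (\<Sum>(c, a)\<leftarrow>L. c * (- of_int a) ^ e)"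

definition binom_comb :: "nat \<Rightarrow> (rat \<times> int) list \<Rightarrow> rat poly" where
  "binom_comb n L = (\<Sum>(c, a)\<leftarrow>L. Polynomial.smult c (binom_poly n a))"

lemma coeff_binom_comb:
  "coeff (binom_comb n L) j =
    (\<Sum>k=j..n. coeff (binom_poly n 0) k * of_nat (k choose j) * moment (k - j) L)"
proof (induction L)
  case (Cons x L)
  obtain c a where x: "x = (c, a)" by (cases x)
  have "coeff (binom_comb n (x # L)) j = c * coeff (binom_poly n a) j + coeff (binom_comb n L) j"
    by (simp add: binom_comb_def x)
  also have "\<dots> = (\<Sum>k=j..n. coeff (binom_poly n 0) k * of_nat (k choose j) * moment (k - j) (x # L))"
    unfolding Cons coeff_binom_poly[of n a] sum_distrib_left sum.distrib[symmetric]
    by (intro sum.cong) (simp_all add: moment_def x algebra_simps)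
  finally show ?case .
qed (simp add: binom_comb_def moment_def)

text \<open>The vanishing moments cancel the three top coefficients. The next one is
  \<open>1 / n!\<close> times \<open>n\<close> over 3 times the third moment, which leaves the
  denominator \<open>(n - 3)! * 6\<close>.\<close>

lemma binom_comb_leading:
  assumes n: "n \<ge> 3" and m: "moment 0 L = 0" "moment 1 L = 0" "moment 2 L = 0" "moment 3 L \<noteq> 0"
  shows "degree (binom_comb n L) = n - 3"
    "fact (n - 3) * lead_coeff (binom_comb n L) = moment 3 L / 6"
proof -
  have zero: "coeff (binom_comb n L) j = 0" if "j > n - 3" for j
  proof -
    have "moment (k - j) L = 0" if "k \<in> {j..n}" for k
    proof -
      have "k - j = 0 \<or> k - j = 1 \<or> k - j = 2" using that \<open>j > n - 3\<close> by auto
      then show ?thesis using m by auto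
    qed
    then show ?thesis unfolding coeff_binom_comb by (intro sum.neutral) auto
  qed
  have "coeff (binom_comb n L) (n - 3) =
      (\<Sum>k\<in>{n}. coeff (binom_poly n 0) k * of_nat (k choose (n - 3)) * moment (k - (n - 3)) L)"
    unfolding coeff_binom_comb
  proof (rule sum.mono_neutral_right)
    show "\<forall>k\<in>{n - 3..n} - {n}. coeff (binom_poly n 0) k * of_nat (k choose (n - 3)) * moment (k - (n - 3)) L = 0"
    proof
      fix k assume "k \<in> {n - 3..n} - {n}"
      then have "k - (n - 3) = 0 \<or> k - (n - 3) = 1 \<or> k - (n - 3) = 2" using n by auto
      then have "moment (k - (n - 3)) L = 0" using m by auto
      then show "coeff (binom_poly n 0) k * of_nat (k choose (n - 3)) * moment (k - (n - 3)) L = 0" by simp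
    qed
  qed auto
  also have "\<dots> = of_nat (n choose (n - 3)) / fact n * moment 3 L"
    using n by (simp add: coeff_binom_poly_top)
  also have "(of_nat (n choose (n - 3)) :: rat) = fact n / (fact (n - 3) * 6)"
    using n binomial_fact[of "n - 3" n, where ?'a = rat] by (simp add: numeral_3_eq_3 fact_numeral)
  finally have top: "coeff (binom_comb n L) (n - 3) = moment 3 L / (fact (n - 3) * 6)" by simp
  then have "coeff (binom_comb n L) (n - 3) \<noteq> 0" using m(4) by simp
  then show deg: "degree (binom_comb n L) = n - 3"
    using zero le_degree[of "binom_comb n L" "n - 3"] degree_le[of "n - 3" "binom_comb n L"] by (metis antisym)
  show "fact (n - 3) * lead_coeff (binom_comb n L) = moment 3 L / 6"
    unfolding deg top by simp
qed

lemma hilbert_polynomial_eqI: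
  assumes "\<forall>\<^sub>F e in sequentially. of_nat (hilbert_function I e) = poly p (of_nat e)"
  shows "hilbert_polynomial I = p"
  unfolding hilbert_polynomial_def
proof (rule the_equality)
  show "\<forall>\<^sub>F e in sequentially. of_nat (hilbert_function I e) = poly p (of_nat e)" by fact
next
  fix q :: "rat poly" assume "\<forall>\<^sub>F e in sequentially. of_nat (hilbert_function I e) = poly q (of_nat e)"
  with assms have "\<forall>\<^sub>F e in sequentially. poly (q - p) (of_nat e) = 0"
    by eventually_elim simp
  then obtain N where N: "\<And>e. e \<ge> N \<Longrightarrow> poly (q - p) (of_nat e) = 0"
    unfolding eventually_sequentially by blast
  have "infinite (of_nat ` {N..} :: rat set)"
    by (subst finite_image_iff) (auto simp: inj_on_def infinite_Ici)
  moreover have "of_nat ` {N..} \<subseteq> {x. poly (q - p) x = 0}" using N by auto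
  ultimately have "infinite {x. poly (q - p) x = 0}" using finite_subset by blast
  then have "q - p = 0" using poly_roots_finite by blast
  then show "q = p" by simp
qed

lemma of_nat_choose_3: "6 * (of_nat (x choose 3) :: rat) = of_nat x * (of_nat x - 1) * (of_nat x - 2)"
  by (simp add: binomial_gbinomial gbinomial_prod_rev numeral_3_eq_3)

section \<open>Hilbert polynomial and degree of \<open>J\<close>\<close>

context determinantal_pair
begin

text \<open>Signed ranks with their shifts; the entry \<open>(1, 0)\<close> stands for
  \<open>R\<close>, since the Hilbert function is that of the quotient by \<open>J\<close>.\<close>

definition betti :: "(rat \<times> int) list" where
  "betti = [(1, 0), (- of_nat s, int (t * d)), (- of_nat (Suc s), int (d * s)),
     (of_nat (Suc s), int (d * Suc t)), (of_nat s, int (d * Suc s)), (- 1, int (d * (t + s + 1)))]"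

lemma sum_shifts1: "(\<Sum>q<m. f (shifts1 ! q)) = of_nat s * f (int (t * d)) + of_nat (Suc s) * f (int (d * s))"
  for f :: "int \<Rightarrow> rat"
proof -
  have "(\<Sum>q<m. f (shifts1 ! q)) = sum_list (map f shifts1)"
    by (simp add: sum_list_sum_nth length_shifts atLeast0LessThan)
  then show ?thesis by (simp add: shifts1_def sum_list_replicate del: replicate_Suc of_nat_mult of_nat_Suc)
qed

lemma sum_shifts2: "(\<Sum>q<m. f (shifts2 ! q)) = of_nat (Suc s) * f (int (d * Suc t)) + of_nat s * f (int (d * Suc s))"
  for f :: "int \<Rightarrow> rat"
proof -
  have "(\<Sum>q<m. f (shifts2 ! q)) = sum_list (map f shifts2)"
    by (simp add: sum_list_sum_nth length_shifts atLeast0LessThan)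
  then show ?thesis by (simp add: shifts2_def sum_list_replicate del: replicate_Suc of_nat_mult of_nat_Suc)
qed

lemma hilbert_polynomial_J: "hilbert_polynomial J = binom_comb n betti"
proof (rule hilbert_polynomial_eqI)
  \<comment> \<open>Any bound above all shifts suffices, so that every term is given by its binomial
    polynomial.\<close>
  define N where "N = t * d + d * s + d * Suc t + d * Suc s + d * (t + s + 1)"
  have "of_nat (hilbert_function J e) = poly (binom_comb n betti) (of_nat e)" if e: "e \<ge> N" for e
  proof -
    define c where "c = (\<lambda>a. of_nat (mono_count TYPE('v) (int e - a)) :: rat)"
    have c: "c a = poly (binom_poly n a) (of_nat e)" if "a \<le> int N" for a
      unfolding c_def using that e by (intro poly_binom_poly[OF n(1), symmetric]) simp
    have "of_nat (hilbert_function J e) = (of_int (int (hilbert_function J e)) :: rat)" by simp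
    also have "\<dots> = c 0 - (\<Sum>q<m. c (shifts1 ! q)) + (\<Sum>q<m. c (shifts2 ! q)) - c (shifts3 ! 0)"
      unfolding hilbert_function_J by (simp add: c_def)
    also have "\<dots> = poly (binom_comb n betti) (of_nat e)"
      unfolding sum_shifts1 sum_shifts2
      by (simp add: binom_comb_def betti_def shifts3_def c N_def del: of_nat_mult of_nat_Suc mult_Suc_right)
    finally show ?thesis .
  qed
  then show "\<forall>\<^sub>F e in sequentially. of_nat (hilbert_function J e) = poly (binom_comb n betti) (of_nat e)"
    unfolding eventually_sequentially by blast
qed

lemma moment_betti:
  fixes S T D :: rat
  defines "S \<equiv> of_nat s" and "T \<equiv> of_nat t" and "D \<equiv> of_nat d"
  shows "moment e betti = 0 ^ e - S * (- (T * D)) ^ e - (S + 1) * (- (D * S)) ^ e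
    + (S + 1) * (- (D * (T + 1))) ^ e + S * (- (D * (S + 1))) ^ e - (- (D * (T + S + 1))) ^ e"
  by (simp add: moment_def betti_def S_def T_def D_def algebra_simps)

text \<open>The factored third moment shows that it is nonzero. In the binomial form,
  \<open>6\<close> times \<open>a\<close> over 3 differs from \<open>a ^ 3\<close> by multiples of
  \<open>a ^ 2\<close> and \<open>a\<close>, which cancel by the vanishing of the lower moments; the
  signs flip because the moments use \<open>- a\<close>.\<close>

lemma moments_betti:
  "moment 0 betti = 0" "moment 1 betti = 0" "moment 2 betti = 0"
  "moment 3 betti = of_nat d ^ 3 * of_nat s * (of_nat s + 1) * (2 * of_nat t + of_nat r + 1)"
  "moment 3 betti = 6 * (of_nat ((d * (t + s + 1)) choose 3) - of_nat (s + 1) * of_nat ((d * (t + 1)) choose 3)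
     + of_nat (s + 1) * of_nat ((d * s) choose 3) + of_nat s * of_nat ((d * t) choose 3)
     - of_nat s * of_nat ((d * (s + 1)) choose 3))"
proof -
  have r: "(of_nat r :: rat) = of_nat t - of_nat s" using t by simp
  show "moment 0 betti = 0" "moment 1 betti = 0" "moment 2 betti = 0"
    "moment 3 betti = of_nat d ^ 3 * of_nat s * (of_nat s + 1) * (2 * of_nat t + of_nat r + 1)"
    unfolding moment_betti r by (simp_all add: power2_eq_square power3_eq_cube algebra_simps)
  show "moment 3 betti = 6 * (of_nat ((d * (t + s + 1)) choose 3) - of_nat (s + 1) * of_nat ((d * (t + 1)) choose 3)
     + of_nat (s + 1) * of_nat ((d * s) choose 3) + of_nat s * of_nat ((d * t) choose 3)
     - of_nat s * of_nat ((d * (s + 1)) choose 3))"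
  proof -
    have cubes: "0 ^ 3 - S * (- (T * D)) ^ 3 - (S + 1) * (- (D * S)) ^ 3 + (S + 1) * (- (D * (T + 1))) ^ 3
        + S * (- (D * (S + 1))) ^ 3 - (- (D * (T + S + 1))) ^ 3 =
      D * (T + S + 1) * (D * (T + S + 1) - 1) * (D * (T + S + 1) - 2)
        - (S + 1) * (D * (T + 1) * (D * (T + 1) - 1) * (D * (T + 1) - 2))
        + (S + 1) * (D * S * (D * S - 1) * (D * S - 2))
        + S * (D * T * (D * T - 1) * (D * T - 2))
        - S * (D * (S + 1) * (D * (S + 1) - 1) * (D * (S + 1) - 2))" for S T D :: rat
      by (simp add: power3_eq_cube algebra_simps)
    have distrib: "6 * (x1 - a * x2 + a * x3 + b * x4 - b * x5) =
        6 * x1 - a * (6 * x2) + a * (6 * x3) + b * (6 * x4) - b * (6 * x5)" for a b x1 x2 x3 x4 x5 :: rat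
      by (simp add: algebra_simps)
    show ?thesis
      unfolding moment_betti distrib of_nat_choose_3 of_nat_mult of_nat_add of_nat_1
      by (rule cubes)
  qed
qed

theorem scheme_degree_J:
  "scheme_degree J = of_nat ((d * (t + s + 1)) choose 3) - of_nat (s + 1) * of_nat ((d * (t + 1)) choose 3)
     + of_nat (s + 1) * of_nat ((d * s) choose 3) + of_nat s * of_nat ((d * t) choose 3)
     - of_nat s * of_nat ((d * (s + 1)) choose 3)"
proof -
  have ne: "moment 3 betti \<noteq> 0" 
  proof -
    have "(of_nat s + 1 :: rat) > 0" "(2 * of_nat t + of_nat r + 1 :: rat) > 0"
      by (simp_all add: add_nonneg_pos)
    then show ?thesis unfolding moments_betti(4) using s d by simp
  qed
  note leading = binom_comb_leading[OF n(2) moments_betti(1-3) ne]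
  have "scheme_degree J = moment 3 betti / 6"
    unfolding scheme_degree_def hilbert_polynomial_J leading(1) by (rule leading(2)[unfolded leading(1)])
  then show ?thesis unfolding moments_betti(5) by simp
qed

end

text \<open>The union is written in the order in which \<open>J\<close> lists the minors of
  \<open>F\<close> before those of the larger matrix.\<close>

lemma set_add_gen_ideal:
  "gen_ideal A <+>\<^bsub>class_ring\<^esub> gen_ideal B = gen_ideal (B \<union> A :: 'a::comm_ring_1 set)"
proof -
  note X = ring_ideal_gen[of A] and Y = ring_ideal_gen[of B]
  have eq: "gen_ideal A <+>\<^bsub>class_ring\<^esub> gen_ideal B = {a + b |a b. a \<in> gen_ideal A \<and> b \<in> gen_ideal B}"
    by (auto simp: set_add_defs)
  show ?thesis
    unfolding eq
  proof
    have "gen_ideal A \<subseteq> gen_ideal (B \<union> A)" "gen_ideal B \<subseteq> gen_ideal (B \<union> A)"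
      using gen_ideal_superset[of "B \<union> A"] by (auto intro!: gen_ideal_minimal[OF ring_ideal_gen])
    then show "{a + b |a b. a \<in> gen_ideal A \<and> b \<in> gen_ideal B} \<subseteq> gen_ideal (B \<union> A)"
      using ring_ideal_add[OF ring_ideal_gen[of "B \<union> A"]] by blast
    show "gen_ideal (B \<union> A) \<subseteq> {a + b |a b. a \<in> gen_ideal A \<and> b \<in> gen_ideal B}" (is "_ \<subseteq> ?S")
    proof (rule gen_ideal_minimal)
      show "ring_ideal ?S"
        unfolding ring_ideal_def
      proof (intro conjI ballI allI)
        have "0 = 0 + (0 :: 'a)" by simp
        then show "0 \<in> ?S" using ring_ideal_0[OF X] ring_ideal_0[OF Y] by blast
        fix x assume "x \<in> ?S"
        then obtain a b where ab: "x = a + b" "a \<in> gen_ideal A" "b \<in> gen_ideal B" by blast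
        have "c * x = c * a + c * b" for c by (simp add: ab(1) distrib_left)
        then show "c * x \<in> ?S" for c
          using ring_ideal_mult[OF X ab(2)] ring_ideal_mult[OF Y ab(3)] by blast
        show "x + y \<in> ?S" if y: "y \<in> ?S" for y
        proof -
          obtain a' b' where ab': "y = a' + b'" "a' \<in> gen_ideal A" "b' \<in> gen_ideal B" using y by blast
          have "x + y = (a + a') + (b + b')" by (simp add: ab(1) ab'(1))
          then show ?thesis using ring_ideal_add[OF X ab(2) ab'(2)] ring_ideal_add[OF Y ab(3) ab'(3)] by blast
        qed
      qed
      show "B \<union> A \<subseteq> ?S"
      proof
        fix x assume "x \<in> B \<union> A"
        then have "(x \<in> gen_ideal A \<and> x = x + 0) \<or> (x \<in> gen_ideal B \<and> x = 0 + x)"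
          using gen_ideal_superset[of A] gen_ideal_superset[of B] by auto
        then show "x \<in> ?S" using ring_ideal_0[OF X] ring_ideal_0[OF Y] by blast
      qed
    qed
  qed
qed

theorem proposition3p6:
  fixes n d t r :: nat
    and F G M_t M_tr :: "('v::finite, 'k::{alg_closed_field, field_char_0}) mpoly mat"
    and X_t X_tr Y :: "('v, 'k) mpoly set"
  assumes n: "CARD('v) = n + 1" "n \<ge> 3"
    and params: "d \<ge> 1" "t \<ge> 2" "1 \<le> r" "r \<le> t - 1"
    and F: "F \<in> carrier_mat (t - r) (t - r + 1)"
           "\<And>i j. i < t - r \<Longrightarrow> j < t - r + 1 \<Longrightarrow> homogeneous (int d) (F $$ (i, j))"
    and G: "G \<in> carrier_mat t (r + 1)"
           "\<And>i j. i < t \<Longrightarrow> j < r + 1 \<Longrightarrow> homogeneous (int d) (G $$ (i, j))"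
    and M_tr: "M_tr = F"
    and M_t: "M_t = mat t (t + 1) (\<lambda>(i, j).
                if j < r + 1 then G $$ (i, j)
                else if i < t - r + 1 then F $$ (j - (r + 1), i)
                else 0)"
    and X_t: "is_subscheme X_t" "codimension X_t = 2" "arithmetically_cohen_macaulay X_t"
             "defined_by_maximal_minors X_t M_t"
    and X_tr: "is_subscheme X_tr" "codimension X_tr = 2" "arithmetically_cohen_macaulay X_tr"
              "defined_by_maximal_minors X_tr M_tr"
    and proper: "components X_t \<inter> components X_tr = {}"
    and Y: "Y = scheme_Int X_t X_tr"
  shows "is_subscheme Y \<and> codimension Y = 3 \<and> arithmetically_gorenstein Y
    \<and> has_minimal_free_resolution Y
        [replicate (t - r) (int (t * d)) @ replicate (t - r + 1) (int (d * (t - r))),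
         replicate (t - r + 1) (int (d * (t + 1))) @ replicate (t - r) (int (d * (t - r + 1))),
         [int (d * (2 * t - r + 1))]]
    \<and> scheme_degree Y =
        of_nat ((d * (2 * t - r + 1)) choose 3)
        - of_nat (t - r + 1) * of_nat ((d * (t + 1)) choose 3)
        + of_nat (t - r + 1) * of_nat ((d * (t - r)) choose 3)
        + of_nat (t - r) * of_nat ((d * t) choose 3)
        - of_nat (t - r) * of_nat ((d * (t - r + 1)) choose 3)"
proof -
  define s where "s = t - r"
  define A where "A = minor F ` {..<Suc s}"
  define B where "B = minor M_t ` {..<Suc t}"
  define J where "J = gen_ideal (A \<union> B)"
  have s1: "s \<ge> 1" and t_eq: "t = r + s" using params by (auto simp: s_def)
  have F': "F \<in> carrier_mat s (Suc s)" using F(1) by (simp add: s_def)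
  have homF': "\<And>i j. i < s \<Longrightarrow> j < Suc s \<Longrightarrow> homogeneous (int d) (F $$ (i, j))"
    using F(2) by (simp add: s_def)
  have G': "G \<in> carrier_mat t (Suc r)" using G(1) by simp
  have homG': "\<And>i j. i < t \<Longrightarrow> j < Suc r \<Longrightarrow> homogeneous (int d) (G $$ (i, j))"
    using G(2) by simp
  have Mt': "M_t \<in> carrier_mat t (Suc t)" by (simp add: M_t)
  have Mt_eq: "M_t = mat t (Suc t) (\<lambda>(i, j). if j < Suc r then G $$ (i, j)
      else if i < Suc s then F $$ (j - Suc r, i) else 0)"
    unfolding M_t by (rule eq_matI) (auto simp: s_def)
  have Xtr: "X_tr = gen_ideal A"
    using X_tr(4) by (simp add: defined_by_maximal_minors_def genideal_class_ring M_tr A_def gen_ideal_maximal_minors[OF F'])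
  have Xt: "X_t = gen_ideal B"
    using X_t(4) by (simp add: defined_by_maximal_minors_def genideal_class_ring B_def gen_ideal_maximal_minors[OF Mt'])
  have sub: "X_t \<subseteq> J" "X_tr \<subseteq> J"
    unfolding Xt Xtr J_def using gen_ideal_superset[of "A \<union> B"]
    by (auto intro!: gen_ideal_minimal[OF ring_ideal_gen])
  \<comment> \<open>Both schemes have codimension 2, and \<open>proper\<close> excludes a common
    generic point, so every point of the intersection allows one step more.\<close>
  have "enat (Suc 2) \<le> codimension J"
    by (rule codimension_intersection[OF _ _ proper sub]) (simp_all add: X_t(2) X_tr(2) numeral_eq_enat)
  then have codimJ: "codimension J > enat 2"
    by (rule less_le_trans[rotated]) simp
  have codimF: "codimension (gen_ideal (minor F ` {..<Suc s})) > enat 1"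
    using X_tr(2) by (simp add: Xtr A_def numeral_eq_enat)
  have "Y = saturation J"
    unfolding Y scheme_Int_def Xt Xtr J_def by (simp only: set_add_gen_ideal)
  have n': "CARD('v) = Suc n" using n(1) by simp
  interpret determinantal_pair F s d G r t n M_t J
    by (intro determinantal_pair.intro hilbert_burch.intro determinantal_pair_axioms.intro)
      (fact F' homF' codimF t_eq params(3) s1 params(1) n' n(2) G' homG' Mt_eq J_def[unfolded A_def B_def] codimJ)+
  have YJ: "Y = J"
    using \<open>Y = saturation J\<close> is_subscheme_J by (simp add: is_subscheme_def)
  \<comment> \<open>With \<open>s = t - r\<close> the last twist \<open>d (2 t - r + 1)\<close>
    becomes the \<open>d (t + s + 1)\<close> of the cone.\<close>
  have shift: "2 * t - r = t + s" using t_eq by simp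
  have sh: "[replicate s (int (t * d)) @ replicate (s + 1) (int (d * s)),
         replicate (s + 1) (int (d * (t + 1))) @ replicate s (int (d * (s + 1))),
         [int (d * (t + s + 1))]] = [shifts1, shifts2, shifts3]"
    by (simp add: shifts1_def shifts2_def shifts3_def)
  have res: "has_minimal_free_resolution J [shifts1, shifts2, shifts3]"
    using minimal_free_resolution_J unfolding has_minimal_free_resolution_def by blast
  have codim: "codimension J = 3" using codimension_J by (simp add: numeral_eq_enat)
  have "arithmetically_gorenstein J"
    unfolding arithmetically_gorenstein_def
  proof (intro exI conjI)
    show "codimension J = enat (length [shifts1, shifts2, shifts3])" by (simp add: codimension_J)
    show "has_minimal_free_resolution J [shifts1, shifts2, shifts3]" by (rule res)
    show "last [shifts1, shifts2, shifts3] = [int (d * (t + s + 1))]" by (simp add: shifts3_def)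
  qed
  then show ?thesis
    unfolding YJ shift s_def[symmetric] sh using is_subscheme_J codim res scheme_degree_J by blast
qed

end
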